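(* Let $A$ be a brick-finite finite dimensional algebra over a field $k$. The following are equivalent: (1) $A$ is brick-directed; (2) the lattice $\operatorname{tors} A$ is left modular; (3) the lattice $\operatorname{tors} A$ is extremal; (4) the lattice $\operatorname{tors} A$ is trim. Moreover, if $A$ satisfies any of these conditions, then the spine of $\operatorname{tors} A$ consists of all brick-splitting torsion classes and it forms a distributive sublattice of $\operatorname{tors} A$.
   Context: $\operatorname{mod} A$ is the category of finitely generated left $A$-modules. A brick is a module $X\in\operatorname{mod} A$ such that $\operatorname{End}_A(X)$ is a division algebra. $A$ is brick-finite if there are only finitely many isomorphism classes of bricks; equivalently, the lattice $\operatorname{tors} A$ of torsion classes in $\operatorname{mod} A$, ordered by inclusion, is finite. A brick-cycle is a sequence $X_0\xrightarrow{f_1}X_1\to\cdots\xrightarrow{f_m}X_m$ with $m\ge 1$, all $X_i$ bricks, $X_0\simeq X_m$, and each $f_j$ non-zero and non-invertible. $A$ is brick-directed if $\operatorname{mod} A$ contains no brick-cycle. A torsion class $\mathcal{T}$ is brick-splitting if every brick belongs to $\mathcal{T}$ or to $\mathcal{T}^{\perp}=\{X\mid\operatorname{Hom}_A(T,X)=0\ \forall T\in\mathcal{T}\}$. Let $L$ be a finite lattice. The length of a chain $x_0<x_1<\cdots<x_r$ is $r$, and the length of $L$ is the maximum of the lengths of its chains. An element $x\in L$ is left modular if $(y\vee x)\wedge z=y\vee(x\wedge z)$ for all $y\le z$ in $L$. $L$ is left modular if it has a maximal chain consisting of left modular elements. $L$ is extremal if its length equals both the number of its join-irreducible elements and the number of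 its meet-irreducible elements ($0$ is not considered join-irreducible and $1$ is not considered meet-irreducible). $L$ is trim if it is both extremal and left modular. The spine of an extremal lattice $L$ is the set of elements lying on some chain of maximal length. *)

theory Defs
  imports "HOL-Algebra.Module" "HOL-Algebra.Complete_Lattice"
begin

section \<open>Finite lattices\<close>

locale finite_lattice = bounded_lattice L for L (structure) +
  assumes finite_carrier: "finite (carrier L)"

abbreviation lattice_chain :: "('a, 'b) gorder_scheme \<Rightarrow> 'a set \<Rightarrow> bool"
  where "lattice_chain L \<equiv> pred_on.chain (carrier L) (lless L)"

abbreviation lattice_maxchain :: "('a, 'b) gorder_scheme \<Rightarrow> 'a set \<Rightarrow> bool"
  where "lattice_maxchain L \<equiv> pred_on.maxchain (carrier L) (lless L)"

text \<open>A chain is given by its set of elements, so that the chain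
  \<open>x\<^sub>0 < \<dots> < x\<^sub>r\<close> of length \<open>r\<close> has cardinality \<open>r + 1\<close>.\<close>

definition lattice_length :: "('a, 'b) gorder_scheme \<Rightarrow> nat"
  where "lattice_length L = Max {card C - 1 | C. lattice_chain L C \<and> C \<noteq> {}}"

definition left_modular_element :: "('a, 'b) gorder_scheme \<Rightarrow> 'a \<Rightarrow> bool"
  where "left_modular_element L x \<longleftrightarrow> x \<in> carrier L \<and>
    (\<forall>y\<in>carrier L. \<forall>z\<in>carrier L. y \<sqsubseteq>\<^bsub>L\<^esub> z \<longrightarrow>
      (y \<squnion>\<^bsub>L\<^esub> x) \<sqinter>\<^bsub>L\<^esub> z = y \<squnion>\<^bsub>L\<^esub> (x \<sqinter>\<^bsub>L\<^esub> z))"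

definition left_modular_lattice :: "('a, 'b) gorder_scheme \<Rightarrow> bool"
  where "left_modular_lattice L \<longleftrightarrow> finite_lattice L \<and>
    (\<exists>C. lattice_maxchain L C \<and> (\<forall>x\<in>C. left_modular_element L x))"

definition join_irreducible :: "('a, 'b) gorder_scheme \<Rightarrow> 'a \<Rightarrow> bool"
  where "join_irreducible L x \<longleftrightarrow> x \<in> carrier L \<and> x \<noteq> \<bottom>\<^bsub>L\<^esub> \<and>
    (\<forall>y\<in>carrier L. \<forall>z\<in>carrier L. x = y \<squnion>\<^bsub>L\<^esub> z \<longrightarrow> x = y \<or> x = z)"

definition meet_irreducible :: "('a, 'b) gorder_scheme \<Rightarrow> 'a \<Rightarrow> bool"
  where "meet_irreducible L x \<longleftrightarrow> x \<in> carrier L \<and> x \<noteq> \<top>\<^bsub>L\<^esub> \<and>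
    (\<forall>y\<in>carrier L. \<forall>z\<in>carrier L. x = y \<sqinter>\<^bsub>L\<^esub> z \<longrightarrow> x = y \<or> x = z)"

definition extremal_lattice :: "('a, 'b) gorder_scheme \<Rightarrow> bool"
  where "extremal_lattice L \<longleftrightarrow> finite_lattice L \<and>
    lattice_length L = card {x. join_irreducible L x} \<and>
    lattice_length L = card {x. meet_irreducible L x}"

definition trim_lattice :: "('a, 'b) gorder_scheme \<Rightarrow> bool"
  where "trim_lattice L \<longleftrightarrow> extremal_lattice L \<and> left_modular_lattice L"

definition spine :: "('a, 'b) gorder_scheme \<Rightarrow> 'a set"
  where "spine L = \<Union>{C. lattice_chain L C \<and> C \<noteq> {} \<and> card C - 1 = lattice_length L}"

definition distributive_sublattice :: "('a, 'b) gorder_scheme \<Rightarrow> 'a set \<Rightarrow> bool"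
  where "distributive_sublattice L S \<longleftrightarrow> S \<subseteq> carrier L \<and> S \<noteq> {} \<and>
    (\<forall>x\<in>S. \<forall>y\<in>S. x \<squnion>\<^bsub>L\<^esub> y \<in> S \<and> x \<sqinter>\<^bsub>L\<^esub> y \<in> S) \<and>
    (\<forall>x\<in>S. \<forall>y\<in>S. \<forall>z\<in>S. x \<sqinter>\<^bsub>L\<^esub> (y \<squnion>\<^bsub>L\<^esub> z) = (x \<sqinter>\<^bsub>L\<^esub> y) \<squnion>\<^bsub>L\<^esub> (x \<sqinter>\<^bsub>L\<^esub> z))"


section \<open>Algebras and modules\<close>

text \<open>The locale \<^locale>\<open>module\<close> requires a commutative base ring; here the base ring
  is arbitrary. Modules use the record type of the library, whose ring
  multiplication and unit play no role for them.\<close>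

locale left_module = R?: ring R + M?: abelian_group M
  for R :: "('r, 'c) ring_scheme" (structure) and M :: "('r, 'm, 'd) module_scheme" (structure) +
  assumes smult_closed [simp, intro]:
      "\<lbrakk>a \<in> carrier R; x \<in> carrier M\<rbrakk> \<Longrightarrow> a \<odot>\<^bsub>M\<^esub> x \<in> carrier M"
    and smult_l_distr:
      "\<lbrakk>a \<in> carrier R; b \<in> carrier R; x \<in> carrier M\<rbrakk> \<Longrightarrow>
        (a \<oplus>\<^bsub>R\<^esub> b) \<odot>\<^bsub>M\<^esub> x = a \<odot>\<^bsub>M\<^esub> x \<oplus>\<^bsub>M\<^esub> b \<odot>\<^bsub>M\<^esub> x"
    and smult_r_distr:
      "\<lbrakk>a \<in> carrier R; x \<in> carrier M; y \<in> carrier M\<rbrakk> \<Longrightarrow>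
        a \<odot>\<^bsub>M\<^esub> (x \<oplus>\<^bsub>M\<^esub> y) = a \<odot>\<^bsub>M\<^esub> x \<oplus>\<^bsub>M\<^esub> a \<odot>\<^bsub>M\<^esub> y"
    and smult_assoc:
      "\<lbrakk>a \<in> carrier R; b \<in> carrier R; x \<in> carrier M\<rbrakk> \<Longrightarrow>
        (a \<otimes>\<^bsub>R\<^esub> b) \<odot>\<^bsub>M\<^esub> x = a \<odot>\<^bsub>M\<^esub> (b \<odot>\<^bsub>M\<^esub> x)"
    and smult_one [simp]: "x \<in> carrier M \<Longrightarrow> \<one>\<^bsub>R\<^esub> \<odot>\<^bsub>M\<^esub> x = x"

definition finitely_generated ::
    "('r, 'c) ring_scheme \<Rightarrow> ('r, 'm, 'd) module_scheme \<Rightarrow> bool"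
  where "finitely_generated R M \<longleftrightarrow>
    (\<exists>S. finite S \<and> S \<subseteq> carrier M \<and>
      (\<forall>x\<in>carrier M. \<exists>c\<in>S \<rightarrow> carrier R. x = (\<Oplus>\<^bsub>M\<^esub>s\<in>S. c s \<odot>\<^bsub>M\<^esub> s)))"

text \<open>The locale \<^locale>\<open>algebra\<close> describes commutative algebras only.\<close>

locale findim_algebra = K?: field K + module K A + A?: ring A
  for K :: "('k, 'c) ring_scheme" (structure) and A :: "('k, 'a, 'd) module_scheme" (structure) +
  assumes smult_mult_left:
      "\<lbrakk>c \<in> carrier K; x \<in> carrier A; y \<in> carrier A\<rbrakk> \<Longrightarrow>
        (c \<odot>\<^bsub>A\<^esub> x) \<otimes>\<^bsub>A\<^esub> y = c \<odot>\<^bsub>A\<^esub> (x \<otimes>\<^bsub>A\<^esub> y)"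
    and smult_mult_right:
      "\<lbrakk>c \<in> carrier K; x \<in> carrier A; y \<in> carrier A\<rbrakk> \<Longrightarrow>
        x \<otimes>\<^bsub>A\<^esub> (c \<odot>\<^bsub>A\<^esub> y) = c \<odot>\<^bsub>A\<^esub> (x \<otimes>\<^bsub>A\<^esub> y)"
    and finite_dimensional: "finitely_generated K A"

definition mod_hom ::
    "('r, 'c) ring_scheme \<Rightarrow> ('r, 'm, 'd) module_scheme \<Rightarrow> ('r, 'n, 'e) module_scheme
      \<Rightarrow> ('m \<Rightarrow> 'n) set"
  where "mod_hom R M N = {f \<in> carrier M \<rightarrow>\<^sub>E carrier N.
    (\<forall>x\<in>carrier M. \<forall>y\<in>carrier M. f (x \<oplus>\<^bsub>M\<^esub> y) = f x \<oplus>\<^bsub>N\<^esub> f y) \<and>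
    (\<forall>a\<in>carrier R. \<forall>x\<in>carrier M. f (a \<odot>\<^bsub>M\<^esub> x) = a \<odot>\<^bsub>N\<^esub> f x)}"

definition zero_hom ::
    "('r, 'm, 'd) module_scheme \<Rightarrow> ('r, 'n, 'e) module_scheme \<Rightarrow> 'm \<Rightarrow> 'n"
  where "zero_hom M N = (\<lambda>x\<in>carrier M. \<zero>\<^bsub>N\<^esub>)"

definition mod_iso ::
    "('r, 'c) ring_scheme \<Rightarrow> ('r, 'm, 'd) module_scheme \<Rightarrow> ('r, 'n, 'e) module_scheme
      \<Rightarrow> ('m \<Rightarrow> 'n) set"
  where "mod_iso R M N = {f \<in> mod_hom R M N. bij_betw f (carrier M) (carrier N)}"

text \<open>The finitely generated left modules with carrier in a fixed type. The type
  \<^typ>\<open>'a list\<close> is large enough for every finitely generated \<open>A\<close>-module to have an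
  isomorphic copy here, see \<open>mod_cat_essentially_all\<close> below.\<close>

definition mod_cat :: "('a, 'c) ring_scheme \<Rightarrow> ('a, 'a list) module set"
  where "mod_cat A = {M. left_module A M \<and> finitely_generated A M}"

definition End_ring :: "('r, 'c) ring_scheme \<Rightarrow> ('r, 'm, 'd) module_scheme \<Rightarrow> ('m \<Rightarrow> 'm) ring"
  where "End_ring R M =
    \<lparr>carrier = mod_hom R M M,
     mult = compose (carrier M),
     one = (\<lambda>x\<in>carrier M. x),
     zero = zero_hom M M,
     add = (\<lambda>f g. \<lambda>x\<in>carrier M. f x \<oplus>\<^bsub>M\<^esub> g x)\<rparr>"

locale division_ring = ring R for R (structure) +
  assumes one_neq_zero: "\<one> \<noteq> \<zero>"
    and division_Units: "Units R = carrier R - {\<zero>}"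


section \<open>Bricks and torsion classes\<close>

definition brick :: "('a, 'c) ring_scheme \<Rightarrow> ('a, 'a list) module \<Rightarrow> bool"
  where "brick A X \<longleftrightarrow> X \<in> mod_cat A \<and> division_ring (End_ring A X)"

definition brick_iso_rel :: "('a, 'c) ring_scheme \<Rightarrow> ('a, 'a list) module rel"
  where "brick_iso_rel A = {(X, Y). brick A X \<and> brick A Y \<and> mod_iso A X Y \<noteq> {}}"

definition brick_finite :: "('a, 'c) ring_scheme \<Rightarrow> bool"
  where "brick_finite A \<longleftrightarrow> finite ({X. brick A X} // brick_iso_rel A)"

definition brick_cycle ::
    "('a, 'c) ring_scheme \<Rightarrow> nat \<Rightarrow> (nat \<Rightarrow> ('a, 'a list) module)
      \<Rightarrow> (nat \<Rightarrow> 'a list \<Rightarrow> 'a list) \<Rightarrow> bool"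
  where "brick_cycle A m X f \<longleftrightarrow> 1 \<le> m \<and>
    (\<forall>i\<le>m. brick A (X i)) \<and> mod_iso A (X 0) (X m) \<noteq> {} \<and>
    (\<forall>j\<in>{1..m}. f j \<in> mod_hom A (X (j - 1)) (X j) \<and>
      f j \<noteq> zero_hom (X (j - 1)) (X j) \<and> f j \<notin> mod_iso A (X (j - 1)) (X j))"

definition brick_directed :: "('a, 'c) ring_scheme \<Rightarrow> bool"
  where "brick_directed A \<longleftrightarrow> (\<nexists>m X f. brick_cycle A m X f)"

text \<open>The last condition is closure under extensions
  \<open>0 \<rightarrow> X \<rightarrow> Y \<rightarrow> Z \<rightarrow> 0\<close>; closure under isomorphism is part of closure under quotients.\<close>

definition torsion_class :: "('a, 'c) ring_scheme \<Rightarrow> ('a, 'a list) module set \<Rightarrow> bool"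
  where "torsion_class A T \<longleftrightarrow> T \<subseteq> mod_cat A \<and> T \<noteq> {} \<and>
    (\<forall>X\<in>T. \<forall>Y\<in>mod_cat A. \<forall>f\<in>mod_hom A X Y. f ` carrier X = carrier Y \<longrightarrow> Y \<in> T) \<and>
    (\<forall>X\<in>T. \<forall>Y\<in>mod_cat A. \<forall>Z\<in>T. \<forall>f\<in>mod_hom A X Y. \<forall>g\<in>mod_hom A Y Z.
      inj_on f (carrier X) \<and> f ` carrier X = {y \<in> carrier Y. g y = \<zero>\<^bsub>Z\<^esub>} \<and>
      g ` carrier Y = carrier Z \<longrightarrow> Y \<in> T)"

definition tors :: "('a, 'c) ring_scheme \<Rightarrow> ('a, 'a list) module set gorder"
  where "tors A = \<lparr>carrier = {T. torsion_class A T}, eq = (=), le = (\<subseteq>)\<rparr>"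

definition right_perp ::
    "('a, 'c) ring_scheme \<Rightarrow> ('a, 'a list) module set \<Rightarrow> ('a, 'a list) module set"
  where "right_perp A T =
    {X \<in> mod_cat A. \<forall>Y\<in>T. mod_hom A Y X = {zero_hom Y X}}"

definition brick_splitting :: "('a, 'c) ring_scheme \<Rightarrow> ('a, 'a list) module set \<Rightarrow> bool"
  where "brick_splitting A T \<longleftrightarrow> torsion_class A T \<and>
    (\<forall>X. brick A X \<longrightarrow> X \<in> T \<or> X \<in> right_perp A T)"


section \<open>Adequacy of the encoding\<close>

lemma left_module_transport:
  fixes A :: "('a, 'c) ring_scheme" and M :: "('a, 'm, 'd) module_scheme"
    and g :: "'m \<Rightarrow> 'n"
  assumes M: "left_module A M" and fg: "finitely_generated A M"
    and inj: "inj_on g (carrier M)"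
  shows "\<exists>N :: ('a, 'n) module. left_module A N \<and> finitely_generated A N \<and> mod_iso A M N \<noteq> {}"
proof -
  interpret left_module A M by fact
  define h where "h = inv_into (carrier M) g"
  define N :: "('a, 'n) module" where "N =
    \<lparr>carrier = g ` carrier M, mult = (\<lambda>x y. x), one = g \<zero>\<^bsub>M\<^esub>, zero = g \<zero>\<^bsub>M\<^esub>,
     add = (\<lambda>x y. g (h x \<oplus>\<^bsub>M\<^esub> h y)), smult = (\<lambda>a x. g (a \<odot>\<^bsub>M\<^esub> h x))\<rparr>"
  have hg [simp]: "h (g x) = x" if "x \<in> carrier M" for x
    using that inj by (simp add: h_def)
  have sel: "carrier N = g ` carrier M" "\<zero>\<^bsub>N\<^esub> = g \<zero>\<^bsub>M\<^esub>"
    "\<And>x y. x \<oplus>\<^bsub>N\<^esub> y = g (h x \<oplus>\<^bsub>M\<^esub> h y)" "\<And>a x. a \<odot>\<^bsub>N\<^esub> x = g (a \<odot>\<^bsub>M\<^esub> h x)"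
    by (simp_all add: N_def)
  have N_ag: "abelian_group N"
  proof (rule abelian_groupI)
    fix x assume "x \<in> carrier N"
    then obtain u where "u \<in> carrier M" "x = g u" by (auto simp: sel)
    then have "g (\<ominus>\<^bsub>M\<^esub> u) \<in> carrier N" "g (\<ominus>\<^bsub>M\<^esub> u) \<oplus>\<^bsub>N\<^esub> x = \<zero>\<^bsub>N\<^esub>"
      by (auto simp: sel M.l_neg)
    then show "\<exists>y\<in>carrier N. y \<oplus>\<^bsub>N\<^esub> x = \<zero>\<^bsub>N\<^esub>" by blast
  qed (auto simp: sel M.a_ac)
  interpret N: abelian_group N by (rule N_ag)
  have N: "left_module A N"
    by (intro left_module.intro left_module_axioms.intro N_ag R.ring_axioms)
       (auto simp: sel smult_l_distr smult_r_distr smult_assoc)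
  define f where "f = restrict g (carrier M)"
  have fhom: "f \<in> mod_hom A M N"
    by (auto simp: mod_hom_def f_def sel)
  have fbij: "bij_betw f (carrier M) (carrier N)"
    using inj by (auto simp: bij_betw_def f_def sel)
  have g_sum: "g (finsum M t S) = finsum N (\<lambda>s. g (t s)) S"
    if "finite S" "t \<in> S \<rightarrow> carrier M" for S :: "'m set" and t
    using that
  proof (induction S rule: finite_induct)
    case empty
    then show ?case by (simp add: sel(2))
  next
    case (insert x S)
    have 1: "finsum M t (insert x S) = t x \<oplus>\<^bsub>M\<^esub> finsum M t S"
      using insert by (intro M.finsum_insert) auto
    have 2: "finsum N (\<lambda>s. g (t s)) (insert x S) = g (t x) \<oplus>\<^bsub>N\<^esub> finsum N (\<lambda>s. g (t s)) S"
      using insert by (intro N.finsum_insert) (auto simp: sel)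
    have "finsum M t S \<in> carrier M" using insert by (intro M.finsum_closed) auto
    moreover have "g (finsum M t S) = finsum N (\<lambda>s. g (t s)) S" using insert by auto
    ultimately show ?case
      unfolding 1 2 using insert by (simp add: sel(3) Pi_iff flip: \<open>g (finsum M t S) = _\<close>)
  qed
  obtain S where S: "finite S" "S \<subseteq> carrier M"
    and gen: "\<And>x. x \<in> carrier M \<Longrightarrow> \<exists>c\<in>S \<rightarrow> carrier A. x = (\<Oplus>\<^bsub>M\<^esub>s\<in>S. c s \<odot>\<^bsub>M\<^esub> s)"
    using fg unfolding finitely_generated_def by blast
  have "finitely_generated A N"
    unfolding finitely_generated_def
  proof (intro exI[of _ "g ` S"] conjI ballI)
    fix y assume "y \<in> carrier N"
    then obtain x where x: "x \<in> carrier M" "y = g x" by (auto simp: sel)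
    obtain c where c: "c \<in> S \<rightarrow> carrier A" "x = (\<Oplus>\<^bsub>M\<^esub>s\<in>S. c s \<odot>\<^bsub>M\<^esub> s)"
      using gen[OF x(1)] by blast
    have cl: "(\<lambda>s. c s \<odot>\<^bsub>M\<^esub> s) \<in> S \<rightarrow> carrier M" using c S by auto
    have inS: "inj_on g S" using inj S inj_on_subset by blast
    have "y = (\<Oplus>\<^bsub>N\<^esub>s\<in>S. g (c s \<odot>\<^bsub>M\<^esub> s))"
      using x c g_sum[OF S(1) cl] by simp
    also have "\<dots> = (\<Oplus>\<^bsub>N\<^esub>s\<in>S. c (h (g s)) \<odot>\<^bsub>N\<^esub> g s)"
      using S cl by (intro N.finsum_cong') (auto simp: sel subset_iff)
    also have "\<dots> = (\<Oplus>\<^bsub>N\<^esub>s\<in>g ` S. c (h s) \<odot>\<^bsub>N\<^esub> s)"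
      using S c inS by (intro N.finsum_reindex[symmetric]) (auto simp: sel subset_iff Pi_iff)
    finally show "\<exists>c\<in>g ` S \<rightarrow> carrier A. y = (\<Oplus>\<^bsub>N\<^esub>s\<in>g ` S. c s \<odot>\<^bsub>N\<^esub> s)"
      using c S by (intro bexI[of _ "\<lambda>s. c (h s)"]) (auto simp: subset_iff Pi_iff)
  qed (use S in \<open>auto simp: sel\<close>)
  with N fhom fbij show ?thesis by (auto simp: mod_iso_def)
qed

theorem mod_cat_essentially_all:
  fixes A :: "('a, 'c) ring_scheme" and M :: "('a, 'm, 'd) module_scheme"
  assumes M: "left_module A M" and fg: "finitely_generated A M"
  shows "\<exists>N\<in>mod_cat A. mod_iso A M N \<noteq> {}"
proof -
  interpret left_module A M by fact
  obtain S where S: "finite S" "S \<subseteq> carrier M"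
    and gen: "\<And>x. x \<in> carrier M \<Longrightarrow> \<exists>c\<in>S \<rightarrow> carrier A. x = (\<Oplus>\<^bsub>M\<^esub>s\<in>S. c s \<odot>\<^bsub>M\<^esub> s)"
    using fg unfolding finitely_generated_def by blast
  obtain ss where ss: "set ss = S" using S finite_list by blast
  define c where "c x = (SOME c. c \<in> S \<rightarrow> carrier A \<and> x = (\<Oplus>\<^bsub>M\<^esub>s\<in>S. c s \<odot>\<^bsub>M\<^esub> s))" for x
  have c: "c x \<in> S \<rightarrow> carrier A" "x = (\<Oplus>\<^bsub>M\<^esub>s\<in>S. c x s \<odot>\<^bsub>M\<^esub> s)" if "x \<in> carrier M" for x
    using someI_ex[OF gen[OF that, unfolded Bex_def]] by (simp_all add: c_def)
  have "inj_on (\<lambda>x. map (c x) ss) (carrier M)"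
  proof (rule inj_onI)
    fix x y assume x: "x \<in> carrier M" and y: "y \<in> carrier M" and "map (c x) ss = map (c y) ss"
    then have eq: "\<And>s. s \<in> S \<Longrightarrow> c x s = c y s" using ss by auto
    have "(\<Oplus>\<^bsub>M\<^esub>s\<in>S. c x s \<odot>\<^bsub>M\<^esub> s) = (\<Oplus>\<^bsub>M\<^esub>s\<in>S. c y s \<odot>\<^bsub>M\<^esub> s)"
      using eq c[OF y] S by (intro M.finsum_cong') auto
    then show "x = y" using c(2)[OF x] c(2)[OF y] by simp
  qed
  from left_module_transport[OF M fg this] show ?thesis
    by (auto simp: mod_cat_def)
qed

lemma torsion_classI:
  assumes "T \<subseteq> mod_cat A" "T \<noteq> {}"
    and "\<And>X Y f. \<lbrakk>X \<in> T; Y \<in> mod_cat A; f \<in> mod_hom A X Y; f ` carrier X = carrier Y\<rbrakk> \<Longrightarrow> Y \<in> T"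
    and "\<And>X Y Z f g. \<lbrakk>X \<in> T; Y \<in> mod_cat A; Z \<in> T; f \<in> mod_hom A X Y; g \<in> mod_hom A Y Z;
      inj_on f (carrier X); f ` carrier X = {y \<in> carrier Y. g y = \<zero>\<^bsub>Z\<^esub>};
      g ` carrier Y = carrier Z\<rbrakk> \<Longrightarrow> Y \<in> T"
  shows "torsion_class A T"
  unfolding torsion_class_def
  by (intro conjI ballI impI; (elim conjE)?) (rule assms(1,2) | erule (3) assms(3) | erule (7) assms(4))+

lemma torsion_class_subset: "torsion_class A T \<Longrightarrow> T \<subseteq> mod_cat A"
  by (simp add: torsion_class_def)

lemma torsion_class_nonempty: "torsion_class A T \<Longrightarrow> T \<noteq> {}"
  by (simp add: torsion_class_def)

lemma torsion_class_quotient: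
  assumes "torsion_class A T"
    and "X \<in> T" "Y \<in> mod_cat A" "f \<in> mod_hom A X Y" "f ` carrier X = carrier Y"
  shows "Y \<in> T"
  using assms(1)[unfolded torsion_class_def, THEN conjunct2, THEN conjunct2, THEN conjunct1,
      rule_format, OF assms(2-5)] .

lemma torsion_class_extension:
  assumes "torsion_class A T"
    and "X \<in> T" "Y \<in> mod_cat A" "Z \<in> T" "f \<in> mod_hom A X Y" "g \<in> mod_hom A Y Z"
    and "inj_on f (carrier X)" "f ` carrier X = {y \<in> carrier Y. g y = \<zero>\<^bsub>Z\<^esub>}"
      "g ` carrier Y = carrier Z"
  shows "Y \<in> T"
  by (rule assms(1)[unfolded torsion_class_def, THEN conjunct2, THEN conjunct2, THEN conjunct2,
      rule_format, OF assms(2-6)]) (intro conjI assms(7-9))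

definition zero_module :: "('a, 'a list) module"
  where "zero_module =
    \<lparr>carrier = {[]}, mult = (\<lambda>x y. []), one = [], zero = [], add = (\<lambda>x y. []),
     smult = (\<lambda>a x. [])\<rparr>"

lemma zero_module_mod_cat:
  assumes "ring A"
  shows "zero_module \<in> mod_cat A"
proof -
  have ag: "abelian_group (zero_module :: ('a, 'a list) module)"
    by (rule abelian_groupI) (simp_all add: zero_module_def)
  then interpret Z: abelian_group "zero_module :: ('a, 'a list) module" .
  have "left_module A zero_module"
    by (intro left_module.intro left_module_axioms.intro ag assms) (simp_all add: zero_module_def)
  moreover have "finitely_generated A zero_module"
    unfolding finitely_generated_def
    by (intro exI[of _ "{}"]) (simp add: zero_module_def Z.finsum_empty[unfolded zero_module_def])
  ultimately show ?thesis by (simp add: mod_cat_def)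
qed

lemma zero_module_torsion_class:
  assumes A: "ring A" and T: "torsion_class A T"
  shows "zero_module \<in> T"
proof -
  obtain X where X: "X \<in> T" using torsion_class_nonempty[OF T] by blast
  then have "left_module A X"
    using torsion_class_subset[OF T] by (auto simp: mod_cat_def)
  then interpret X: left_module A X .
  show ?thesis
  proof (rule torsion_class_quotient[OF T X zero_module_mod_cat[OF A]])
    show "zero_hom X zero_module \<in> mod_hom A X zero_module"
      by (simp add: mod_hom_def zero_hom_def zero_module_def)
    show "zero_hom X zero_module ` carrier X = carrier zero_module"
      using X.M.zero_closed by (auto simp: zero_hom_def zero_module_def)
  qed
qed

lemma torsion_class_Inter:
  assumes A: "ring A" and F: "\<And>T. T \<in> F \<Longrightarrow> torsion_class A T" "F \<noteq> {}"
  shows "torsion_class A (\<Inter>F)"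
proof (rule torsion_classI)
  show "\<Inter>F \<subseteq> mod_cat A" using F torsion_class_subset by blast
  show "\<Inter>F \<noteq> {}" using zero_module_torsion_class[OF A F(1)] by blast
next
  fix X Y f
  assume "X \<in> \<Inter>F" "Y \<in> mod_cat A" "f \<in> mod_hom A X Y" "f ` carrier X = carrier Y"
  then show "Y \<in> \<Inter>F"
    by (intro InterI) (rule torsion_class_quotient[OF F(1)], simp_all)
next
  fix X Y Z f g
  assume *: "X \<in> \<Inter>F" "Y \<in> mod_cat A" "Z \<in> \<Inter>F" "f \<in> mod_hom A X Y" "g \<in> mod_hom A Y Z"
    "inj_on f (carrier X)" "f ` carrier X = {y \<in> carrier Y. g y = \<zero>\<^bsub>Z\<^esub>}"
    "g ` carrier Y = carrier Z"
  show "Y \<in> \<Inter>F"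
  proof (rule InterI)
    fix T assume T: "T \<in> F"
    show "Y \<in> T"
      by (rule torsion_class_extension[OF F(1)[OF T] InterD[OF *(1) T] *(2) InterD[OF *(3) T] *(4-)])
  qed
qed

lemma torsion_class_mod_cat: "ring A \<Longrightarrow> torsion_class A (mod_cat A)"
  using zero_module_mod_cat by (intro torsion_classI) auto

theorem tors_complete_lattice:
  assumes "ring A"
  shows "complete_lattice (tors A)"
proof (rule partial_order.complete_lattice_criterion1)
  show "partial_order (tors A)" by unfold_locales (auto simp: tors_def)
  show "\<exists>T. greatest (tors A) T (carrier (tors A))"
    using torsion_class_mod_cat[OF assms]
    by (intro exI[of _ "mod_cat A"]) (auto simp: greatest_def tors_def dest: torsion_class_subset)
next
  fix F assume F: "F \<subseteq> carrier (tors A)" "F \<noteq> {}"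
  then have "torsion_class A (\<Inter>F)"
    using assms by (intro torsion_class_Inter) (auto simp: tors_def)
  then show "\<exists>T. greatest (tors A) T (Lower (tors A) F)"
    using F by (intro exI[of _ "\<Inter>F"]) (auto simp: greatest_def Lower_def tors_def)
qed

end

theory Submission
  imports Defs
begin

text \<open>A torsion class is determined by the bricks it contains, and the sets of bricks that occur are
  the closed sets of the Galois connection given by the relation \<open>X \<leadsto> Y\<close> iff \<open>Hom(X, Y) \<noteq> 0\<close>
  on isomorphism classes of bricks. Every \<open>X \<leadsto> Y\<close> factors through a brick \<open>Z\<close> with
  \<open>Z \<in> T(X)\<close> and \<open>Z \<in> F(Y)\<close>, the smallest torsion class and the smallest torsion-free class containing
  \<open>X\<close> and \<open>Y\<close>: take \<open>Z\<close> of minimal length among the non-zero modules of \<open>T(X) \<inter> F(Y)\<close>. Everything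
  else is combinatorics of a finite set \<open>Q\<close> with such a relation. Join-irreducible and
  meet-irreducible closed sets both correspond to the elements of \<open>Q\<close>, so the lattice is extremal iff
  it has a chain of length \<open>card Q\<close>. A closed set is left modular iff it is closed under \<open>\<leadsto>\<close>,
  which for torsion classes means brick-splitting. Some maximal chain of the lattice consists of
  such sets precisely when \<open>\<leadsto>\<close> has no cycles, and it then has length \<open>card Q\<close>.\<close>

section \<open>Closed sets of a reflexive relation\<close>

text \<open>The obstacle is that \<open>epi\<close> and \<open>mono\<close> cannot simply be
  surjections and injections of bricks: the image of a non-zero map between bricks need not be a
  brick, and cutting it down to a brick \<open>Z\<close> only keeps \<open>Z\<close> inside T(X) and
  F(Y). Both memberships can be read off from \<open>\<leadsto>\<close> alone, and this is what lets
  the lattice part forget modules. What it has to assume is a two-acyclic factorization system, the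
  combinatorial form of a finite semidistributive lattice; in this setting extremal implies left
  modular, which fails for finite lattices in general. The delicate direction is from left modular
  to acyclic: a maximal chain of up-closed sets is not known in advance to have
  \<open>card Q + 1\<close> members, so no counting is available, and instead each cover in the
  chain is shown to add a single element. On the module side, finite dimension enters only through
  finite generation of submodules and a length that drops on proper submodules and proper
  quotients.\<close>

locale finite_reflexive_relation =
  fixes Q :: "'q set" and R :: "'q \<Rightarrow> 'q \<Rightarrow> bool" (infix \<open>\<leadsto>\<close> 50)
  assumes finite_Q: "finite Q"
    and rel_refl: "x \<in> Q \<Longrightarrow> x \<leadsto> x"
begin

definition rperp :: "'q set \<Rightarrow> 'q set"
  where "rperp S = {y \<in> Q. \<forall>x\<in>S. \<not> x \<leadsto> y}"

definition lperp :: "'q set \<Rightarrow> 'q set"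
  where "lperp S = {x \<in> Q. \<forall>y\<in>S. \<not> x \<leadsto> y}"

abbreviation cl :: "'q set \<Rightarrow> 'q set"
  where "cl S \<equiv> lperp (rperp S)"

definition closed :: "'q set \<Rightarrow> bool"
  where "closed S \<longleftrightarrow> cl S = S"

definition upclosed :: "'q set \<Rightarrow> bool"
  where "upclosed S \<longleftrightarrow> S \<subseteq> Q \<and> (\<forall>x\<in>S. \<forall>y\<in>Q. x \<leadsto> y \<longrightarrow> y \<in> S)"

text \<open>For bricks, \<open>epi x y\<close> says that \<open>y\<close> lies in T(x), and
  \<open>mono x y\<close> below says that \<open>x\<close> lies in F(y). Quotients of
  \<open>x\<close> qualify for the former, but so do iterated extensions of such quotients, so no
  surjection from \<open>x\<close> to \<open>y\<close> is implied.\<close>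

definition epi :: "'q \<Rightarrow> 'q \<Rightarrow> bool"
  where "epi x y \<longleftrightarrow> (\<forall>v\<in>Q. y \<leadsto> v \<longrightarrow> x \<leadsto> v)"

definition mono :: "'q \<Rightarrow> 'q \<Rightarrow> bool"
  where "mono x y \<longleftrightarrow> (\<forall>v\<in>Q. v \<leadsto> x \<longrightarrow> v \<leadsto> y)"

text \<open>Loops are discarded because \<open>\<leadsto>\<close> is reflexive. No brick-cycle gets
  lost: a non-zero endomorphism of a brick is invertible, so no step of a brick-cycle is a
  loop.\<close>

definition acyclic_rel :: bool
  where "acyclic_rel \<longleftrightarrow> acyclic {(x, y). x \<in> Q \<and> y \<in> Q \<and> x \<leadsto> y \<and> x \<noteq> y}"

lemma rperp_subset: "rperp S \<subseteq> Q" by (auto simp: rperp_def)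

lemma lperp_subset: "lperp S \<subseteq> Q" by (auto simp: lperp_def)

lemma rperp_antimono: "S \<subseteq> S' \<Longrightarrow> rperp S' \<subseteq> rperp S" by (auto simp: rperp_def)

lemma lperp_antimono: "S \<subseteq> S' \<Longrightarrow> lperp S' \<subseteq> lperp S" by (auto simp: lperp_def)

lemma cl_extensive: "S \<subseteq> Q \<Longrightarrow> S \<subseteq> cl S" by (auto simp: lperp_def rperp_def)

lemma lperp_closed: "S \<subseteq> Q \<Longrightarrow> closed (lperp S)"
  by (auto simp: closed_def lperp_def rperp_def)

lemma closed_cl: "closed (cl S)" by (rule lperp_closed[OF rperp_subset])

lemma rperp_Un: "rperp (S \<union> S') = rperp S \<inter> rperp S'" by (auto simp: rperp_def)

lemma closed_subset: "closed S \<Longrightarrow> S \<subseteq> Q" using lperp_subset by (auto simp: closed_def)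

lemma cl_least: "closed T \<Longrightarrow> S \<subseteq> T \<Longrightarrow> cl S \<subseteq> T"
  using lperp_antimono rperp_antimono unfolding closed_def by blast

lemma closed_Int: "closed S \<Longrightarrow> closed T \<Longrightarrow> closed (S \<inter> T)"
  using cl_least[of S "S \<inter> T"] cl_least[of T "S \<inter> T"] cl_extensive[of "S \<inter> T"] closed_subset[of S]
  unfolding closed_def by blast

lemma disjoint_rperp: "x \<in> S \<Longrightarrow> x \<in> rperp S \<Longrightarrow> False" using rel_refl by (auto simp: rperp_def)

lemma closed_empty: "closed {}"
  using rel_refl by (auto simp: closed_def lperp_def rperp_def)

lemma closed_Q: "closed Q"
  using rel_refl by (auto simp: closed_def lperp_def rperp_def)

lemma rperp_inj: "closed S \<Longrightarrow> closed T \<Longrightarrow> rperp S = rperp T \<Longrightarrow> S = T"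
  by (metis closed_def)

lemma rperp_upclosed: "upclosed S \<Longrightarrow> rperp S = Q - S"
  using rel_refl by (auto simp: rperp_def upclosed_def)

lemma upclosed_closed: "upclosed S \<Longrightarrow> closed S"
  unfolding closed_def by (simp add: rperp_upclosed) (use rel_refl in \<open>auto simp: lperp_def upclosed_def\<close>)

text \<open>If \<open>S\<close> consists of the bricks in a torsion class, then
  \<open>rperp S\<close> consists of those in its torsion-free class, so the right-hand side is
  brick-splitting.\<close>

lemma upclosed_iff_split:
  "upclosed S \<longleftrightarrow> S \<subseteq> Q \<and> S \<union> rperp S = Q"
  by (auto simp: rperp_upclosed) (auto simp: upclosed_def rperp_def)

lemma upclosed_Un: "upclosed S \<Longrightarrow> upclosed T \<Longrightarrow> upclosed (S \<union> T)"
  by (auto simp: upclosed_def)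

lemma upclosed_Int: "upclosed S \<Longrightarrow> upclosed T \<Longrightarrow> upclosed (S \<inter> T)"
  by (auto simp: upclosed_def)

lemma epi_trans: "epi x y \<Longrightarrow> epi y z \<Longrightarrow> epi x z" by (auto simp: epi_def)

lemma cl_singleton: "x \<in> Q \<Longrightarrow> cl {x} = {y \<in> Q. epi x y}"
  by (auto simp: lperp_def rperp_def epi_def)

text \<open>Together with \<open>rperp_mono\<close> this is how factorizations are exploited: if
  \<open>x\<close> lies in a closed set and \<open>y\<close> in a right perpendicular, then the
  middle term of \<open>x \<leadsto> y\<close> lies in both, usually against
  \<open>disjoint_rperp\<close>.\<close>

lemma closed_epi: "closed T \<Longrightarrow> x \<in> T \<Longrightarrow> y \<in> Q \<Longrightarrow> epi x y \<Longrightarrow> y \<in> T"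
  by (auto simp: closed_def lperp_def rperp_def epi_def)

lemma rperp_mono: "y \<in> rperp T \<Longrightarrow> x \<in> Q \<Longrightarrow> T \<subseteq> Q \<Longrightarrow> mono x y \<Longrightarrow> x \<in> rperp T"
  by (auto simp: rperp_def mono_def)

end

text \<open>Antisymmetry is where bricks matter: a module and its square lie in the same torsion
  classes, so \<open>epi\<close> could not tell them apart. All three collapsing axioms abstract
  from the fact that a non-zero endomorphism of a brick is invertible.\<close>

locale two_acyclic = finite_reflexive_relation +
  assumes factorization: "\<lbrakk>x \<in> Q; y \<in> Q; x \<leadsto> y\<rbrakk> \<Longrightarrow> \<exists>z\<in>Q. epi x z \<and> mono z y"
    and epi_antisym: "\<lbrakk>x \<in> Q; y \<in> Q; epi x y; epi y x\<rbrakk> \<Longrightarrow> x = y"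
    and mono_antisym: "\<lbrakk>x \<in> Q; y \<in> Q; mono x y; mono y x\<rbrakk> \<Longrightarrow> x = y"
    and epi_mono: "\<lbrakk>x \<in> Q; y \<in> Q; epi x y; mono y x\<rbrakk> \<Longrightarrow> x = y"
begin

text \<open>The unique element covered by \<open>cl {x}\<close> is \<open>cl {x} \<inter> lperp {x}\<close>; the next two lemmas
  make \<open>cl {x}\<close> join-irreducible and \<open>lperp {x}\<close> meet-irreducible.\<close>

lemma below_cl_singleton:
  assumes x: "x \<in> Q" and T: "closed T" "T \<subseteq> cl {x}" "x \<notin> T"
  shows "T \<subseteq> lperp {x}"
proof
  fix y assume y: "y \<in> T"
  then have yQ: "y \<in> Q" using T closed_subset by auto
  have "\<not> y \<leadsto> x"
  proof
    assume "y \<leadsto> x"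
    then obtain z where z: "z \<in> Q" "epi y z" "mono z x" using factorization yQ x by blast
    have "epi x y" using T y cl_singleton[OF x] by auto
    then have "epi x z" using z epi_trans by blast
    then have "z = x" using epi_mono[of x z] z x by auto
    then show False using closed_epi[OF T(1) y z(1) z(2)] T by simp
  qed
  then show "y \<in> lperp {x}" using yQ by (auto simp: lperp_def)
qed

lemma above_lperp_singleton:
  assumes x: "x \<in> Q" and T: "closed T" "lperp {x} \<subseteq> T" "x \<notin> rperp T"
  shows "x \<in> T"
proof (rule ccontr)
  assume "x \<notin> T"
  then obtain y where y: "y \<in> rperp T" "x \<leadsto> y"
    using T x by (auto simp: closed_def lperp_def)
  have yQ: "y \<in> Q" using y rperp_subset by auto
  obtain z where z: "z \<in> Q" "epi x z" "mono z y" using factorization[OF x yQ y(2)] by blast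
  have zT: "z \<in> rperp T" using rperp_mono[OF y(1) z(1) closed_subset[OF T(1)] z(3)] .
  then have "z \<notin> lperp {x}" using T disjoint_rperp by auto
  then have "z \<leadsto> x" using z by (auto simp: lperp_def)
  \<comment> \<open>Whatever maps to \<open>z\<close> is outside \<open>T\<close>, hence outside
    \<open>lperp {x}\<close>, hence maps to \<open>x\<close>. With \<open>epi x z\<close> this
    collapses \<open>z\<close> to \<open>x\<close>.\<close>
  have "mono z x" unfolding mono_def
  proof (intro ballI impI)
    fix v assume v: "v \<in> Q" "v \<leadsto> z"
    then have "v \<notin> T" using zT by (auto simp: rperp_def)
    then show "v \<leadsto> x" using T v by (auto simp: lperp_def)
  qed
  then have "x = z" using epi_mono x z by auto
  then show False using zT T by simp
qed

lemma cl_singleton_inj: "\<lbrakk>x \<in> Q; y \<in> Q; cl {x} = cl {y}\<rbrakk> \<Longrightarrow> x = y"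
  using cl_singleton[of x] cl_singleton[of y] epi_antisym[of x y] by (auto simp: epi_def)

lemma lperp_singleton_inj: "\<lbrakk>x \<in> Q; y \<in> Q; lperp {x} = lperp {y}\<rbrakk> \<Longrightarrow> x = y"
  using mono_antisym[of x y] by (auto simp: mono_def lperp_def)

text \<open>One inclusion holds in every lattice. If the other fails at \<open>w\<close>, then
  \<open>w\<close> maps to some \<open>v\<close> perpendicular to the right-hand side, and the
  middle term \<open>u\<close> lies in \<open>Z\<close>, in \<open>cl (Y \<union> T)\<close> and in
  \<open>rperp (Y \<union> (T \<inter> Z))\<close>. Since \<open>T\<close> splits \<open>u\<close>,
  either \<open>u\<close> is in \<open>T \<inter> Z\<close> or it is perpendicular to
  \<open>Y \<union> T\<close>; both contradict reflexivity.\<close>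

lemma upclosed_left_modular:
  assumes T: "upclosed T" and Y: "closed Y" and Z: "closed Z" and YZ: "Y \<subseteq> Z"
  shows "cl (Y \<union> T) \<inter> Z = cl (Y \<union> (T \<inter> Z))"
proof
  have Q: "Y \<subseteq> Q" "Z \<subseteq> Q" "T \<subseteq> Q" using T Y Z closed_subset upclosed_closed by auto
  show "cl (Y \<union> (T \<inter> Z)) \<subseteq> cl (Y \<union> T) \<inter> Z"
    using cl_least[OF Z, of "Y \<union> (T \<inter> Z)"] YZ
      lperp_antimono[OF rperp_antimono[of "Y \<union> (T \<inter> Z)" "Y \<union> T"]] by blast
  show "cl (Y \<union> T) \<inter> Z \<subseteq> cl (Y \<union> (T \<inter> Z))"
  proof
    fix w assume w: "w \<in> cl (Y \<union> T) \<inter> Z"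
    then have wQ: "w \<in> Q" using Q by auto
    have "\<not> w \<leadsto> v" if v: "v \<in> rperp (Y \<union> (T \<inter> Z))" for v
    proof
      assume "w \<leadsto> v"
      moreover have "v \<in> Q" using v rperp_subset by auto
      ultimately obtain u where u: "u \<in> Q" "epi w u" "mono u v" using factorization wQ by blast
      have 1: "u \<in> cl (Y \<union> T)" "u \<in> Z"
        using closed_epi[OF closed_cl _ u(1,2)] closed_epi[OF Z _ u(1,2)] w by auto
      have 2: "u \<in> rperp (Y \<union> (T \<inter> Z))"
        using rperp_mono[OF v u(1) _ u(3)] Q by auto
      have "u \<notin> T" using 1 2 disjoint_rperp[of u "Y \<union> (T \<inter> Z)"] by auto
      then have "u \<in> rperp T" using rperp_upclosed[OF T] u by auto
      then have "u \<in> rperp (Y \<union> T)" using 2 by (simp add: rperp_Un)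
      then show False using 1 rel_refl u by (auto simp: lperp_def)
    qed
    then show "w \<in> cl (Y \<union> (T \<inter> Z))" using wQ by (auto simp: lperp_def)
  qed
qed

text \<open>If \<open>T\<close> does not split \<open>x\<close>, then modularity fails for the cover
  \<open>cl {x} \<inter> lperp {x} \<subset> cl {x}\<close>.\<close>

lemma left_modular_upclosed:
  assumes T: "closed T"
    and mod: "\<And>Y Z. \<lbrakk>closed Y; closed Z; Y \<subseteq> Z\<rbrakk> \<Longrightarrow> cl (Y \<union> T) \<inter> Z = cl (Y \<union> (T \<inter> Z))"
  shows "upclosed T"
proof -
  have TQ: "T \<subseteq> Q" using T closed_subset by auto
  have "x \<in> rperp T" if x: "x \<in> Q" "x \<notin> T" for x
  proof (rule ccontr)
    assume nx: "x \<notin> rperp T"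
    let ?Y = "cl {x} \<inter> lperp {x}"
    have Y: "closed ?Y" using closed_Int[OF closed_cl lperp_closed] x by auto
    \<comment> \<open>As \<open>x\<close> is not in \<open>T\<close>, the part of \<open>T\<close>
      below \<open>cl {x}\<close> is below its unique lower cover \<open>?Y\<close>. Modularity for
      \<open>?Y\<close> and \<open>cl {x}\<close> then says that joining \<open>T\<close> to
      \<open>?Y\<close> does not produce \<open>x\<close>.\<close>
    have "T \<inter> cl {x} \<subseteq> ?Y"
      using below_cl_singleton[OF x(1) closed_Int[OF T closed_cl], of "{x}"] x by auto
    then have "cl (?Y \<union> (T \<inter> cl {x})) = ?Y"
      using Y by (simp add: Un_absorb2 closed_def)
    then have eq: "cl (?Y \<union> T) \<inter> cl {x} = ?Y" using mod[OF Y closed_cl, of "{x}"] by simp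
    have "x \<in> cl {x}" using cl_extensive[of "{x}"] x by auto
    moreover have "x \<notin> lperp {x}" using rel_refl x by (auto simp: lperp_def)
    ultimately have "x \<notin> cl (?Y \<union> T)" using eq by auto
    then obtain v where v: "v \<in> rperp (?Y \<union> T)" "x \<leadsto> v" using x by (auto simp: lperp_def)
    have vQ: "v \<in> Q" using v rperp_subset by auto
    obtain z where z: "z \<in> Q" "epi x z" "mono z v" using factorization[OF x(1) vQ v(2)] by blast
    have YT: "?Y \<union> T \<subseteq> Q" using lperp_subset TQ by auto
    have zp: "z \<in> rperp (?Y \<union> T)" using rperp_mono[OF v(1) z(1) YT z(3)] .
    \<comment> \<open>It remains to identify \<open>z\<close> with \<open>x\<close>. Being in
      \<open>cl {x}\<close> but not in \<open>?Y\<close>, \<open>z\<close> maps to \<open>x\<close>;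
      the middle term of this relation is \<open>x\<close> itself, so \<open>epi\<close> holds in
      both directions. But \<open>z\<close> is perpendicular to \<open>T\<close> and
      \<open>x\<close> is not.\<close>
    then have "z \<notin> ?Y" using disjoint_rperp[of z "?Y \<union> T"] by blast
    then have "z \<leadsto> x" using z(1,2) cl_singleton[OF x(1)] by (auto simp: lperp_def)
    then obtain u where u: "u \<in> Q" "epi z u" "mono u x" using factorization[OF z(1) x(1)] by blast
    have "u = x" using epi_mono[of x u] epi_trans[OF z(2) u(2)] u x by auto
    then have "z = x" using epi_antisym[of x z] u z x by auto
    then show False using zp nx by (simp add: rperp_Un)
  qed
  then show ?thesis using TQ upclosed_iff_split rperp_subset[of T] by auto
qed

text \<open>All elements of \<open>U \<inter> rperp T\<close> are related to each other; an element that is extremal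
  for both factors of the factorization absorbs the others.\<close>

lemma upclosed_cover_unique:
  assumes T: "upclosed T" and U: "upclosed U" and TU: "T \<subseteq> U"
    and cover: "\<And>V. \<lbrakk>closed V; T \<subseteq> V; V \<subseteq> U\<rbrakk> \<Longrightarrow> V = T \<or> V = U"
    and x: "x \<in> U - T" and y: "y \<in> U - T"
  shows "x = y"
proof -
  let ?S = "U - T"
  have UQ: "U \<subseteq> Q" using U by (auto simp: upclosed_def)
  have S: "?S = U \<inter> rperp T" using rperp_upclosed[OF T] UQ by auto
  \<comment> \<open>Over the cover, \<open>a\<close> alone already generates \<open>U\<close>. If
    \<open>a\<close> did not map to \<open>b\<close>, then \<open>b\<close> would be perpendicular
    to a generating set of \<open>U\<close> while lying in \<open>U\<close>.\<close>
  have all: "a \<leadsto> b" if a: "a \<in> ?S" and b: "b \<in> ?S" for a b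
  proof (rule ccontr)
    assume n: "\<not> a \<leadsto> b"
    have sub: "T \<union> {a} \<subseteq> Q" using a UQ TU by auto
    have "cl (T \<union> {a}) \<subseteq> U" using cl_least[OF upclosed_closed[OF U]] a TU by auto
    moreover have "T \<union> {a} \<subseteq> cl (T \<union> {a})" using cl_extensive[OF sub] .
    ultimately have "cl (T \<union> {a}) = U" using cover[OF closed_cl, of "T \<union> {a}"] a by auto
    then have "b \<in> cl (T \<union> {a})" using b by auto
    moreover have "b \<in> rperp (T \<union> {a})" using n b S by (auto simp: rperp_def)
    ultimately show False using rel_refl b UQ by (auto simp: lperp_def)
  qed
  have fact: "\<exists>c\<in>?S. epi a c \<and> mono c b" if a: "a \<in> ?S" and b: "b \<in> ?S" for a b
  proof -
    obtain c where c: "c \<in> Q" "epi a c" "mono c b" using factorization all[OF a b] a b UQ by blast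
    have "c \<in> U" using closed_epi[OF upclosed_closed[OF U] _ c(1,2)] a by auto
    moreover have "c \<in> rperp T" using rperp_mono[OF _ c(1) _ c(3), of T] b S TU UQ by auto
    ultimately show ?thesis using S c by blast
  qed
  \<comment> \<open>\<open>epi p z\<close> means that the targets of \<open>z\<close> are among
    those of \<open>p\<close>. Fewest targets thus make \<open>p\<close> a dead end for
    \<open>epi\<close> inside \<open>?S\<close>; in the same way, fewest sources make
    \<open>q\<close> below a dead end for \<open>mono\<close>.\<close>
  obtain p where p: "p \<in> ?S" and pmin: "\<And>z. z \<in> ?S \<Longrightarrow> card {v\<in>Q. p \<leadsto> v} \<le> card {v\<in>Q. z \<leadsto> v}"
    using x ex_has_least_nat[of "\<lambda>z. z \<in> ?S" x "\<lambda>p. card {v\<in>Q. p \<leadsto> v}"] by blast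
  have pepi: "z = p" if z: "z \<in> ?S" "epi p z" for z
  proof -
    have "{v\<in>Q. z \<leadsto> v} = {v\<in>Q. p \<leadsto> v}"
      using z(2) pmin[OF z(1)] finite_Q by (intro card_seteq) (auto simp: epi_def)
    then have "epi z p" by (auto simp: epi_def)
    then show ?thesis using epi_antisym z p UQ by blast
  qed
  obtain q where q: "q \<in> ?S" and qmin: "\<And>z. z \<in> ?S \<Longrightarrow> card {v\<in>Q. v \<leadsto> q} \<le> card {v\<in>Q. v \<leadsto> z}"
    using x ex_has_least_nat[of "\<lambda>z. z \<in> ?S" x "\<lambda>p. card {v\<in>Q. v \<leadsto> p}"] by blast
  have qmono: "z = q" if z: "z \<in> ?S" "mono z q" for z
  proof -
    have "{v\<in>Q. v \<leadsto> z} = {v\<in>Q. v \<leadsto> q}"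
      using z(2) qmin[OF z(1)] finite_Q by (intro card_seteq) (auto simp: mono_def)
    then have "mono q z" by (auto simp: mono_def)
    then show ?thesis using mono_antisym z q UQ by blast
  qed
  \<comment> \<open>The middle term of \<open>p \<leadsto> q\<close> is reached from
    \<open>p\<close> by \<open>epi\<close>, hence is \<open>p\<close>, and leads to \<open>q\<close>
    by \<open>mono\<close>, hence is \<open>q\<close>.\<close>
  have pq: "p = q" using fact[OF p q] pepi qmono by blast
  have "z = p" if z: "z \<in> ?S" for z
  proof -
    have "mono p z" using fact[OF p z] pepi by blast
    moreover have "epi z p" using fact[OF z q] qmono pq by blast
    ultimately show ?thesis using epi_mono[of z p] z p UQ by blast
  qed
  then show ?thesis using x y by metis
qed

end

section \<open>Acyclic relations and chains of up-closed sets\<close>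

context finite_reflexive_relation
begin

text \<open>Membership in an up-closed set is passed on along \<open>\<leadsto>\<close>, so all
  elements of a cycle lie in the same members of \<open>C\<close>.\<close>

lemma acyclic_if_separated:
  assumes C: "\<And>S. S \<in> C \<Longrightarrow> upclosed S"
    and sep: "\<And>x y. \<lbrakk>x \<in> Q; y \<in> Q; \<And>S. S \<in> C \<Longrightarrow> x \<in> S \<longleftrightarrow> y \<in> S\<rbrakk> \<Longrightarrow> x = y"
  shows acyclic_rel
  unfolding acyclic_rel_def
proof (rule acyclicI, intro allI notI)
  let ?r = "{(x, y). x \<in> Q \<and> y \<in> Q \<and> x \<leadsto> y \<and> x \<noteq> y}"
  fix x assume "(x, x) \<in> ?r\<^sup>+"
  have up: "x \<in> S \<Longrightarrow> y \<in> S" if "(x, y) \<in> ?r\<^sup>*" "S \<in> C" for x y S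
    using that by (induction rule: rtrancl_induct) (use C in \<open>auto simp: upclosed_def\<close>)
  obtain y where y: "(x, y) \<in> ?r" "(y, x) \<in> ?r\<^sup>*"
    using tranclD[OF \<open>(x, x) \<in> ?r\<^sup>+\<close>] by blast
  have "x = y" using y up[OF r_into_rtrancl[OF y(1)]] up[OF y(2)] by (intro sep) blast+
  then show False using y by simp
qed

text \<open>The element to drop is a source of the relation on \<open>S\<close>: no other element of
  \<open>S\<close> maps to it. Dually, \<open>upclosed_insert\<close> adds a sink of the relation on
  \<open>Q - S\<close>.\<close>

lemma upclosed_remove:
  assumes acyc: acyclic_rel and S: "upclosed S" "S \<noteq> {}"
  shows "\<exists>x\<in>S. upclosed (S - {x})"
proof -
  let ?r = "{(x, y). x \<in> Q \<and> y \<in> Q \<and> x \<leadsto> y \<and> x \<noteq> y}"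
  have "wf ?r" using acyc finite_subset[of ?r "Q \<times> Q"] finite_Q
    by (intro finite_acyclic_wf) (auto simp: acyclic_rel_def)
  then obtain x where x: "x \<in> S" "\<And>y. (y, x) \<in> ?r \<Longrightarrow> y \<notin> S"
    using S(2) wfE_min[of ?r _ S] by blast
  then show ?thesis using S by (intro bexI[of _ x]) (auto simp: upclosed_def)
qed

lemma upclosed_insert:
  assumes acyc: acyclic_rel and S: "upclosed S" "S \<noteq> Q"
  shows "\<exists>x\<in>Q - S. upclosed (insert x S)"
proof -
  let ?r = "{(x, y). x \<in> Q \<and> y \<in> Q \<and> x \<leadsto> y \<and> x \<noteq> y}"
  have "wf (?r\<inverse>)" using acyc finite_subset[of ?r "Q \<times> Q"] finite_Q
    by (intro finite_acyclic_wf_converse) (auto simp: acyclic_rel_def)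
  moreover have "Q - S \<noteq> {}" using S by (auto simp: upclosed_def)
  ultimately obtain x where x: "x \<in> Q - S" "\<And>y. (y, x) \<in> ?r\<inverse> \<Longrightarrow> y \<notin> Q - S"
    using wfE_min[of "?r\<inverse>" _ "Q - S"] by blast
  then show ?thesis using S by (intro bexI[of _ x]) (auto simp: upclosed_def)
qed

lemma upclosed_chain_below:
  assumes acyclic_rel and "upclosed S"
  shows "\<exists>C. subset.chain {T. upclosed T} C \<and> S \<in> C \<and> (\<forall>T\<in>C. T \<subseteq> S) \<and> card C = card S + 1"
  using assms(2)
proof (induction "card S" arbitrary: S)
  case 0
  then have "S = {}" using finite_Q by (auto simp: upclosed_def dest: finite_subset)
  then show ?case using 0 by (intro exI[of _ "{{}}"]) (auto simp: subset.chain_def)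
next
  case (Suc n)
  then have "S \<noteq> {}" by auto
  then obtain x where x: "x \<in> S" "upclosed (S - {x})" using upclosed_remove assms(1) Suc by blast
  have fS: "finite S" using finite_Q Suc by (auto simp: upclosed_def dest: finite_subset)
  have "n = card (S - {x})" using x Suc fS by simp
  from Suc(1)[OF this x(2)] obtain C where C: "subset.chain {T. upclosed T} C"
    "\<forall>T\<in>C. T \<subseteq> S - {x}" "card C = n + 1"
    using \<open>n = card (S - {x})\<close> by auto
  then have "S \<notin> C" "finite C" using x by (auto intro: card_ge_0_finite)
  moreover have "subset.chain {T. upclosed T} (insert S C)"
    using C Suc(3) unfolding subset.chain_def by blast
  ultimately show ?case using C Suc(2) by (intro exI[of _ "insert S C"]) auto
qed

text \<open>Sources are removed one at a time down to the empty set and sinks are added one at a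
  time up to \<open>Q\<close>, so every cardinality from \<open>0\<close> to \<open>card Q\<close>
  occurs. With \<open>S\<close> empty this yields extremality; with \<open>S\<close> arbitrary it
  puts every up-closed set on the spine.\<close>

lemma upclosed_chain_through:
  assumes acyclic_rel and "upclosed S"
  shows "\<exists>C. subset.chain {T. upclosed T} C \<and> S \<in> C \<and> card C = card Q + 1"
proof -
  have ext: "\<exists>C'. subset.chain {T. upclosed T} C' \<and> C \<subseteq> C' \<and> card C' = card Q + 1"
    if "subset.chain {T. upclosed T} C" "upclosed S" "\<forall>T\<in>C. T \<subseteq> S" "card C = card S + 1" for C S
    using that
  proof (induction "card (Q - S)" arbitrary: S C)
    case 0
    then have "S = Q" using finite_Q by (auto simp: upclosed_def)
    then show ?case using 0 by blast
  next
    case (Suc n)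
    then obtain x where x: "x \<in> Q - S" "upclosed (insert x S)"
      using upclosed_insert assms(1) by (metis Diff_cancel card.empty nat.distinct(1))
    have fS: "finite S" using finite_Q Suc by (auto simp: upclosed_def dest: finite_subset)
    have "Q - insert x S = (Q - S) - {x}" by auto
    then have n: "n = card (Q - insert x S)" using x Suc(2) by (simp add: card_Diff_singleton_if)
    have nC: "insert x S \<notin> C" "finite C" using x Suc by (auto intro: card_ge_0_finite)
    have "subset.chain {T. upclosed T} (insert (insert x S) C)"
      using Suc(3,5) x(2) unfolding subset.chain_def by blast
    moreover have "card (insert (insert x S) C) = card (insert x S) + 1"
      using nC x fS Suc(6) by simp
    ultimately show ?case using Suc(1)[OF n _ x(2), of "insert (insert x S) C"] Suc(5) by blast
  qed
  obtain C where C: "subset.chain {T. upclosed T} C" "S \<in> C" "\<forall>T\<in>C. T \<subseteq> S" "card C = card S + 1"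
    using upclosed_chain_below[OF assms] by blast
  then show ?thesis using ext[OF C(1) assms(2) C(3,4)] by blast
qed

text \<open>Along a chain with \<open>card Q + 1\<close> members, both \<open>card S\<close> and \<open>card Q - card (rperp S)\<close> run
  through \<open>{..card Q}\<close>; comparing sums, the inequality between the two is an equality.\<close>

lemma long_chain_upclosed:
  assumes C: "subset.chain {T. closed T} C" "card C = card Q + 1" and S: "S \<in> C"
  shows "upclosed S"
proof -
  let ?n = "card Q"
  let ?f = "card" and ?g = "\<lambda>S. ?n - card (rperp S)"
  have fC: "finite C" using C by (auto intro: card_ge_0_finite)
  have cl: "closed T" "T \<subseteq> Q" "finite T" "finite (rperp T)" if "T \<in> C" for T
  proof -
    show "closed T" using that C(1) by (auto simp: subset.chain_def)
    then show "T \<subseteq> Q" by (rule closed_subset)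
    then show "finite T" using finite_Q finite_subset by blast
    show "finite (rperp T)" using finite_Q rperp_subset finite_subset by blast
  qed
  have disj: "card T + card (rperp T) \<le> ?n" if "T \<in> C" for T
  proof -
    have "card T + card (rperp T) = card (T \<union> rperp T)"
      using cl[OF that] disjoint_rperp by (subst card_Un_disjoint) auto
    also have "\<dots> \<le> ?n" using cl[OF that] finite_Q rperp_subset by (intro card_mono) auto
    finally show ?thesis .
  qed
  have cmp: "T \<subset> U \<or> U \<subset> T" if "T \<in> C" "U \<in> C" "T \<noteq> U" for T U
    using that C(1) by (auto simp: subset.chain_def)
  have strict: "card T < card U" "card (rperp U) < card (rperp T)" if TU: "T \<in> C" "U \<in> C" "T \<subset> U" for T U
  proof -
    show "card T < card U" using TU cl by (auto intro: psubset_card_mono)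
    have "rperp U \<subset> rperp T" using TU rperp_antimono[of T U] rperp_inj[of T U] cl by blast
    then show "card (rperp U) < card (rperp T)" using TU cl by (auto intro: psubset_card_mono)
  qed
  have bij: "bij_betw h C {..?n}" if "inj_on h C" "h ` C \<subseteq> {..?n}" for h
    unfolding bij_betw_def using that C(2) card_subset_eq[of "{..?n}" "h ` C"]
    by (simp add: card_image)
  have f: "bij_betw ?f C {..?n}"
  proof (intro bij inj_onI)
    fix T U assume TU: "T \<in> C" "U \<in> C" "?f T = ?f U"
    then show "T = U" using cmp[OF TU(1,2)] strict(1)[OF TU(1,2)] strict(1)[OF TU(2,1)] by auto
  next
    show "?f ` C \<subseteq> {..?n}" using disj by (auto dest: add_leD1)
  qed
  have g: "bij_betw ?g C {..?n}"
  proof (intro bij inj_onI)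
    fix T U assume TU: "T \<in> C" "U \<in> C" "?g T = ?g U"
    then have "card (rperp T) = card (rperp U)" using disj[OF TU(1)] disj[OF TU(2)] by auto
    then show "T = U" using cmp[OF TU(1,2)] strict(2)[OF TU(1,2)] strict(2)[OF TU(2,1)] by auto
  qed auto
  have "sum ?f C = sum ?g C"
    using sum.reindex_bij_betw[OF f, of "\<lambda>x. x"] sum.reindex_bij_betw[OF g, of "\<lambda>x. x"] by simp
  then have "?f S = ?g S" using S fC disj by (intro sum_mono_inv[of ?f C ?g]) fastforce+
  then have "card (S \<union> rperp S) = ?n"
    using cl[OF S] disjoint_rperp disj[OF S] by (subst card_Un_disjoint) auto
  then have "S \<union> rperp S = Q"
    using cl[OF S] finite_Q rperp_subset by (intro card_subset_eq) auto
  then show ?thesis using cl[OF S] upclosed_iff_split by auto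
qed

end

section \<open>Lattices of closed sets\<close>

text \<open>The lattice is only identified with the closed sets through \<open>\<beta>\<close>, so
  that the results apply to \<open>tors\<close> itself, whose elements are classes of modules rather
  than sets of representatives.\<close>

locale closed_set_lattice = two_acyclic Q R + L?: bounded_lattice L
  for Q :: "'q set" and R :: "'q \<Rightarrow> 'q \<Rightarrow> bool" and L :: "('l, 'b) gorder_scheme" (structure) +
  fixes \<beta> :: "'l \<Rightarrow> 'q set"
  assumes le_iff: "\<lbrakk>x \<in> carrier L; y \<in> carrier L\<rbrakk> \<Longrightarrow> x \<sqsubseteq> y \<longleftrightarrow> \<beta> x \<subseteq> \<beta> y"
    and image_carrier: "\<beta> ` carrier L = {S. closed S}"
begin

lemma closed_image: "x \<in> carrier L \<Longrightarrow> closed (\<beta> x)"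
  using image_carrier by blast

lemma closed_obtain: assumes "closed S" obtains x where "x \<in> carrier L" "\<beta> x = S"
  using image_carrier assms by (metis (mono_tags) imageE mem_Collect_eq)

lemma image_subset_Q: "x \<in> carrier L \<Longrightarrow> \<beta> x \<subseteq> Q"
  using closed_image closed_subset by blast

lemma image_inject: "\<lbrakk>x \<in> carrier L; y \<in> carrier L\<rbrakk> \<Longrightarrow> \<beta> x = \<beta> y \<longleftrightarrow> x = y"
  using le_iff[of x y] le_iff[of y x] L.le_antisym[of x y] by auto

lemma inj_on_image: "inj_on \<beta> (carrier L)"
  by (auto intro: inj_onI simp: image_inject)

lemma lless_iff: "\<lbrakk>x \<in> carrier L; y \<in> carrier L\<rbrakk> \<Longrightarrow> x \<sqsubset> y \<longleftrightarrow> \<beta> x \<subset> \<beta> y"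
  using le_iff image_inject L.eq_is_equal by (auto simp: lless_def)

lemma finite_lattice: "finite_lattice L"
proof (intro finite_lattice.intro finite_lattice_axioms.intro)
  show "bounded_lattice L" by unfold_locales
  have "\<beta> ` carrier L \<subseteq> Pow Q" using image_subset_Q by auto
  then show "finite (carrier L)"
    using finite_Q inj_on_image by (metis finite_Pow_iff finite_imageD finite_subset)
qed

lemma image_meet:
  assumes "x \<in> carrier L" "y \<in> carrier L"
  shows "\<beta> (x \<sqinter> y) = \<beta> x \<inter> \<beta> y"
proof
  show "\<beta> (x \<sqinter> y) \<subseteq> \<beta> x \<inter> \<beta> y"
    using assms meet_left meet_right by (simp flip: le_iff)
  obtain z where z: "z \<in> carrier L" "\<beta> z = \<beta> x \<inter> \<beta> y"
    using closed_Int closed_image assms closed_obtain by metis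
  then have "z \<sqsubseteq> x \<sqinter> y" using assms by (intro meet_le) (simp_all add: le_iff)
  then show "\<beta> x \<inter> \<beta> y \<subseteq> \<beta> (x \<sqinter> y)" using z assms le_iff[of z "x \<sqinter> y"] by simp
qed

lemma image_join:
  assumes "x \<in> carrier L" "y \<in> carrier L"
  shows "\<beta> (x \<squnion> y) = cl (\<beta> x \<union> \<beta> y)"
proof
  have "\<beta> x \<union> \<beta> y \<subseteq> \<beta> (x \<squnion> y)"
    using assms join_left join_right by (simp flip: le_iff)
  then show "cl (\<beta> x \<union> \<beta> y) \<subseteq> \<beta> (x \<squnion> y)" using assms by (intro cl_least closed_image) auto
  obtain z where z: "z \<in> carrier L" "\<beta> z = cl (\<beta> x \<union> \<beta> y)"
    using closed_cl closed_obtain by metis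
  have "\<beta> x \<union> \<beta> y \<subseteq> \<beta> z"
    unfolding z(2) using assms image_subset_Q by (intro cl_extensive) blast
  then have "x \<squnion> y \<sqsubseteq> z" using assms z(1) by (intro join_le) (simp_all add: le_iff)
  then show "\<beta> (x \<squnion> y) \<subseteq> cl (\<beta> x \<union> \<beta> y)" using z assms le_iff[of "x \<squnion> y" z] by simp
qed

lemma image_bottom: "\<beta> \<bottom> = {}"
proof -
  obtain z where z: "z \<in> carrier L" "\<beta> z = {}" using closed_empty closed_obtain by metis
  then have "\<bottom> \<sqsubseteq> z" by simp
  then show ?thesis using z le_iff[of "\<bottom>" z] by simp
qed

lemma image_top: "\<beta> \<top> = Q"
proof -
  obtain z where z: "z \<in> carrier L" "\<beta> z = Q" using closed_Q closed_obtain by metis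
  then have "z \<sqsubseteq> \<top>" by simp
  then show ?thesis using z le_iff[of z "\<top>"] image_subset_Q[of "\<top>"] by simp
qed

section \<open>Left modular and irreducible elements\<close>

lemma left_modular_element_iff:
  assumes x: "x \<in> carrier L"
  shows "left_modular_element L x \<longleftrightarrow> upclosed (\<beta> x)"
proof
  assume lm: "left_modular_element L x"
  show "upclosed (\<beta> x)"
  proof (rule left_modular_upclosed[OF closed_image[OF x]])
    fix Y Z assume YZ: "closed Y" "closed Z" "Y \<subseteq> Z"
    obtain y where y: "y \<in> carrier L" "\<beta> y = Y" using closed_obtain YZ by metis
    obtain z where z: "z \<in> carrier L" "\<beta> z = Z" using closed_obtain YZ by metis
    have "(y \<squnion> x) \<sqinter> z = y \<squnion> (x \<sqinter> z)"
      using lm y z YZ le_iff[of y z] unfolding left_modular_element_def by blast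
    then have "\<beta> ((y \<squnion> x) \<sqinter> z) = \<beta> (y \<squnion> (x \<sqinter> z))" by simp
    then show "cl (Y \<union> \<beta> x) \<inter> Z = cl (Y \<union> (\<beta> x \<inter> Z))"
      using x y z by (simp add: image_join image_meet)
  qed
next
  assume up: "upclosed (\<beta> x)"
  show "left_modular_element L x"
    unfolding left_modular_element_def
  proof (intro conjI ballI impI x)
    fix y z assume yz: "y \<in> carrier L" "z \<in> carrier L" "y \<sqsubseteq> z"
    have "\<beta> ((y \<squnion> x) \<sqinter> z) = \<beta> (y \<squnion> (x \<sqinter> z))"
      using x yz upclosed_left_modular[OF up closed_image[OF yz(1)] closed_image[OF yz(2)]]
      by (simp add: image_join image_meet le_iff)
    then show "(y \<squnion> x) \<sqinter> z = y \<squnion> (x \<sqinter> z)" using x yz by (simp add: image_inject)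
  qed
qed

text \<open>A largest closed set \<open>U\<close> strictly below \<open>\<beta> t\<close>, joined
  with \<open>cl {x}\<close> for any further \<open>x\<close>, gives back \<open>\<beta> t\<close>;
  irreducibility leaves only \<open>cl {x}\<close>. Conversely, closed sets below
  \<open>cl {x}\<close> that miss \<open>x\<close> all lie in \<open>lperp {x}\<close>, so their
  join misses \<open>x\<close> as well.\<close>

lemma join_irreducible_iff:
  assumes t: "t \<in> carrier L"
  shows "join_irreducible L t \<longleftrightarrow> (\<exists>x\<in>Q. \<beta> t = cl {x})"
proof
  assume ji: "join_irreducible L t"
  let ?P = "\<lambda>U. closed U \<and> U \<subset> \<beta> t"
  have "\<beta> t \<noteq> {}" using ji t image_inject[of t "\<bottom>"] image_bottom by (auto simp: join_irreducible_def)
  then have "?P {}" using closed_empty by auto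
  moreover have "\<forall>U. ?P U \<longrightarrow> card U < Suc (card Q)"
    using card_mono[OF finite_Q] closed_subset by (simp add: less_Suc_eq_le)
  ultimately obtain U where U: "?P U" and max: "\<And>V. ?P V \<Longrightarrow> card V \<le> card U"
    using ex_has_greatest_nat[of ?P "{}" card "Suc (card Q)"] by blast
  obtain x where x: "x \<in> \<beta> t" "x \<notin> U" using U by auto
  have xQ: "x \<in> Q" using x t image_subset_Q by auto
  obtain u where u: "u \<in> carrier L" "\<beta> u = U" using closed_obtain U by metis
  obtain c where c: "c \<in> carrier L" "\<beta> c = cl {x}" using closed_obtain[OF closed_cl] by metis
  have sub: "U \<union> cl {x} \<subseteq> \<beta> t" using U cl_least[OF closed_image[OF t], of "{x}"] x by auto
  have "x \<in> cl {x}" using cl_extensive[of "{x}"] xQ by auto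
  have "U \<union> cl {x} \<subseteq> cl (U \<union> cl {x})" using cl_extensive sub image_subset_Q[OF t] by blast
  then have V: "U \<subset> cl (U \<union> cl {x})" "cl (U \<union> cl {x}) \<subseteq> \<beta> t"
    using x(2) \<open>x \<in> cl {x}\<close> cl_least[OF closed_image[OF t] sub] by blast+
  have "finite (cl (U \<union> cl {x}))" using finite_Q lperp_subset finite_subset by blast
  then have "cl (U \<union> cl {x}) = \<beta> t"
    using max[of "cl (U \<union> cl {x})"] V closed_cl psubset_card_mono[OF _ V(1)] by fastforce
  then have "\<beta> t = \<beta> (u \<squnion> c)" using image_join u c by simp
  then have "t = u \<squnion> c" using image_inject t u c by simp
  then have "t = u \<or> t = c" using ji u c by (auto simp: join_irreducible_def)
  then show "\<exists>x\<in>Q. \<beta> t = cl {x}" using U u c xQ by auto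
next
  assume "\<exists>x\<in>Q. \<beta> t = cl {x}"
  then obtain x where x: "x \<in> Q" "\<beta> t = cl {x}" by auto
  have xt: "x \<in> \<beta> t" using cl_extensive[of "{x}"] x by auto
  show "join_irreducible L t"
    unfolding join_irreducible_def
  proof (intro conjI ballI impI t)
    show "t \<noteq> \<bottom>" using xt image_bottom by auto
    fix y z assume yz: "y \<in> carrier L" "z \<in> carrier L" "t = y \<squnion> z"
    then have eq: "\<beta> t = cl (\<beta> y \<union> \<beta> z)" by (simp add: image_join)
    have sub: "\<beta> y \<union> \<beta> z \<subseteq> cl {x}"
      using cl_extensive[of "\<beta> y \<union> \<beta> z"] image_subset_Q yz eq x by blast
    have "x \<in> \<beta> y \<union> \<beta> z"
    proof (rule ccontr)
      assume "x \<notin> \<beta> y \<union> \<beta> z"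
      then have "\<beta> y \<union> \<beta> z \<subseteq> lperp {x}"
        using below_cl_singleton[OF x(1) closed_image] yz sub by blast
      then have "x \<in> lperp {x}" using xt eq cl_least lperp_closed[of "{x}"] x(1) by blast
      then show False using rel_refl x by (auto simp: lperp_def)
    qed
    then have "cl {x} \<subseteq> \<beta> y \<or> cl {x} \<subseteq> \<beta> z"
      using cl_least[OF closed_image, of _ "{x}"] yz by blast
    then show "t = y \<or> t = z" using sub x yz t image_inject by (metis Un_subset_iff order_antisym)
  qed
qed

text \<open>Dual argument with a smallest closed set \<open>U\<close> strictly above
  \<open>\<beta> t\<close>. An \<open>x\<close> in \<open>U\<close> outside \<open>\<beta> t\<close>
  maps to some \<open>y\<close> in the right perpendicular of \<open>\<beta> t\<close>, and
  \<open>lperp {y}\<close> contains \<open>\<beta> t\<close> but not \<open>x\<close>, so it cuts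
  \<open>U\<close> down to \<open>\<beta> t\<close>.\<close>

lemma meet_irreducible_iff:
  assumes t: "t \<in> carrier L"
  shows "meet_irreducible L t \<longleftrightarrow> (\<exists>x\<in>Q. \<beta> t = lperp {x})"
proof
  assume mi: "meet_irreducible L t"
  let ?P = "\<lambda>U. closed U \<and> \<beta> t \<subset> U"
  have "\<beta> t \<noteq> Q" using mi t image_inject[of t "\<top>"] image_top by (auto simp: meet_irreducible_def)
  then have "?P Q" using closed_Q image_subset_Q[OF t] by auto
  then obtain U where U: "?P U" and min: "\<And>V. ?P V \<Longrightarrow> card U \<le> card V"
    using ex_has_least_nat[of ?P Q card] by blast
  then obtain x where x: "x \<in> U" "x \<notin> \<beta> t" by auto
  have xQ: "x \<in> Q" using x U closed_subset by auto
  then obtain y where y: "y \<in> rperp (\<beta> t)" "R x y"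
    using x closed_image[OF t] by (auto simp: closed_def lperp_def)
  have yQ: "y \<in> Q" using y rperp_subset by auto
  obtain u where u: "u \<in> carrier L" "\<beta> u = U" using closed_obtain U by metis
  obtain c where c: "c \<in> carrier L" "\<beta> c = lperp {y}"
    using closed_obtain[OF lperp_closed] yQ by (metis empty_subsetI insert_subset)
  have sub: "\<beta> t \<subseteq> lperp {y}" using y image_subset_Q[OF t] by (auto simp: rperp_def lperp_def)
  have V: "U \<inter> lperp {y} \<subset> U" using x y by (auto simp: lperp_def)
  have "finite U" using U closed_subset finite_Q finite_subset by blast
  then have "card (U \<inter> lperp {y}) < card U" using V psubset_card_mono by blast
  then have "U \<inter> lperp {y} = \<beta> t"
    using min[of "U \<inter> lperp {y}"] U sub closed_Int lperp_closed[of "{y}"] yQ by fastforce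
  then have "\<beta> t = \<beta> (u \<sqinter> c)" using image_meet u c by simp
  then have "t = u \<sqinter> c" using image_inject t u c by simp
  then have "t = u \<or> t = c" using mi u c by (auto simp: meet_irreducible_def)
  then show "\<exists>x\<in>Q. \<beta> t = lperp {x}" using U u c yQ by auto
next
  assume "\<exists>x\<in>Q. \<beta> t = lperp {x}"
  then obtain x where x: "x \<in> Q" "\<beta> t = lperp {x}" by auto
  have xt: "x \<notin> \<beta> t" using x rel_refl by (auto simp: lperp_def)
  show "meet_irreducible L t"
    unfolding meet_irreducible_def
  proof (intro conjI ballI impI t)
    show "t \<noteq> \<top>" using xt image_top x by auto
    fix y z assume yz: "y \<in> carrier L" "z \<in> carrier L" "t = y \<sqinter> z"
    then have eq: "\<beta> t = \<beta> y \<inter> \<beta> z" by (simp add: image_meet)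
    \<comment> \<open>Everything strictly above \<open>t\<close> contains \<open>x\<close>, and a
      meet of two such elements would still contain it.\<close>
    have "w = t" if w: "w \<in> carrier L" "\<beta> t \<subseteq> \<beta> w" "x \<notin> \<beta> w" for w
    proof -
      have "x \<in> rperp (\<beta> w)"
        using above_lperp_singleton[OF x(1) closed_image[OF w(1)]] w x by auto
      then have "\<beta> w \<subseteq> lperp {x}" using image_subset_Q[OF w(1)] by (auto simp: rperp_def lperp_def)
      then show ?thesis using w x t image_inject by blast
    qed
    then show "t = y \<or> t = z" using eq xt yz by (metis IntI Int_lower1 Int_lower2)
  qed
qed

lemma card_join_irreducible: "card {t. join_irreducible L t} = card Q"
proof -
  have "bij_betw \<beta> {t. join_irreducible L t} ((\<lambda>x. cl {x}) ` Q)"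
  proof (rule bij_betw_imageI)
    show "inj_on \<beta> {t. join_irreducible L t}"
      by (rule inj_on_subset[OF inj_on_image]) (auto simp: join_irreducible_def)
    show "\<beta> ` {t. join_irreducible L t} = (\<lambda>x. cl {x}) ` Q"
    proof (intro equalityI subsetI)
      fix S assume "S \<in> \<beta> ` {t. join_irreducible L t}"
      then obtain t where t: "join_irreducible L t" "S = \<beta> t" by auto
      then have "t \<in> carrier L" by (simp add: join_irreducible_def)
      then show "S \<in> (\<lambda>x. cl {x}) ` Q" using join_irreducible_iff t by auto
    next
      fix S assume "S \<in> (\<lambda>x. cl {x}) ` Q"
      then obtain x where x: "x \<in> Q" "S = cl {x}" by auto
      then obtain t where "t \<in> carrier L" "\<beta> t = S" using closed_obtain[OF closed_cl] by blast
      then show "S \<in> \<beta> ` {t. join_irreducible L t}" using x join_irreducible_iff by blast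
    qed
  qed
  moreover have "inj_on (\<lambda>x. cl {x}) Q" using cl_singleton_inj by (auto intro: inj_onI)
  ultimately show ?thesis by (simp add: bij_betw_same_card card_image)
qed

lemma card_meet_irreducible: "card {t. meet_irreducible L t} = card Q"
proof -
  have "bij_betw \<beta> {t. meet_irreducible L t} ((\<lambda>x. lperp {x}) ` Q)"
  proof (rule bij_betw_imageI)
    show "inj_on \<beta> {t. meet_irreducible L t}"
      by (rule inj_on_subset[OF inj_on_image]) (auto simp: meet_irreducible_def)
    show "\<beta> ` {t. meet_irreducible L t} = (\<lambda>x. lperp {x}) ` Q"
    proof (intro equalityI subsetI)
      fix S assume "S \<in> \<beta> ` {t. meet_irreducible L t}"
      then obtain t where t: "meet_irreducible L t" "S = \<beta> t" by auto
      then have "t \<in> carrier L" by (simp add: meet_irreducible_def)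
      then show "S \<in> (\<lambda>x. lperp {x}) ` Q" using meet_irreducible_iff t by auto
    next
      fix S assume "S \<in> (\<lambda>x. lperp {x}) ` Q"
      then obtain x where x: "x \<in> Q" "S = lperp {x}" by auto
      then obtain t where "t \<in> carrier L" "\<beta> t = S" using closed_obtain lperp_closed[of "{x}"] by auto
      then show "S \<in> \<beta> ` {t. meet_irreducible L t}" using x meet_irreducible_iff by blast
    qed
  qed
  moreover have "inj_on (\<lambda>x. lperp {x}) Q" using lperp_singleton_inj by (auto intro: inj_onI)
  ultimately show ?thesis by (simp add: bij_betw_same_card card_image)
qed

section \<open>Chains, length and the equivalent lattice conditions\<close>

lemma lattice_chain_iff:
  assumes "C \<subseteq> carrier L"
  shows "lattice_chain L C \<longleftrightarrow> subset.chain {S. closed S} (\<beta> ` C)"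
proof -
  have "(lless L)\<^sup>=\<^sup>= x y \<longleftrightarrow> (\<subset>)\<^sup>=\<^sup>= (\<beta> x) (\<beta> y)" if "x \<in> C" "y \<in> C" for x y
    using that assms lless_iff[of x y] image_inject[of x y] by auto
  then show ?thesis
    using assms closed_image unfolding pred_on.chain_def by (auto 0 3)
qed

lemma lattice_chain_comparable:
  assumes "lattice_chain L C" "x \<in> C" "y \<in> C"
  shows "\<beta> x \<subseteq> \<beta> y \<or> \<beta> y \<subseteq> \<beta> x"
proof -
  have C: "C \<subseteq> carrier L" "(lless L)\<^sup>=\<^sup>= x y \<or> (lless L)\<^sup>=\<^sup>= y x"
    using assms unfolding pred_on.chain_def by blast+
  then show ?thesis using lless_iff[of x y] lless_iff[of y x] assms by auto
qed

text \<open>Cardinalities of the images strictly increase along a chain and range over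
  \<open>{..card Q}\<close>. This is the usual bound of the length by the number of
  join-irreducibles, which extremal lattices attain.\<close>

lemma lattice_chain_card:
  assumes C: "lattice_chain L C"
  shows "finite C" "card C \<le> card Q + 1"
proof -
  have sub: "C \<subseteq> carrier L" using C by (simp add: pred_on.chain_def)
  then show "finite C" using finite_lattice finite_subset
    by (auto simp: finite_lattice_def finite_lattice_axioms_def)
  have fin: "finite (\<beta> x)" if "x \<in> C" for x
    using that sub image_subset_Q finite_Q finite_subset by blast
  have "inj_on (\<lambda>x. card (\<beta> x)) C"
  proof (rule inj_onI)
    fix x y assume xy: "x \<in> C" "y \<in> C" "card (\<beta> x) = card (\<beta> y)"
    have "\<beta> x \<subseteq> \<beta> y \<or> \<beta> y \<subseteq> \<beta> x" by (rule lattice_chain_comparable[OF C xy(1,2)])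
    then have "\<beta> x = \<beta> y" using xy(3) card_subset_eq[OF fin[OF xy(1)], of "\<beta> y"]
        card_subset_eq[OF fin[OF xy(2)], of "\<beta> x"] by auto
    then show "x = y" using image_inject[of x y] xy sub by auto
  qed
  moreover have "(\<lambda>x. card (\<beta> x)) ` C \<subseteq> {..card Q}"
    using sub image_subset_Q finite_Q by (auto intro: card_mono)
  ultimately show "card C \<le> card Q + 1" using card_inj_on_le[of _ C "{..card Q}"] by fastforce
qed

lemma lattice_length_eq_iff:
  "lattice_length L = card Q \<longleftrightarrow> (\<exists>C. lattice_chain L C \<and> card C = card Q + 1)"
proof -
  let ?M = "{card C - 1 | C. lattice_chain L C \<and> C \<noteq> {}}"
  have sub: "?M \<subseteq> {..card Q}" using lattice_chain_card(2) by fastforce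
  have fin: "finite ?M" using sub by (rule finite_subset) simp
  have "lattice_chain L {\<bottom>}" by (auto simp: pred_on.chain_def)
  then have ne: "?M \<noteq> {}" by blast
  show ?thesis
  proof
    assume "lattice_length L = card Q"
    then have "card Q \<in> ?M" using Max_in[OF fin ne] by (simp add: lattice_length_def)
    then obtain C where C: "lattice_chain L C" "C \<noteq> {}" "card Q = card C - 1" by auto
    \<comment> \<open>Positivity undoes the truncated subtraction in
      \<open>card C - 1\<close>.\<close>
    then have "card C > 0" using lattice_chain_card(1) by (simp add: card_gt_0_iff)
    then show "\<exists>C. lattice_chain L C \<and> card C = card Q + 1" using C by (intro exI[of _ C]) auto
  next
    assume "\<exists>C. lattice_chain L C \<and> card C = card Q + 1"
    then have "card Q \<in> ?M" by force
    then show "lattice_length L = card Q"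
      unfolding lattice_length_def using fin sub by (intro Max_eqI) auto
  qed
qed

lemma extremal_lattice_iff:
  "extremal_lattice L \<longleftrightarrow> (\<exists>C. lattice_chain L C \<and> card C = card Q + 1)"
  using finite_lattice lattice_length_eq_iff
  by (simp add: extremal_lattice_def card_join_irreducible card_meet_irreducible)

lemma long_lattice_chain_upclosed:
  assumes C: "lattice_chain L C" "card C = card Q + 1" and x: "x \<in> C"
  shows "upclosed (\<beta> x)"
proof -
  have sub: "C \<subseteq> carrier L" using C by (simp add: pred_on.chain_def)
  have "card (\<beta> ` C) = card Q + 1"
    using C(2) card_image[OF inj_on_subset[OF inj_on_image sub]] by simp
  then show ?thesis using long_chain_upclosed C lattice_chain_iff[OF sub] x by blast
qed

lemma long_lattice_chain_through:
  assumes acyclic_rel and x: "x \<in> carrier L" "upclosed (\<beta> x)"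
  shows "\<exists>C. lattice_chain L C \<and> x \<in> C \<and> card C = card Q + 1"
proof -
  obtain D where D: "subset.chain {T. upclosed T} D" "\<beta> x \<in> D" "card D = card Q + 1"
    using upclosed_chain_through[OF assms(1) x(2)] by blast
  define C where "C = {y \<in> carrier L. \<beta> y \<in> D}"
  have cl: "D \<subseteq> {S. closed S}" using D(1) upclosed_closed by (auto simp: subset.chain_def)
  have "D \<subseteq> \<beta> ` carrier L" using cl image_carrier by simp
  then have im: "\<beta> ` C = D" by (auto simp: C_def)
  have "subset.chain {S. closed S} D" using D(1) cl by (simp add: subset.chain_def)
  moreover have "card C = card D"
    using card_image[of \<beta> C] inj_on_subset[OF inj_on_image, of C] im by (auto simp: C_def)
  moreover have "x \<in> C" using x D(2) by (simp add: C_def)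
  ultimately show ?thesis using D(3) im lattice_chain_iff[of C] by (auto simp: C_def)
qed

text \<open>A chain of the largest possible cardinality cannot be refined, and the counting argument
  has made all its members up-closed.\<close>

lemma long_lattice_chain_left_modular:
  assumes C: "lattice_chain L C" "card C = card Q + 1"
  shows "left_modular_lattice L"
proof -
  have "lattice_maxchain L C" unfolding pred_on.maxchain_def
  proof (intro conjI C notI)
    assume "\<exists>S. pred_on.chain (carrier L) (lless L) S \<and> C \<subset> S"
    then obtain S where S: "lattice_chain L S" "C \<subset> S" by auto
    then show False using lattice_chain_card[OF S(1)] psubset_card_mono[of S C] C by auto
  qed
  moreover have "C \<subseteq> carrier L" using C by (simp add: pred_on.chain_def)
  ultimately show ?thesis
    using long_lattice_chain_upclosed[OF C] finite_lattice left_modular_element_iff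
    unfolding left_modular_lattice_def by blast
qed

text \<open>Members of the given maximal chain are up-closed, so it suffices that they separate
  elements of \<open>Q\<close>. If they do not separate \<open>x\<close> and \<open>y\<close>, let
  \<open>u\<close> be the smallest member containing \<open>x\<close> and \<open>t\<close> the
  largest one not containing it. These are neighbours in a maximal chain, hence form a cover, and
  both \<open>x\<close> and \<open>y\<close> lie in the difference;
  \<open>upclosed_cover_unique\<close> identifies them.\<close>

lemma left_modular_acyclic:
  assumes "left_modular_lattice L"
  shows acyclic_rel
proof -
  obtain C where C: "lattice_maxchain L C" "\<And>x. x \<in> C \<Longrightarrow> left_modular_element L x"
    using assms by (auto simp: left_modular_lattice_def)
  have ch: "lattice_chain L C" using C by (simp add: pred_on.maxchain_def)
  have sub: "C \<subseteq> carrier L" using ch by (simp add: pred_on.chain_def)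
  have up: "upclosed (\<beta> x)" if "x \<in> C" for x using C(2)[OF that] left_modular_element_iff that sub by blast
  have cmp: "\<beta> x \<subseteq> \<beta> y \<or> \<beta> y \<subseteq> \<beta> x" if "x \<in> C" "y \<in> C" for x y
    using lattice_chain_comparable[OF ch that] .
  \<comment> \<open>Maximality in usable form: whatever is comparable with the whole chain is on it.
    In particular the bottom and the top are, so \<open>?A\<close> and \<open>?B\<close> below are
    non-empty.\<close>
  have max: "v \<in> C" if v: "v \<in> carrier L" "\<And>x. x \<in> C \<Longrightarrow> \<beta> x \<subseteq> \<beta> v \<or> \<beta> v \<subseteq> \<beta> x" for v
  proof (rule ccontr)
    assume n: "v \<notin> C"
    have "subset.chain {S. closed S} (\<beta> ` insert v C)"
      using ch v closed_image unfolding lattice_chain_iff[OF sub] subset.chain_def by auto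
    then have "lattice_chain L (insert v C)" using lattice_chain_iff[of "insert v C"] sub v by auto
    then show False using C(1) n unfolding pred_on.maxchain_def by blast
  qed
  have bot: "\<bottom> \<in> C" by (rule max) (auto simp: image_bottom)
  have top: "\<top> \<in> C" by (rule max) (use sub image_subset_Q in \<open>auto simp: image_top\<close>)
  show ?thesis
  proof (rule acyclic_if_separated[of "\<beta> ` C"])
    show "upclosed S" if "S \<in> \<beta> ` C" for S using that up by auto
  next
    fix x y assume xy: "x \<in> Q" "y \<in> Q" and same: "\<And>S. S \<in> \<beta> ` C \<Longrightarrow> x \<in> S \<longleftrightarrow> y \<in> S"
    let ?A = "{c \<in> C. x \<in> \<beta> c}" and ?B = "{c \<in> C. x \<notin> \<beta> c}"
    have fin: "finite (\<beta> c)" if "c \<in> C" for c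
      using that sub image_subset_Q finite_Q finite_subset by blast
    obtain u where u: "u \<in> ?A" and umin: "\<And>c. c \<in> ?A \<Longrightarrow> card (\<beta> u) \<le> card (\<beta> c)"
      using top xy image_top ex_has_least_nat[of "\<lambda>c. c \<in> ?A" "\<top>" "\<lambda>c. card (\<beta> c)"] by blast
    have bd: "\<forall>c. c \<in> ?B \<longrightarrow> card (\<beta> c) < Suc (card Q)"
      using sub image_subset_Q finite_Q by (auto simp: less_Suc_eq_le intro: card_mono)
    have "\<bottom> \<in> ?B" using bot image_bottom by simp
    from ex_has_greatest_nat[of "\<lambda>c. c \<in> ?B", OF this bd]
    obtain t where t: "t \<in> ?B" and tmax: "\<And>c. c \<in> ?B \<Longrightarrow> card (\<beta> c) \<le> card (\<beta> t)"
      by blast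
    have uA: "\<beta> u \<subseteq> \<beta> c" if "c \<in> ?A" for c
      using cmp[of u c] u that umin[OF that] fin card_seteq[of "\<beta> u" "\<beta> c"] by blast
    have tB: "\<beta> c \<subseteq> \<beta> t" if "c \<in> ?B" for c
      using cmp[of t c] t that tmax[OF that] fin card_seteq[of "\<beta> c" "\<beta> t"] by blast
    have tu: "\<beta> t \<subseteq> \<beta> u" using cmp[of t u] t u by blast
    show "x = y"
    proof (rule upclosed_cover_unique[OF up up tu])
      show "t \<in> C" "u \<in> C" using t u by auto
      show "x \<in> \<beta> u - \<beta> t" "y \<in> \<beta> u - \<beta> t" using t u same by auto
      fix V assume V: "closed V" "\<beta> t \<subseteq> V" "V \<subseteq> \<beta> u"
      obtain v where v: "v \<in> carrier L" "\<beta> v = V" using closed_obtain V by metis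
      \<comment> \<open>Each member of the chain contains \<open>\<beta> u\<close> or is contained
        in \<open>\<beta> t\<close>, so anything in between is comparable with all of them.\<close>
      have "v \<in> C" using uA tB V v by (intro max) blast+
      then show "V = \<beta> t \<or> V = \<beta> u" using uA[of v] tB[of v] V v by blast
    qed
  qed
qed

text \<open>The implications run in a circle: acyclic to extremal by building a long chain, extremal
  to left modular by counting along such a chain, left modular to acyclic by separation. Trim is the
  conjunction of two conditions already equivalent.\<close>

theorem acyclic_iff_left_modular: "acyclic_rel \<longleftrightarrow> left_modular_lattice L"
  and acyclic_iff_extremal: "acyclic_rel \<longleftrightarrow> extremal_lattice L"
  and acyclic_iff_trim: "acyclic_rel \<longleftrightarrow> trim_lattice L"
proof -
  have "upclosed (\<beta> \<bottom>)" by (simp add: image_bottom upclosed_def)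
  then have 1: "acyclic_rel \<Longrightarrow> extremal_lattice L"
    using long_lattice_chain_through[of "\<bottom>"] extremal_lattice_iff by auto
  have 2: "extremal_lattice L \<Longrightarrow> left_modular_lattice L"
    using long_lattice_chain_left_modular extremal_lattice_iff by auto
  show "acyclic_rel \<longleftrightarrow> left_modular_lattice L" "acyclic_rel \<longleftrightarrow> extremal_lattice L"
    "acyclic_rel \<longleftrightarrow> trim_lattice L"
    using 1 2 left_modular_acyclic by (auto simp: trim_lattice_def)
qed

text \<open>One inclusion is the counting argument on a chain of maximal length, the other extends
  an up-closed set to such a chain in both directions.\<close>

theorem spine_eq_upclosed:
  assumes acyclic_rel
  shows "spine L = {t \<in> carrier L. upclosed (\<beta> t)}"
proof -
  have len: "lattice_length L = card Q"
    using assms acyclic_iff_extremal extremal_lattice_iff lattice_length_eq_iff by auto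
  have "(C \<noteq> {} \<and> card C - 1 = lattice_length L) \<longleftrightarrow> card C = card Q + 1"
    if "lattice_chain L C" for C
    using lattice_chain_card(1)[OF that] len card_gt_0_iff[of C] by auto
  then have "spine L = \<Union>{C. lattice_chain L C \<and> card C = card Q + 1}"
    unfolding spine_def by blast
  also have "\<dots> = {t \<in> carrier L. upclosed (\<beta> t)}"
  proof (intro equalityI subsetI)
    fix x assume "x \<in> \<Union>{C. lattice_chain L C \<and> card C = card Q + 1}"
    then obtain C where C: "lattice_chain L C" "card C = card Q + 1" "x \<in> C" by blast
    then have "x \<in> carrier L" unfolding pred_on.chain_def by blast
    then show "x \<in> {t \<in> carrier L. upclosed (\<beta> t)}" using long_lattice_chain_upclosed[OF C] by simp
  next
    fix x assume "x \<in> {t \<in> carrier L. upclosed (\<beta> t)}"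
    then show "x \<in> \<Union>{C. lattice_chain L C \<and> card C = card Q + 1}"
      using long_lattice_chain_through[OF assms, of x] by blast
  qed
  finally show ?thesis .
qed

text \<open>Joins are closures of unions in general, but a union of up-closed sets is up-closed and
  therefore already closed. On these elements the operations are union and intersection of
  sets.\<close>

theorem distributive_sublattice_upclosed:
  "distributive_sublattice L {t \<in> carrier L. upclosed (\<beta> t)}"
proof -
  have join: "\<beta> (x \<squnion> y) = \<beta> x \<union> \<beta> y"
    if "x \<in> carrier L" "y \<in> carrier L" "upclosed (\<beta> x)" "upclosed (\<beta> y)" for x y
    using that upclosed_closed[OF upclosed_Un] by (simp add: image_join closed_def)
  have dist: "x \<sqinter> (y \<squnion> z) = (x \<sqinter> y) \<squnion> (x \<sqinter> z)"
    if "x \<in> carrier L" "y \<in> carrier L" "z \<in> carrier L"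
      "upclosed (\<beta> x)" "upclosed (\<beta> y)" "upclosed (\<beta> z)" for x y z
  proof -
    have "\<beta> (x \<sqinter> (y \<squnion> z)) = \<beta> ((x \<sqinter> y) \<squnion> (x \<sqinter> z))"
      using that by (simp add: join image_meet upclosed_Int Int_Un_distrib)
    then show ?thesis using that by (simp add: image_inject)
  qed
  have "\<bottom> \<in> {t \<in> carrier L. upclosed (\<beta> t)}" by (simp add: image_bottom upclosed_def)
  then show ?thesis
    unfolding distributive_sublattice_def
    by (auto simp: join image_meet upclosed_Un upclosed_Int dist)
qed

end

section \<open>Submodules and linear maps\<close>

definition submod :: "('r, 'c) ring_scheme \<Rightarrow> ('r, 'm, 'd) module_scheme \<Rightarrow> 'm set \<Rightarrow> bool"
  where "submod R M N \<longleftrightarrow> N \<subseteq> carrier M \<and> \<zero>\<^bsub>M\<^esub> \<in> N \<and>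
    (\<forall>x\<in>N. \<forall>y\<in>N. x \<oplus>\<^bsub>M\<^esub> y \<in> N) \<and> (\<forall>a\<in>carrier R. \<forall>x\<in>N. a \<odot>\<^bsub>M\<^esub> x \<in> N)"

text \<open>Only the carrier is replaced, so a submodule of a submodule is literally a submodule
  record of the big module and the type never changes.\<close>

abbreviation subm :: "('r, 'm, 'd) module_scheme \<Rightarrow> 'm set \<Rightarrow> ('r, 'm, 'd) module_scheme"
  where "subm M N \<equiv> M\<lparr>carrier := N\<rparr>"

text \<open>Unlike \<open>mod_hom\<close> this does not ask for extensionality, so that the same
  function serves on submodules and composites are plain. \<open>mod_hom_restrict\<close> and
  \<open>mod_hom_linear\<close> translate.\<close>

definition linear ::
    "('r, 'c) ring_scheme \<Rightarrow> ('r, 'm, 'd) module_scheme \<Rightarrow> ('r, 'n, 'e) module_scheme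
      \<Rightarrow> ('m \<Rightarrow> 'n) \<Rightarrow> bool"
  where "linear R M N f \<longleftrightarrow> f \<in> carrier M \<rightarrow> carrier N \<and>
    (\<forall>x\<in>carrier M. \<forall>y\<in>carrier M. f (x \<oplus>\<^bsub>M\<^esub> y) = f x \<oplus>\<^bsub>N\<^esub> f y) \<and>
    (\<forall>a\<in>carrier R. \<forall>x\<in>carrier M. f (a \<odot>\<^bsub>M\<^esub> x) = a \<odot>\<^bsub>N\<^esub> f x)"

lemma submod_subset: "submod R M N \<Longrightarrow> x \<in> N \<Longrightarrow> x \<in> carrier M"
  by (auto simp: submod_def)

lemma submod_add: "submod R M N \<Longrightarrow> x \<in> N \<Longrightarrow> y \<in> N \<Longrightarrow> x \<oplus>\<^bsub>M\<^esub> y \<in> N"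
  by (simp add: submod_def)

lemma submod_smult: "submod R M N \<Longrightarrow> a \<in> carrier R \<Longrightarrow> x \<in> N \<Longrightarrow> a \<odot>\<^bsub>M\<^esub> x \<in> N"
  by (simp add: submod_def)

context left_module
begin

lemma smult_zero_right:
  assumes a: "a \<in> carrier R" shows "a \<odot>\<^bsub>M\<^esub> \<zero>\<^bsub>M\<^esub> = \<zero>\<^bsub>M\<^esub>"
proof -
  have "a \<odot>\<^bsub>M\<^esub> \<zero>\<^bsub>M\<^esub> \<oplus>\<^bsub>M\<^esub> a \<odot>\<^bsub>M\<^esub> \<zero>\<^bsub>M\<^esub> = a \<odot>\<^bsub>M\<^esub> \<zero>\<^bsub>M\<^esub>"
    using a smult_r_distr[OF a M.zero_closed M.zero_closed] by simp
  then show ?thesis using a by (simp add: M.add.l_cancel_one)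
qed

lemma smult_zero_left:
  assumes x: "x \<in> carrier M" shows "\<zero>\<^bsub>R\<^esub> \<odot>\<^bsub>M\<^esub> x = \<zero>\<^bsub>M\<^esub>"
proof -
  have "\<zero>\<^bsub>R\<^esub> \<odot>\<^bsub>M\<^esub> x \<oplus>\<^bsub>M\<^esub> \<zero>\<^bsub>R\<^esub> \<odot>\<^bsub>M\<^esub> x = \<zero>\<^bsub>R\<^esub> \<odot>\<^bsub>M\<^esub> x"
    using x smult_l_distr[OF R.zero_closed R.zero_closed x] by simp
  then show ?thesis using x by (simp add: M.add.l_cancel_one)
qed

lemma smult_minus_left:
  assumes a: "a \<in> carrier R" and x: "x \<in> carrier M"
  shows "(\<ominus>\<^bsub>R\<^esub> a) \<odot>\<^bsub>M\<^esub> x = \<ominus>\<^bsub>M\<^esub> (a \<odot>\<^bsub>M\<^esub> x)"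
proof -
  have "(\<ominus>\<^bsub>R\<^esub> a) \<odot>\<^bsub>M\<^esub> x \<oplus>\<^bsub>M\<^esub> a \<odot>\<^bsub>M\<^esub> x = \<zero>\<^bsub>M\<^esub>"
    using a x smult_l_distr[OF R.a_inv_closed[OF a] a x] by (simp add: R.l_neg smult_zero_left)
  then show ?thesis using a x by (intro M.minus_equality[symmetric]) auto
qed

lemma smult_minus_right:
  assumes a: "a \<in> carrier R" and x: "x \<in> carrier M"
  shows "a \<odot>\<^bsub>M\<^esub> (\<ominus>\<^bsub>M\<^esub> x) = \<ominus>\<^bsub>M\<^esub> (a \<odot>\<^bsub>M\<^esub> x)"
proof -
  have "a \<odot>\<^bsub>M\<^esub> (\<ominus>\<^bsub>M\<^esub> x) \<oplus>\<^bsub>M\<^esub> a \<odot>\<^bsub>M\<^esub> x = \<zero>\<^bsub>M\<^esub>"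
    using a x smult_r_distr[OF a M.a_inv_closed[OF x] x] by (simp add: M.l_neg smult_zero_right)
  then show ?thesis using a x by (intro M.minus_equality[symmetric]) auto
qed

lemma minus_eq_zero:
  assumes "x \<in> carrier M" "y \<in> carrier M" "x \<ominus>\<^bsub>M\<^esub> y = \<zero>\<^bsub>M\<^esub>" shows "x = y"
proof -
  have "x = (x \<ominus>\<^bsub>M\<^esub> y) \<oplus>\<^bsub>M\<^esub> y" using assms(1,2) by (simp add: a_minus_def M.a_assoc M.l_neg)
  then show ?thesis using assms by simp
qed

lemma submod_uminus:
  assumes "submod R M N" "x \<in> N" shows "\<ominus>\<^bsub>M\<^esub> x \<in> N"
proof -
  have "x \<in> carrier M" using assms by (auto simp: submod_def)
  then have "\<ominus>\<^bsub>M\<^esub> x = (\<ominus>\<^bsub>R\<^esub> \<one>\<^bsub>R\<^esub>) \<odot>\<^bsub>M\<^esub> x" by (simp add: smult_minus_left)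
  then show ?thesis using assms R.a_inv_closed[OF R.one_closed] by (simp add: submod_def)
qed

lemma submod_minus: "submod R M N \<Longrightarrow> x \<in> N \<Longrightarrow> y \<in> N \<Longrightarrow> x \<ominus>\<^bsub>M\<^esub> y \<in> N"
  using submod_uminus by (simp add: a_minus_def submod_def)

lemma subm_left_module:
  assumes "submod R M N" shows "left_module R (subm M N)"
proof (intro left_module.intro left_module_axioms.intro R.ring_axioms)
  have N: "x \<in> N \<Longrightarrow> x \<in> carrier M" for x using assms by (auto simp: submod_def)
  show "abelian_group (subm M N)"
  proof (rule abelian_groupI)
    fix x assume "x \<in> carrier (subm M N)"
    then show "\<exists>y\<in>carrier (subm M N). y \<oplus>\<^bsub>subm M N\<^esub> x = \<zero>\<^bsub>subm M N\<^esub>"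
      using assms submod_uminus N by (intro bexI[of _ "\<ominus>\<^bsub>M\<^esub> x"]) (auto simp: M.l_neg)
  qed (use assms N in \<open>auto simp: submod_def M.a_ac\<close>)
qed (use assms in \<open>auto simp: submod_def subset_iff smult_l_distr smult_r_distr smult_assoc\<close>)

lemma submod_carrier: "submod R M (carrier M)"
  by (simp add: submod_def)

lemma submod_zero: "submod R M {\<zero>\<^bsub>M\<^esub>}"
  by (simp add: submod_def smult_zero_right)

lemma submod_Int: "submod R M N \<Longrightarrow> submod R M N' \<Longrightarrow> submod R M (N \<inter> N')"
  by (auto simp: submod_def)

lemma submod_finsum:
  assumes N: "submod R M N" and f: "f \<in> S \<rightarrow> N"
  shows "finsum M f S \<in> N"
proof (cases "finite S")
  case True
  then show ?thesis using f
  proof (induction S rule: finite_induct)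
    case (insert x S)
    then have "f \<in> S \<rightarrow> carrier M" "f x \<in> carrier M" using N by (auto simp: submod_def)
    then show ?case using insert N by (simp add: submod_def)
  qed (use N in \<open>simp add: submod_def\<close>)
qed (use N in \<open>simp add: submod_def M.finsum_infinite\<close>)

lemma smult_finsum:
  assumes a: "a \<in> carrier R" and f: "f \<in> S \<rightarrow> carrier M"
  shows "a \<odot>\<^bsub>M\<^esub> finsum M f S = finsum M (\<lambda>s. a \<odot>\<^bsub>M\<^esub> f s) S"
proof (cases "finite S")
  case True
  then show ?thesis using f
  proof (induction S rule: finite_induct)
    case (insert x S)
    then have "f \<in> S \<rightarrow> carrier M" "f x \<in> carrier M" "(\<lambda>s. a \<odot>\<^bsub>M\<^esub> f s) \<in> S \<rightarrow> carrier M"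
      using a by auto
    then show ?case using insert a by (simp add: smult_r_distr)
  qed (use a in \<open>simp add: smult_zero_right\<close>)
qed (use a in \<open>simp add: M.finsum_infinite smult_zero_right\<close>)

lemma submod_combinations:
  assumes S: "finite S" "S \<subseteq> carrier M"
  defines "W \<equiv> {(\<Oplus>\<^bsub>M\<^esub>s\<in>S. c s \<odot>\<^bsub>M\<^esub> s) | c. c \<in> S \<rightarrow> carrier R}"
  shows "submod R M W" "S \<subseteq> W"
proof -
  have cl: "(\<lambda>s. c s \<odot>\<^bsub>M\<^esub> s) \<in> S \<rightarrow> carrier M" if "c \<in> S \<rightarrow> carrier R" for c
    using that S by auto
  show "submod R M W"
    unfolding submod_def
  proof (intro conjI ballI)
    show "W \<subseteq> carrier M" using cl by (auto simp: W_def)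
    have "(\<Oplus>\<^bsub>M\<^esub>s\<in>S. \<zero>\<^bsub>R\<^esub> \<odot>\<^bsub>M\<^esub> s) = (\<Oplus>\<^bsub>M\<^esub>s\<in>S. \<zero>\<^bsub>M\<^esub>)"
      using S by (intro M.finsum_cong') (auto simp: smult_zero_left)
    then have "\<zero>\<^bsub>M\<^esub> = (\<Oplus>\<^bsub>M\<^esub>s\<in>S. \<zero>\<^bsub>R\<^esub> \<odot>\<^bsub>M\<^esub> s)" by (simp add: M.finsum_zero)
    then show "\<zero>\<^bsub>M\<^esub> \<in> W" unfolding W_def by (intro CollectI exI[of _ "\<lambda>_. \<zero>\<^bsub>R\<^esub>"]) auto
  next
    fix x y assume "x \<in> W" "y \<in> W"
    then obtain c e where c: "c \<in> S \<rightarrow> carrier R" "x = (\<Oplus>\<^bsub>M\<^esub>s\<in>S. c s \<odot>\<^bsub>M\<^esub> s)"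
      and e: "e \<in> S \<rightarrow> carrier R" "y = (\<Oplus>\<^bsub>M\<^esub>s\<in>S. e s \<odot>\<^bsub>M\<^esub> s)" by (auto simp: W_def)
    have "x \<oplus>\<^bsub>M\<^esub> y = (\<Oplus>\<^bsub>M\<^esub>s\<in>S. c s \<odot>\<^bsub>M\<^esub> s \<oplus>\<^bsub>M\<^esub> e s \<odot>\<^bsub>M\<^esub> s)"
      using cl c e by (simp add: M.finsum_addf)
    also have "\<dots> = (\<Oplus>\<^bsub>M\<^esub>s\<in>S. (c s \<oplus>\<^bsub>R\<^esub> e s) \<odot>\<^bsub>M\<^esub> s)"
      using S c e by (intro M.finsum_cong') (auto simp: smult_l_distr Pi_iff subset_iff)
    finally show "x \<oplus>\<^bsub>M\<^esub> y \<in> W"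
      unfolding W_def using c e by (intro CollectI exI[of _ "\<lambda>s. c s \<oplus>\<^bsub>R\<^esub> e s"]) auto
  next
    fix a x assume a: "a \<in> carrier R" and "x \<in> W"
    then obtain c where c: "c \<in> S \<rightarrow> carrier R" "x = (\<Oplus>\<^bsub>M\<^esub>s\<in>S. c s \<odot>\<^bsub>M\<^esub> s)" by (auto simp: W_def)
    have "a \<odot>\<^bsub>M\<^esub> x = (\<Oplus>\<^bsub>M\<^esub>s\<in>S. a \<odot>\<^bsub>M\<^esub> (c s \<odot>\<^bsub>M\<^esub> s))"
      using cl c a by (simp add: smult_finsum)
    also have "\<dots> = (\<Oplus>\<^bsub>M\<^esub>s\<in>S. (a \<otimes>\<^bsub>R\<^esub> c s) \<odot>\<^bsub>M\<^esub> s)"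
      using S c a by (intro M.finsum_cong') (auto simp: smult_assoc Pi_iff subset_iff)
    finally show "a \<odot>\<^bsub>M\<^esub> x \<in> W"
      unfolding W_def using c a by (intro CollectI exI[of _ "\<lambda>s. a \<otimes>\<^bsub>R\<^esub> c s"]) auto
  qed
  show "S \<subseteq> W"
  proof
    fix t assume t: "t \<in> S"
    have "(\<Oplus>\<^bsub>M\<^esub>s\<in>S. (if t = s then \<one>\<^bsub>R\<^esub> else \<zero>\<^bsub>R\<^esub>) \<odot>\<^bsub>M\<^esub> s) = (\<Oplus>\<^bsub>M\<^esub>s\<in>S. if t = s then s else \<zero>\<^bsub>M\<^esub>)"
      using S by (intro M.finsum_cong') (auto simp: smult_zero_left)
    also have "\<dots> = t" using t S by (intro M.finsum_singleton) auto
    finally show "t \<in> W"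
      unfolding W_def by (intro CollectI exI[of _ "\<lambda>s. if t = s then \<one>\<^bsub>R\<^esub> else \<zero>\<^bsub>R\<^esub>"]) auto
  qed
qed

text \<open>Replaces linear combinations by a property of the submodules containing
  \<open>S\<close>, which is easy to carry along images, preimages and a change of scalars.\<close>

lemma finitely_generated_iff:
  "finitely_generated R M \<longleftrightarrow>
    (\<exists>S. finite S \<and> S \<subseteq> carrier M \<and> (\<forall>W. submod R M W \<and> S \<subseteq> W \<longrightarrow> W = carrier M))"
proof
  assume "finitely_generated R M"
  then obtain S where S: "finite S" "S \<subseteq> carrier M"
    "\<And>x. x \<in> carrier M \<Longrightarrow> \<exists>c\<in>S \<rightarrow> carrier R. x = (\<Oplus>\<^bsub>M\<^esub>s\<in>S. c s \<odot>\<^bsub>M\<^esub> s)"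
    unfolding finitely_generated_def by blast
  have "W = carrier M" if W: "submod R M W" "S \<subseteq> W" for W
  proof
    show "W \<subseteq> carrier M" using W by (simp add: submod_def)
    show "carrier M \<subseteq> W"
    proof
      fix x assume "x \<in> carrier M"
      then obtain c where c: "c \<in> S \<rightarrow> carrier R" "x = (\<Oplus>\<^bsub>M\<^esub>s\<in>S. c s \<odot>\<^bsub>M\<^esub> s)" using S(3) by blast
      have "(\<lambda>s. c s \<odot>\<^bsub>M\<^esub> s) \<in> S \<rightarrow> W" using c(1) W unfolding submod_def by blast
      then show "x \<in> W" using submod_finsum[OF W(1)] c(2) by simp
    qed
  qed
  then show "\<exists>S. finite S \<and> S \<subseteq> carrier M \<and> (\<forall>W. submod R M W \<and> S \<subseteq> W \<longrightarrow> W = carrier M)"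
    using S by blast
next
  assume "\<exists>S. finite S \<and> S \<subseteq> carrier M \<and> (\<forall>W. submod R M W \<and> S \<subseteq> W \<longrightarrow> W = carrier M)"
  then obtain S where S: "finite S" "S \<subseteq> carrier M"
    "\<forall>W. submod R M W \<and> S \<subseteq> W \<longrightarrow> W = carrier M" by (elim exE conjE) (rule that)
  have "carrier M = {(\<Oplus>\<^bsub>M\<^esub>s\<in>S. c s \<odot>\<^bsub>M\<^esub> s) | c. c \<in> S \<rightarrow> carrier R}"
    using S(3) submod_combinations[OF S(1,2)] by simp
  then have "\<exists>c\<in>S \<rightarrow> carrier R. x = (\<Oplus>\<^bsub>M\<^esub>s\<in>S. c s \<odot>\<^bsub>M\<^esub> s)" if "x \<in> carrier M" for x
    using that by auto
  then show "finitely_generated R M"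
    unfolding finitely_generated_def using S(1,2) by (intro exI[of _ S]) simp
qed

end

lemma linear_closed: "linear R M N f \<Longrightarrow> x \<in> carrier M \<Longrightarrow> f x \<in> carrier N"
  by (auto simp: linear_def)

lemma linear_add:
  "linear R M N f \<Longrightarrow> x \<in> carrier M \<Longrightarrow> y \<in> carrier M \<Longrightarrow> f (x \<oplus>\<^bsub>M\<^esub> y) = f x \<oplus>\<^bsub>N\<^esub> f y"
  by (auto simp: linear_def)

lemma linear_smult:
  "linear R M N f \<Longrightarrow> a \<in> carrier R \<Longrightarrow> x \<in> carrier M \<Longrightarrow> f (a \<odot>\<^bsub>M\<^esub> x) = a \<odot>\<^bsub>N\<^esub> f x"
  by (auto simp: linear_def)

lemma linear_compose: "linear R M N f \<Longrightarrow> linear R N P g \<Longrightarrow> linear R M P (\<lambda>x. g (f x))"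
  by (auto simp: linear_def Pi_iff)

lemma linear_id: "linear R M M (\<lambda>x. x)"
  by (simp add: linear_def)

lemma linear_zero:
  assumes "left_module R M" "left_module R N" "linear R M N f"
  shows "f \<zero>\<^bsub>M\<^esub> = \<zero>\<^bsub>N\<^esub>"
proof -
  interpret M: left_module R M by fact
  interpret N: left_module R N by fact
  have "f (\<zero>\<^bsub>R\<^esub> \<odot>\<^bsub>M\<^esub> \<zero>\<^bsub>M\<^esub>) = \<zero>\<^bsub>R\<^esub> \<odot>\<^bsub>N\<^esub> f \<zero>\<^bsub>M\<^esub>" using assms by (intro linear_smult) auto
  then show ?thesis
    using linear_closed[OF assms(3) M.M.zero_closed] by (simp add: M.smult_zero_left N.smult_zero_left)
qed

lemma linear_uminus:
  assumes "left_module R M" "left_module R N" "linear R M N f" "x \<in> carrier M"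
  shows "f (\<ominus>\<^bsub>M\<^esub> x) = \<ominus>\<^bsub>N\<^esub> f x"
proof -
  interpret M: left_module R M by fact
  interpret N: left_module R N by fact
  have "f ((\<ominus>\<^bsub>R\<^esub> \<one>\<^bsub>R\<^esub>) \<odot>\<^bsub>M\<^esub> x) = (\<ominus>\<^bsub>R\<^esub> \<one>\<^bsub>R\<^esub>) \<odot>\<^bsub>N\<^esub> f x" using assms by (intro linear_smult) auto
  then show ?thesis
    using assms linear_closed[OF assms(3,4)] by (simp add: M.smult_minus_left N.smult_minus_left)
qed

lemma linear_minus:
  assumes "left_module R M" "left_module R N" "linear R M N f" "x \<in> carrier M" "y \<in> carrier M"
  shows "f (x \<ominus>\<^bsub>M\<^esub> y) = f x \<ominus>\<^bsub>N\<^esub> f y"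
proof -
  interpret M: left_module R M by fact
  show ?thesis
    using assms linear_uminus[OF assms(1-3,5)] linear_add[OF assms(3,4), of "\<ominus>\<^bsub>M\<^esub> y"]
    by (simp add: a_minus_def)
qed

lemma linear_inj_on_iff:
  assumes "left_module R M" "left_module R N" "linear R M N f"
  shows "inj_on f (carrier M) \<longleftrightarrow> (\<forall>x\<in>carrier M. f x = \<zero>\<^bsub>N\<^esub> \<longrightarrow> x = \<zero>\<^bsub>M\<^esub>)"
proof -
  interpret M: left_module R M by fact
  interpret N: left_module R N by fact
  show ?thesis
  proof
    assume "inj_on f (carrier M)"
    then show "\<forall>x\<in>carrier M. f x = \<zero>\<^bsub>N\<^esub> \<longrightarrow> x = \<zero>\<^bsub>M\<^esub>"
      using linear_zero[OF assms] by (metis M.M.zero_closed inj_onD)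
  next
    assume ker: "\<forall>x\<in>carrier M. f x = \<zero>\<^bsub>N\<^esub> \<longrightarrow> x = \<zero>\<^bsub>M\<^esub>"
    show "inj_on f (carrier M)"
    proof (rule inj_onI)
      fix x y assume xy: "x \<in> carrier M" "y \<in> carrier M" "f x = f y"
      have "f (x \<ominus>\<^bsub>M\<^esub> y) = \<zero>\<^bsub>N\<^esub>"
        using xy linear_minus[OF assms xy(1,2)] linear_closed[OF assms(3) xy(2)] N.M.r_neg
        by (simp add: a_minus_def)
      then have "x \<ominus>\<^bsub>M\<^esub> y = \<zero>\<^bsub>M\<^esub>" using ker xy by (simp add: M.M.minus_closed)
      then show "x = y" using M.minus_eq_zero xy by simp
    qed
  qed
qed

lemma linear_subm: "submod R M N \<Longrightarrow> linear R (subm M N) M (\<lambda>x. x)"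
  by (auto simp: linear_def submod_def)

lemma linear_restrict_dom: "linear R M P f \<Longrightarrow> N \<subseteq> carrier M \<Longrightarrow> linear R (subm M N) P f"
  by (auto simp: linear_def subset_iff)

lemma linear_restrict_codom: "linear R M P f \<Longrightarrow> f ` carrier M \<subseteq> N \<Longrightarrow> linear R M (subm P N) f"
  by (auto simp: linear_def)

lemma submod_image:
  assumes "left_module R M" "left_module R N" "linear R M N f" "submod R M U"
  shows "submod R N (f ` U)"
  unfolding submod_def
proof (intro conjI ballI)
  have U: "U \<subseteq> carrier M" using assms by (simp add: submod_def)
  show "f ` U \<subseteq> carrier N" using U assms(3) by (auto simp: linear_def)
  show "\<zero>\<^bsub>N\<^esub> \<in> f ` U" using linear_zero[OF assms(1-3)] assms(4) by (force simp: submod_def)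
  fix x y assume "x \<in> f ` U" "y \<in> f ` U"
  then obtain u v where "u \<in> U" "v \<in> U" "x = f u" "y = f v" by auto
  then have "x \<oplus>\<^bsub>N\<^esub> y = f (u \<oplus>\<^bsub>M\<^esub> v)" "u \<oplus>\<^bsub>M\<^esub> v \<in> U"
    using submod_subset[OF assms(4)] submod_add[OF assms(4)] linear_add[OF assms(3), of u v] by auto
  then show "x \<oplus>\<^bsub>N\<^esub> y \<in> f ` U" by blast
next
  fix a x assume "a \<in> carrier R" "x \<in> f ` U"
  then obtain u where u: "u \<in> U" "x = f u" "a \<in> carrier R" by auto
  then have "a \<odot>\<^bsub>N\<^esub> x = f (a \<odot>\<^bsub>M\<^esub> u)" "a \<odot>\<^bsub>M\<^esub> u \<in> U"
    using assms(4) linear_smult[OF assms(3), of a u] by (auto simp: submod_def)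
  then show "a \<odot>\<^bsub>N\<^esub> x \<in> f ` U" by blast
qed

lemma submod_vimage:
  assumes "left_module R M" "left_module R N" "linear R M N f" "submod R N U"
  shows "submod R M {x \<in> carrier M. f x \<in> U}"
proof -
  interpret M: left_module R M by fact
  show ?thesis using assms(3,4) linear_zero[OF assms(1-3)] by (auto simp: submod_def linear_def)
qed

lemma submod_of_subm: "submod R M N \<Longrightarrow> submod R (subm M N) W \<longleftrightarrow> submod R M W \<and> W \<subseteq> N"
  by (auto simp: submod_def)

lemma finitely_generated_image:
  assumes "left_module R M" "left_module R N" "linear R M N f" "f ` carrier M = carrier N"
    and "finitely_generated R M"
  shows "finitely_generated R N"
proof -
  interpret M: left_module R M by fact
  interpret N: left_module R N by fact
  obtain S where S: "finite S" "S \<subseteq> carrier M" "\<forall>W. submod R M W \<and> S \<subseteq> W \<longrightarrow> W = carrier M"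
    using assms(5) unfolding M.finitely_generated_iff by (elim exE conjE) (rule that)
  have "W = carrier N" if W: "submod R N W" "f ` S \<subseteq> W" for W
  proof
    show "W \<subseteq> carrier N" using W by (simp add: submod_def)
    have "{x \<in> carrier M. f x \<in> W} = carrier M"
      using S(2,3) W(2) submod_vimage[OF assms(1-3) W(1)] by auto
    then show "carrier N \<subseteq> W" unfolding assms(4)[symmetric] by blast
  qed
  then show ?thesis
    unfolding N.finitely_generated_iff using S(1,2) assms(3)
    by (intro exI[of _ "f ` S"]) (auto simp: linear_def)
qed

text \<open>The quotient by \<open>N\<close> is realized on a set of coset representatives, so that it has the
  same underlying type as \<open>M\<close>.\<close>

lemma quotient_exists:
  fixes M :: "('r, 'm) module"
  assumes M: "left_module R M" and N: "submod R M N"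
  obtains Q :: "('r, 'm) module" and p where "left_module R Q" "linear R M Q p"
    "p ` carrier M = carrier Q" "{x \<in> carrier M. p x = \<zero>\<^bsub>Q\<^esub>} = N"
proof -
  interpret M: left_module R M by fact
  have NM: "x \<in> N \<Longrightarrow> x \<in> carrier M" for x using N by (auto simp: submod_def)
  define r where "r x = (SOME y. y \<in> carrier M \<and> (\<exists>n\<in>N. y = x \<oplus>\<^bsub>M\<^esub> n))" for x
  have r: "r x \<in> carrier M" "\<exists>n\<in>N. r x = x \<oplus>\<^bsub>M\<^esub> n" if "x \<in> carrier M" for x
  proof -
    have "x \<in> carrier M \<and> (\<exists>n\<in>N. x = x \<oplus>\<^bsub>M\<^esub> n)" using that N by (auto simp: submod_def intro!: bexI[of _ "\<zero>\<^bsub>M\<^esub>"])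
    from someI[of "\<lambda>y. y \<in> carrier M \<and> (\<exists>n\<in>N. y = x \<oplus>\<^bsub>M\<^esub> n)", OF this]
    show "r x \<in> carrier M" "\<exists>n\<in>N. r x = x \<oplus>\<^bsub>M\<^esub> n" by (auto simp: r_def)
  qed
  \<comment> \<open>\<open>r x\<close> is chosen by a predicate that depends only on the coset of
    \<open>x\<close>, so shifting by \<open>n\<close> leaves the choice unchanged.\<close>
  have r_shift: "r (x \<oplus>\<^bsub>M\<^esub> n) = r x" if x: "x \<in> carrier M" and n: "n \<in> N" for x n
  proof -
    have "(\<exists>k\<in>N. y = x \<oplus>\<^bsub>M\<^esub> n \<oplus>\<^bsub>M\<^esub> k) \<longleftrightarrow> (\<exists>k\<in>N. y = x \<oplus>\<^bsub>M\<^esub> k)" for y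
    proof
      assume "\<exists>k\<in>N. y = x \<oplus>\<^bsub>M\<^esub> n \<oplus>\<^bsub>M\<^esub> k"
      then obtain k where "k \<in> N" "y = x \<oplus>\<^bsub>M\<^esub> n \<oplus>\<^bsub>M\<^esub> k" by auto
      then have "n \<oplus>\<^bsub>M\<^esub> k \<in> N" "y = x \<oplus>\<^bsub>M\<^esub> (n \<oplus>\<^bsub>M\<^esub> k)"
        using N x n NM by (auto simp: submod_def M.M.a_assoc)
      then show "\<exists>k\<in>N. y = x \<oplus>\<^bsub>M\<^esub> k" by blast
    next
      assume "\<exists>k\<in>N. y = x \<oplus>\<^bsub>M\<^esub> k"
      then obtain k where k: "k \<in> N" "y = x \<oplus>\<^bsub>M\<^esub> k" by auto
      have "\<ominus>\<^bsub>M\<^esub> n \<oplus>\<^bsub>M\<^esub> k \<in> N" using k n M.submod_uminus[OF N] N by (simp add: submod_def)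
      moreover have "y = x \<oplus>\<^bsub>M\<^esub> n \<oplus>\<^bsub>M\<^esub> (\<ominus>\<^bsub>M\<^esub> n \<oplus>\<^bsub>M\<^esub> k)"
        using k n x NM by (simp add: M.M.a_assoc M.M.r_neg2)
      ultimately show "\<exists>k\<in>N. y = x \<oplus>\<^bsub>M\<^esub> n \<oplus>\<^bsub>M\<^esub> k" by blast
    qed
    then show ?thesis by (simp add: r_def)
  qed
  have r_r: "r (r x) = r x" if "x \<in> carrier M" for x
    using r(2)[OF that] r_shift[OF that] by auto
  have r_l: "r (r x \<oplus>\<^bsub>M\<^esub> y) = r (x \<oplus>\<^bsub>M\<^esub> y)" if x: "x \<in> carrier M" and y: "y \<in> carrier M" for x y
  proof -
    obtain n where n: "n \<in> N" "r x = x \<oplus>\<^bsub>M\<^esub> n" using r(2)[OF x] by auto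
    have "r x \<oplus>\<^bsub>M\<^esub> y = (x \<oplus>\<^bsub>M\<^esub> y) \<oplus>\<^bsub>M\<^esub> n" using n x y NM by (simp add: M.M.a_ac)
    then show ?thesis using r_shift[of "x \<oplus>\<^bsub>M\<^esub> y" n] n x y by simp
  qed
  have r_rr: "r (x \<oplus>\<^bsub>M\<^esub> r y) = r (x \<oplus>\<^bsub>M\<^esub> y)" if x: "x \<in> carrier M" and y: "y \<in> carrier M" for x y
    using r_l[OF y x] x y r(1) by (simp add: M.M.a_comm)
  have r_s: "r (a \<odot>\<^bsub>M\<^esub> r x) = r (a \<odot>\<^bsub>M\<^esub> x)" if a: "a \<in> carrier R" and x: "x \<in> carrier M" for a x
  proof -
    obtain n where n: "n \<in> N" "r x = x \<oplus>\<^bsub>M\<^esub> n" using r(2)[OF x] by auto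
    have "a \<odot>\<^bsub>M\<^esub> r x = a \<odot>\<^bsub>M\<^esub> x \<oplus>\<^bsub>M\<^esub> a \<odot>\<^bsub>M\<^esub> n" "a \<odot>\<^bsub>M\<^esub> n \<in> N"
      using n x a NM N by (auto simp: M.smult_r_distr submod_def)
    then show ?thesis using r_shift[of "a \<odot>\<^bsub>M\<^esub> x" "a \<odot>\<^bsub>M\<^esub> n"] a x by simp
  qed
  define Q :: "('r, 'm) module" where "Q =
    \<lparr>carrier = r ` carrier M, mult = (\<lambda>x y. x), one = r \<zero>\<^bsub>M\<^esub>, zero = r \<zero>\<^bsub>M\<^esub>,
     add = (\<lambda>x y. r (x \<oplus>\<^bsub>M\<^esub> y)), smult = (\<lambda>a x. r (a \<odot>\<^bsub>M\<^esub> x))\<rparr>"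
  have sel: "carrier Q = r ` carrier M" "\<zero>\<^bsub>Q\<^esub> = r \<zero>\<^bsub>M\<^esub>"
    "\<And>x y. x \<oplus>\<^bsub>Q\<^esub> y = r (x \<oplus>\<^bsub>M\<^esub> y)" "\<And>a x. a \<odot>\<^bsub>Q\<^esub> x = r (a \<odot>\<^bsub>M\<^esub> x)"
    by (simp_all add: Q_def)
  have QM: "x \<in> carrier M" and Qr: "r x = x" if "x \<in> carrier Q" for x
    using that r(1) r_r by (auto simp: sel(1))
  have rQ: "r x \<in> carrier Q" if "x \<in> carrier M" for x using that by (simp add: sel(1))
  have ag: "abelian_group Q"
  proof (rule abelian_groupI)
    fix x assume x: "x \<in> carrier Q"
    show "\<zero>\<^bsub>Q\<^esub> \<oplus>\<^bsub>Q\<^esub> x = x" using r_l[of "\<zero>\<^bsub>M\<^esub>" x] QM[OF x] Qr[OF x] by (simp add: sel)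
    have "r (\<ominus>\<^bsub>M\<^esub> x) \<oplus>\<^bsub>Q\<^esub> x = \<zero>\<^bsub>Q\<^esub>"
      using r_l[of "\<ominus>\<^bsub>M\<^esub> x" x] QM[OF x] by (simp add: sel M.M.l_neg)
    then show "\<exists>y\<in>carrier Q. y \<oplus>\<^bsub>Q\<^esub> x = \<zero>\<^bsub>Q\<^esub>" using rQ QM[OF x] by blast
  next
    fix x y assume xy: "x \<in> carrier Q" "y \<in> carrier Q"
    show "x \<oplus>\<^bsub>Q\<^esub> y \<in> carrier Q" unfolding sel(3) using xy QM by (intro rQ) simp
    show "x \<oplus>\<^bsub>Q\<^esub> y = y \<oplus>\<^bsub>Q\<^esub> x"
      unfolding sel(3) by (simp add: M.M.a_comm[OF QM[OF xy(1)] QM[OF xy(2)]])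
  next
    fix x y z assume "x \<in> carrier Q" "y \<in> carrier Q" "z \<in> carrier Q"
    then have xyz: "x \<in> carrier M" "y \<in> carrier M" "z \<in> carrier M" using QM by auto
    then have "x \<oplus>\<^bsub>M\<^esub> y \<oplus>\<^bsub>M\<^esub> z = x \<oplus>\<^bsub>M\<^esub> (y \<oplus>\<^bsub>M\<^esub> z)" by (rule M.M.a_assoc)
    then show "x \<oplus>\<^bsub>Q\<^esub> y \<oplus>\<^bsub>Q\<^esub> z = x \<oplus>\<^bsub>Q\<^esub> (y \<oplus>\<^bsub>Q\<^esub> z)"
      unfolding sel(3) using r_l[of "x \<oplus>\<^bsub>M\<^esub> y" z] r_rr[of x "y \<oplus>\<^bsub>M\<^esub> z"] xyz by simp
  next
    show "\<zero>\<^bsub>Q\<^esub> \<in> carrier Q" unfolding sel(2) by (rule rQ) simp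
  qed
  have r_add: "r (x \<oplus>\<^bsub>M\<^esub> y) = r x \<oplus>\<^bsub>Q\<^esub> r y" if "x \<in> carrier M" "y \<in> carrier M" for x y
    unfolding sel(3) using that r_l[of x "r y"] r_rr[of x y] r(1) by simp
  have r_smult: "r (a \<odot>\<^bsub>M\<^esub> x) = a \<odot>\<^bsub>Q\<^esub> r x" if "x \<in> carrier M" "a \<in> carrier R" for x a
    unfolding sel(4) using that r_s by simp
  have Q: "left_module R Q"
  proof (intro left_module.intro left_module_axioms.intro ag M.R.ring_axioms)
    fix a x assume ax: "a \<in> carrier R" "x \<in> carrier Q"
    show "a \<odot>\<^bsub>Q\<^esub> x \<in> carrier Q" unfolding sel(4) using ax QM by (intro rQ) simp
    fix b assume b: "b \<in> carrier R"
    show "(a \<oplus>\<^bsub>R\<^esub> b) \<odot>\<^bsub>Q\<^esub> x = a \<odot>\<^bsub>Q\<^esub> x \<oplus>\<^bsub>Q\<^esub> b \<odot>\<^bsub>Q\<^esub> x"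
      using r_add[of "a \<odot>\<^bsub>M\<^esub> x" "b \<odot>\<^bsub>M\<^esub> x"] ax b QM by (simp add: sel(4) M.smult_l_distr)
    show "(a \<otimes>\<^bsub>R\<^esub> b) \<odot>\<^bsub>Q\<^esub> x = a \<odot>\<^bsub>Q\<^esub> (b \<odot>\<^bsub>Q\<^esub> x)"
      using r_s[of a "b \<odot>\<^bsub>M\<^esub> x"] ax b QM by (simp add: sel(4) M.smult_assoc)
  next
    fix a x y assume axy: "a \<in> carrier R" "x \<in> carrier Q" "y \<in> carrier Q"
    have "a \<odot>\<^bsub>Q\<^esub> (x \<oplus>\<^bsub>Q\<^esub> y) = r (a \<odot>\<^bsub>M\<^esub> (x \<oplus>\<^bsub>M\<^esub> y))"
      using r_s[of a "x \<oplus>\<^bsub>M\<^esub> y"] axy QM by (simp add: sel(3,4))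
    then show "a \<odot>\<^bsub>Q\<^esub> (x \<oplus>\<^bsub>Q\<^esub> y) = a \<odot>\<^bsub>Q\<^esub> x \<oplus>\<^bsub>Q\<^esub> a \<odot>\<^bsub>Q\<^esub> y"
      using r_add[of "a \<odot>\<^bsub>M\<^esub> x" "a \<odot>\<^bsub>M\<^esub> y"] axy QM by (simp add: sel(4) M.smult_r_distr)
  next
    fix x assume "x \<in> carrier Q"
    then show "\<one>\<^bsub>R\<^esub> \<odot>\<^bsub>Q\<^esub> x = x" using QM Qr by (simp add: sel(4))
  qed
  have lin: "linear R M Q r"
    using rQ r_add r_smult by (simp add: linear_def)
  have "{x \<in> carrier M. r x = \<zero>\<^bsub>Q\<^esub>} = N"
  proof (intro equalityI subsetI)
    fix x assume "x \<in> {x \<in> carrier M. r x = \<zero>\<^bsub>Q\<^esub>}"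
    then have x: "x \<in> carrier M" "r x = r \<zero>\<^bsub>M\<^esub>" by (auto simp: sel)
    obtain n where n: "n \<in> N" "r x = x \<oplus>\<^bsub>M\<^esub> n" using r(2)[OF x(1)] by auto
    \<comment> \<open>The zero of the quotient is the representative of \<open>N\<close>, which is
      some \<open>k\<close> in \<open>N\<close> and not necessarily the zero of
      \<open>M\<close>.\<close>
    obtain k where k: "k \<in> N" "r \<zero>\<^bsub>M\<^esub> = \<zero>\<^bsub>M\<^esub> \<oplus>\<^bsub>M\<^esub> k" using r(2)[OF M.M.zero_closed] by auto
    have "x \<oplus>\<^bsub>M\<^esub> n = k" using n k x NM by simp
    then have "k \<ominus>\<^bsub>M\<^esub> n = (x \<oplus>\<^bsub>M\<^esub> n) \<ominus>\<^bsub>M\<^esub> n" by simp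
    also have "\<dots> = x" using n(1) x(1) NM by (simp add: a_minus_def M.M.a_assoc M.M.r_neg)
    finally have "k \<ominus>\<^bsub>M\<^esub> n = x" .
    then show "x \<in> N" using M.submod_minus[OF N k(1) n(1)] by simp
  next
    fix x assume "x \<in> N"
    then show "x \<in> {x \<in> carrier M. r x = \<zero>\<^bsub>Q\<^esub>}"
      using r_shift[of "\<zero>\<^bsub>M\<^esub>" x] NM by (simp add: sel)
  qed
  then show ?thesis using that[OF Q lin] by (simp add: sel)
qed

lemma linear_factor:
  assumes "left_module R M" "left_module R N" "left_module R P"
    and g: "linear R M N g" "g ` carrier M = carrier N" and h: "linear R M P h"
    and ker: "\<And>x. \<lbrakk>x \<in> carrier M; g x = \<zero>\<^bsub>N\<^esub>\<rbrakk> \<Longrightarrow> h x = \<zero>\<^bsub>P\<^esub>"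
  obtains k where "linear R N P k" "\<And>x. x \<in> carrier M \<Longrightarrow> k (g x) = h x"
proof -
  interpret M: left_module R M by fact
  interpret N: left_module R N by fact
  interpret P: left_module R P by fact
  define k where "k y = h (inv_into (carrier M) g y)" for y
  \<comment> \<open>Any preimage may be used to define \<open>k\<close>: two of them differ by an
    element of the kernel of \<open>g\<close>, which \<open>h\<close> kills.\<close>
  have kg: "k (g x) = h x" if x: "x \<in> carrier M" for x
  proof -
    let ?x = "inv_into (carrier M) g (g x)"
    have x': "?x \<in> carrier M" "g ?x = g x" using x by (auto intro: inv_into_into simp: f_inv_into_f)
    have "g (?x \<ominus>\<^bsub>M\<^esub> x) = \<zero>\<^bsub>N\<^esub>"
      using x' x linear_minus[OF assms(1,2) g(1) x'(1) x] linear_closed[OF g(1) x] N.M.r_neg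
      by (simp add: a_minus_def)
    then have "h (?x \<ominus>\<^bsub>M\<^esub> x) = \<zero>\<^bsub>P\<^esub>" using ker x x' by (simp add: M.M.minus_closed)
    then have "h ?x \<ominus>\<^bsub>P\<^esub> h x = \<zero>\<^bsub>P\<^esub>" using linear_minus[OF assms(1,3) h x'(1) x] by simp
    then show ?thesis using P.minus_eq_zero linear_closed[OF h] x x' by (simp add: k_def)
  qed
  have "linear R N P k"
    unfolding linear_def
  proof (intro conjI ballI)
    show "k \<in> carrier N \<rightarrow> carrier P" using kg h by (auto simp: linear_def simp flip: g(2))
  next
    fix y z assume "y \<in> carrier N" "z \<in> carrier N"
    then obtain u v where "u \<in> carrier M" "v \<in> carrier M" "y = g u" "z = g v" using g(2) by (metis imageE)
    then show "k (y \<oplus>\<^bsub>N\<^esub> z) = k y \<oplus>\<^bsub>P\<^esub> k z"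
      using kg[of "u \<oplus>\<^bsub>M\<^esub> v"] by (simp add: kg linear_add[OF g(1)] linear_add[OF h])
  next
    fix a y assume "a \<in> carrier R" "y \<in> carrier N"
    then obtain u where "u \<in> carrier M" "y = g u" "a \<in> carrier R" using g(2) by (metis imageE)
    then show "k (a \<odot>\<^bsub>N\<^esub> y) = a \<odot>\<^bsub>P\<^esub> k y"
      using kg[of "a \<odot>\<^bsub>M\<^esub> u"] by (simp add: kg linear_smult[OF g(1)] linear_smult[OF h])
  qed
  then show ?thesis using that kg by blast
qed

section \<open>Dimension\<close>

text \<open>\<open>dim_le K V n W\<close> means that the subspace \<open>W\<close> is spanned by at most \<open>n\<close> vectors; the
  dimension theory of the library is restricted to vector spaces inside a ring.\<close>

definition adjoin :: "('r, 'c) ring_scheme \<Rightarrow> ('r, 'm, 'd) module_scheme \<Rightarrow> 'm set \<Rightarrow> 'm \<Rightarrow> 'm set"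
  where "adjoin K V U b = {u \<oplus>\<^bsub>V\<^esub> c \<odot>\<^bsub>V\<^esub> b | u c. u \<in> U \<and> c \<in> carrier K}"

primrec dim_le :: "('r, 'c) ring_scheme \<Rightarrow> ('r, 'm, 'd) module_scheme \<Rightarrow> nat \<Rightarrow> 'm set \<Rightarrow> bool"
  where
    "dim_le K V 0 = (\<lambda>W. W = {\<zero>\<^bsub>V\<^esub>})"
  | "dim_le K V (Suc n) = (\<lambda>W. \<exists>U b. dim_le K V n U \<and> b \<in> carrier V \<and> W = adjoin K V U b)"

context left_module
begin

lemma submod_adjoin:
  assumes U: "submod R M U" and b: "b \<in> carrier M"
  shows "submod R M (adjoin R M U b)"
proof -
  have UM: "u \<in> U \<Longrightarrow> u \<in> carrier M" for u using U by (auto simp: submod_def)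
  show ?thesis
    unfolding submod_def
  proof (intro conjI ballI)
    show "adjoin R M U b \<subseteq> carrier M" using UM b by (auto simp: adjoin_def)
    have "\<zero>\<^bsub>M\<^esub> = \<zero>\<^bsub>M\<^esub> \<oplus>\<^bsub>M\<^esub> \<zero>\<^bsub>R\<^esub> \<odot>\<^bsub>M\<^esub> b" using b by (simp add: smult_zero_left)
    then show "\<zero>\<^bsub>M\<^esub> \<in> adjoin R M U b" unfolding adjoin_def using U by (auto simp: submod_def)
  next
    fix x y assume "x \<in> adjoin R M U b" "y \<in> adjoin R M U b"
    then obtain u c v e where *: "u \<in> U" "v \<in> U" "c \<in> carrier R" "e \<in> carrier R"
      "x = u \<oplus>\<^bsub>M\<^esub> c \<odot>\<^bsub>M\<^esub> b" "y = v \<oplus>\<^bsub>M\<^esub> e \<odot>\<^bsub>M\<^esub> b" by (auto simp: adjoin_def)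
    then have "x \<oplus>\<^bsub>M\<^esub> y = (u \<oplus>\<^bsub>M\<^esub> v) \<oplus>\<^bsub>M\<^esub> (c \<oplus>\<^bsub>R\<^esub> e) \<odot>\<^bsub>M\<^esub> b"
      using UM b by (simp add: smult_l_distr M.a_ac)
    moreover have "u \<oplus>\<^bsub>M\<^esub> v \<in> U" "c \<oplus>\<^bsub>R\<^esub> e \<in> carrier R" using * U by (auto simp: submod_def)
    ultimately show "x \<oplus>\<^bsub>M\<^esub> y \<in> adjoin R M U b" unfolding adjoin_def by blast
  next
    fix a x assume a: "a \<in> carrier R" and "x \<in> adjoin R M U b"
    then obtain u c where *: "u \<in> U" "c \<in> carrier R" "x = u \<oplus>\<^bsub>M\<^esub> c \<odot>\<^bsub>M\<^esub> b" by (auto simp: adjoin_def)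
    then have "a \<odot>\<^bsub>M\<^esub> x = a \<odot>\<^bsub>M\<^esub> u \<oplus>\<^bsub>M\<^esub> (a \<otimes>\<^bsub>R\<^esub> c) \<odot>\<^bsub>M\<^esub> b"
      using UM b a by (simp add: smult_r_distr smult_assoc)
    moreover have "a \<odot>\<^bsub>M\<^esub> u \<in> U" "a \<otimes>\<^bsub>R\<^esub> c \<in> carrier R" using * a U by (auto simp: submod_def)
    ultimately show "a \<odot>\<^bsub>M\<^esub> x \<in> adjoin R M U b" unfolding adjoin_def by blast
  qed
qed

lemma adjoin_superset:
  assumes U: "submod R M U" and b: "b \<in> carrier M"
  shows "U \<subseteq> adjoin R M U b" "b \<in> adjoin R M U b"
proof -
  have UM: "u \<in> U \<Longrightarrow> u \<in> carrier M" for u using U by (auto simp: submod_def)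
  show "U \<subseteq> adjoin R M U b"
  proof
    fix u assume "u \<in> U"
    then have "u = u \<oplus>\<^bsub>M\<^esub> \<zero>\<^bsub>R\<^esub> \<odot>\<^bsub>M\<^esub> b" using b UM by (simp add: smult_zero_left)
    then show "u \<in> adjoin R M U b" using \<open>u \<in> U\<close> unfolding adjoin_def by blast
  qed
  have "b = \<zero>\<^bsub>M\<^esub> \<oplus>\<^bsub>M\<^esub> \<one>\<^bsub>R\<^esub> \<odot>\<^bsub>M\<^esub> b" "\<zero>\<^bsub>M\<^esub> \<in> U" using b U by (auto simp: submod_def)
  then show "b \<in> adjoin R M U b" unfolding adjoin_def by blast
qed

lemma adjoin_least:
  "\<lbrakk>submod R M W; U \<subseteq> W; b \<in> W\<rbrakk> \<Longrightarrow> adjoin R M U b \<subseteq> W"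
  by (auto simp: adjoin_def submod_def)

lemma dim_le_submod: "dim_le R M n W \<Longrightarrow> submod R M W"
  by (induction n arbitrary: W) (auto simp: submod_zero submod_adjoin)

lemma dim_le_generators:
  "dim_le R M n W \<Longrightarrow> \<exists>S. finite S \<and> S \<subseteq> W \<and> (\<forall>U. submod R M U \<and> S \<subseteq> U \<longrightarrow> W \<subseteq> U)"
proof (induction n arbitrary: W)
  case 0
  then show ?case by (intro exI[of _ "{}"]) (auto simp: submod_def)
next
  case (Suc n)
  then obtain U b where U: "dim_le R M n U" "b \<in> carrier M" "W = adjoin R M U b" by auto
  obtain S where S: "finite S" "S \<subseteq> U" "\<forall>X. submod R M X \<and> S \<subseteq> X \<longrightarrow> U \<subseteq> X"
    using Suc.IH[OF U(1)] by (elim exE conjE) (rule that)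
  have "insert b S \<subseteq> W" using adjoin_superset[OF dim_le_submod[OF U(1)] U(2)] S(2) U(3) by auto
  moreover have "W \<subseteq> X" if X: "submod R M X" "insert b S \<subseteq> X" for X
    unfolding U(3) using adjoin_least[OF X(1)] S(3) X by simp
  ultimately show ?case using S(1) by (intro exI[of _ "insert b S"]) auto
qed

lemma dim_le_cover:
  assumes "finite S" "S \<subseteq> carrier M"
  shows "\<exists>n W. dim_le R M n W \<and> S \<subseteq> W"
  using assms
proof (induction S rule: finite_induct)
  case empty
  show ?case by (intro exI[of _ 0] exI[of _ "{\<zero>\<^bsub>M\<^esub>}"]) simp
next
  case (insert b S)
  then obtain n W where W: "dim_le R M n W" "S \<subseteq> W" by auto
  then have "dim_le R M (Suc n) (adjoin R M W b)" using insert by auto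
  moreover have "insert b S \<subseteq> adjoin R M W b"
    using adjoin_superset[OF dim_le_submod[OF W(1)], of b] W(2) insert by auto
  ultimately show ?case by blast
qed

lemma dim_le_subm: "dim_le R M n W \<Longrightarrow> submod R M N \<Longrightarrow> W \<subseteq> N \<Longrightarrow> dim_le R (subm M N) n W"
proof (induction n arbitrary: W)
  case (Suc n)
  then obtain U b where U: "dim_le R M n U" "b \<in> carrier M" "W = adjoin R M U b" by auto
  then have "U \<subseteq> N" "b \<in> N" using adjoin_superset[OF dim_le_submod[OF U(1)] U(2)] Suc.prems by auto
  then show ?case using Suc.IH[OF U(1) Suc.prems(2)] U by (auto simp: adjoin_def)
qed simp

text \<open>Steinitz exchange. If \<open>U\<close> is not inside the span \<open>W'\<close> of the
  first \<open>n\<close> vectors, some \<open>v\<close> in \<open>U\<close> involves the last vector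
  \<open>b\<close> and can replace it; then \<open>U\<close> is spanned by \<open>v\<close> and
  \<open>U \<inter> W'\<close>, and the induction hypothesis applies to the latter as a proper
  subspace of \<open>W'\<close>.\<close>

lemma dim_le_proper_subspace:
  assumes K: "field R"
  shows "\<lbrakk>dim_le R M n W; submod R M U; U \<subset> W\<rbrakk> \<Longrightarrow> \<exists>m<n. dim_le R M m U"
proof (induction n arbitrary: U W)
  case 0
  then show ?case by (auto simp: submod_def)
next
  case (Suc n)
  interpret K: field R by fact
  obtain W' b where W': "dim_le R M n W'" "b \<in> carrier M" "W = adjoin R M W' b"
    using Suc.prems(1) by auto
  have sW': "submod R M W'" by (rule dim_le_submod[OF W'(1)])
  have W'M: "w \<in> W' \<Longrightarrow> w \<in> carrier M" for w using sW' by (auto simp: submod_def)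
  show ?case
  proof (cases "U \<subseteq> W'")
    case True
    then consider "U = W'" | "U \<subset> W'" by blast
    then show ?thesis
    proof cases
      case 1
      then show ?thesis using W'(1) by blast
    next
      case 2
      then show ?thesis using Suc.IH[OF W'(1) Suc.prems(2)] less_SucI by blast
    qed
  next
    case False
    then obtain v where v: "v \<in> U" "v \<notin> W'" by auto
    have vM: "v \<in> carrier M" using v Suc.prems(2) by (auto simp: submod_def)
    obtain w0 c where vc: "v = w0 \<oplus>\<^bsub>M\<^esub> c \<odot>\<^bsub>M\<^esub> b" "w0 \<in> W'" "c \<in> carrier R"
      using v(1) Suc.prems(3) W'(3) unfolding adjoin_def by blast
    have "c \<noteq> \<zero>\<^bsub>R\<^esub>" using vc v W'M W'(2) by (auto simp: smult_zero_left)
    then have c: "inv\<^bsub>R\<^esub> c \<in> carrier R" "inv\<^bsub>R\<^esub> c \<otimes>\<^bsub>R\<^esub> c = \<one>\<^bsub>R\<^esub>"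
      using vc(3) by (simp_all add: K.field_Units)
    \<comment> \<open>Solves \<open>v = w0 + c b\<close> for \<open>b\<close> and substitutes, which
      is possible as \<open>c\<close> is invertible.\<close>
    have eq: "w \<oplus>\<^bsub>M\<^esub> e \<odot>\<^bsub>M\<^esub> b = (w \<ominus>\<^bsub>M\<^esub> (e \<otimes>\<^bsub>R\<^esub> inv\<^bsub>R\<^esub> c) \<odot>\<^bsub>M\<^esub> w0) \<oplus>\<^bsub>M\<^esub> (e \<otimes>\<^bsub>R\<^esub> inv\<^bsub>R\<^esub> c) \<odot>\<^bsub>M\<^esub> v"
      if w: "w \<in> W'" and e: "e \<in> carrier R" for w e
    proof -
      let ?q = "e \<otimes>\<^bsub>R\<^esub> inv\<^bsub>R\<^esub> c"
      have "?q \<odot>\<^bsub>M\<^esub> v = ?q \<odot>\<^bsub>M\<^esub> w0 \<oplus>\<^bsub>M\<^esub> (?q \<otimes>\<^bsub>R\<^esub> c) \<odot>\<^bsub>M\<^esub> b"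
        using vc e c W'M W'(2) by (simp add: smult_r_distr smult_assoc)
      also have "?q \<otimes>\<^bsub>R\<^esub> c = e" using e c vc(3) by (simp add: R.m_assoc)
      finally have "?q \<odot>\<^bsub>M\<^esub> v = ?q \<odot>\<^bsub>M\<^esub> w0 \<oplus>\<^bsub>M\<^esub> e \<odot>\<^bsub>M\<^esub> b" .
      then show ?thesis
        using w e c vc(2) W'M W'(2) by (simp add: a_minus_def M.a_assoc M.r_neg1 M.r_neg2)
    qed
    let ?U' = "U \<inter> W'"
    have sU': "submod R M ?U'" using submod_Int Suc.prems(2) sW' by blast
    have U: "U = adjoin R M ?U' v"
    proof
      show "adjoin R M ?U' v \<subseteq> U" using adjoin_least[OF Suc.prems(2)] v by auto
      show "U \<subseteq> adjoin R M ?U' v"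
      proof
        fix u assume u: "u \<in> U"
        then obtain w e where we: "u = w \<oplus>\<^bsub>M\<^esub> e \<odot>\<^bsub>M\<^esub> b" "w \<in> W'" "e \<in> carrier R"
          using Suc.prems(3) W'(3) unfolding adjoin_def by blast
        let ?q = "e \<otimes>\<^bsub>R\<^esub> inv\<^bsub>R\<^esub> c" and ?x = "w \<ominus>\<^bsub>M\<^esub> (e \<otimes>\<^bsub>R\<^esub> inv\<^bsub>R\<^esub> c) \<odot>\<^bsub>M\<^esub> w0"
        have q: "?q \<in> carrier R" using we c by simp
        have xW: "?x \<in> W'" using submod_minus[OF sW' we(2)] vc(2) q sW' by (simp add: submod_def)
        have ux: "u = ?x \<oplus>\<^bsub>M\<^esub> ?q \<odot>\<^bsub>M\<^esub> v" using eq[OF we(2,3)] we(1) by simp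
        have "?x = u \<ominus>\<^bsub>M\<^esub> ?q \<odot>\<^bsub>M\<^esub> v"
          unfolding ux using W'M[OF xW] q vM by (simp add: a_minus_def M.a_assoc M.r_neg)
        moreover have "u \<ominus>\<^bsub>M\<^esub> ?q \<odot>\<^bsub>M\<^esub> v \<in> U"
          using submod_minus[OF Suc.prems(2) u] v q Suc.prems(2) by (simp add: submod_def)
        ultimately have "?x \<in> ?U'" using xW by simp
        then show "u \<in> adjoin R M ?U' v" using ux q unfolding adjoin_def by blast
      qed
    qed
    \<comment> \<open>Otherwise \<open>U\<close> would contain \<open>W'\<close>, and by the
      exchange formula also \<open>b\<close>, hence all of \<open>W\<close>.\<close>
    have "?U' \<noteq> W'"
    proof
      assume "?U' = W'"
      then have "W' \<subseteq> U" by auto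
      have "b = \<zero>\<^bsub>M\<^esub> \<oplus>\<^bsub>M\<^esub> \<one>\<^bsub>R\<^esub> \<odot>\<^bsub>M\<^esub> b" using W'(2) by simp
      also have "\<dots> = (\<zero>\<^bsub>M\<^esub> \<ominus>\<^bsub>M\<^esub> (\<one>\<^bsub>R\<^esub> \<otimes>\<^bsub>R\<^esub> inv\<^bsub>R\<^esub> c) \<odot>\<^bsub>M\<^esub> w0) \<oplus>\<^bsub>M\<^esub> (\<one>\<^bsub>R\<^esub> \<otimes>\<^bsub>R\<^esub> inv\<^bsub>R\<^esub> c) \<odot>\<^bsub>M\<^esub> v"
        using sW' by (intro eq) (auto simp: submod_def)
      also have "\<dots> \<in> U"
        using Suc.prems(2) v(1) c vc(2) \<open>W' \<subseteq> U\<close> submod_minus[OF Suc.prems(2), of "\<zero>\<^bsub>M\<^esub>"]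
        by (auto simp: submod_def)
      finally have "W \<subseteq> U" using adjoin_least[OF Suc.prems(2) \<open>W' \<subseteq> U\<close>] W'(3) by simp
      then show False using Suc.prems(3) by auto
    qed
    then obtain m where m: "m < n" "dim_le R M m ?U'" using Suc.IH[OF W'(1) sU'] by blast
    then have "dim_le R M (Suc m) U" using U vM by auto
    then show ?thesis using m(1) by blast
  qed
qed

end

lemma image_adjoin:
  assumes f: "linear K V V' f" and V: "left_module K V" and U: "U \<subseteq> carrier V" "b \<in> carrier V"
  shows "f ` adjoin K V U b = adjoin K V' (f ` U) (f b)"
proof -
  interpret V: left_module K V by fact
  have eq: "f (u \<oplus>\<^bsub>V\<^esub> c \<odot>\<^bsub>V\<^esub> b) = f u \<oplus>\<^bsub>V'\<^esub> c \<odot>\<^bsub>V'\<^esub> f b" if "u \<in> U" "c \<in> carrier K" for u c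
    using that U linear_add[OF f, of u "c \<odot>\<^bsub>V\<^esub> b"] linear_smult[OF f] by auto
  show ?thesis
  proof (intro equalityI subsetI)
    fix y assume "y \<in> f ` adjoin K V U b"
    then obtain u c where "u \<in> U" "c \<in> carrier K" "y = f (u \<oplus>\<^bsub>V\<^esub> c \<odot>\<^bsub>V\<^esub> b)"
      unfolding adjoin_def by blast
    then show "y \<in> adjoin K V' (f ` U) (f b)" unfolding adjoin_def using eq by blast
  next
    fix y assume "y \<in> adjoin K V' (f ` U) (f b)"
    then obtain u c where "u \<in> U" "c \<in> carrier K" "y = f u \<oplus>\<^bsub>V'\<^esub> c \<odot>\<^bsub>V'\<^esub> f b"
      unfolding adjoin_def by blast
    then have "y = f (u \<oplus>\<^bsub>V\<^esub> c \<odot>\<^bsub>V\<^esub> b)" "u \<in> U" "c \<in> carrier K" using eq by auto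
    then show "y \<in> f ` adjoin K V U b" unfolding adjoin_def by blast
  qed
qed

lemma dim_le_image:
  assumes V: "left_module K V" "left_module K V'" and f: "linear K V V' f"
  shows "dim_le K V n W \<Longrightarrow> dim_le K V' n (f ` W)"
proof (induction n arbitrary: W)
  case 0
  then show ?case using linear_zero[OF V f] by simp
next
  case (Suc n)
  interpret V: left_module K V by fact
  obtain U b where U: "dim_le K V n U" "b \<in> carrier V" "W = adjoin K V U b" using Suc by auto
  have UV: "U \<subseteq> carrier V" using V.dim_le_submod[OF U(1)] by (simp add: submod_def)
  have "f ` W = adjoin K V' (f ` U) (f b)" unfolding U(3) by (rule image_adjoin[OF f V(1) UV U(2)])
  then show ?case using Suc.IH[OF U(1)] linear_closed[OF f U(2)] by auto
qed

lemma dim_le_image_kernel: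
  assumes V: "left_module K V" "left_module K V'" and f: "linear K V V' f" and K: "field K"
  shows "\<lbrakk>dim_le K V n W; w \<in> W; w \<noteq> \<zero>\<^bsub>V\<^esub>; f w = \<zero>\<^bsub>V'\<^esub>\<rbrakk> \<Longrightarrow> \<exists>m<n. dim_le K V' m (f ` W)"
proof (induction n arbitrary: W)
  case (Suc n)
  interpret K: field K by fact
  interpret V: left_module K V by fact
  interpret V': left_module K V' by fact
  obtain U b where U: "dim_le K V n U" "b \<in> carrier V" "W = adjoin K V U b" using Suc by auto
  have sU: "submod K V U" by (rule V.dim_le_submod[OF U(1)])
  have UV: "U \<subseteq> carrier V" using sU by (simp add: submod_def)
  have sfU: "submod K V' (f ` U)" by (rule submod_image[OF V f sU])
  have eq: "f (u \<oplus>\<^bsub>V\<^esub> c \<odot>\<^bsub>V\<^esub> b) = f u \<oplus>\<^bsub>V'\<^esub> c \<odot>\<^bsub>V'\<^esub> f b" if "u \<in> U" "c \<in> carrier K" for u c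
    using that UV U(2) linear_add[OF f, of u "c \<odot>\<^bsub>V\<^esub> b"] linear_smult[OF f] by auto
  have img: "f ` W = adjoin K V' (f ` U) (f b)" unfolding U(3) by (rule image_adjoin[OF f V(1) UV U(2)])
  show ?case
  proof (cases "w \<in> U")
    case True
    then obtain m where m: "m < n" "dim_le K V' m (f ` U)"
      using Suc.IH[OF U(1) _ Suc.prems(3,4)] by blast
    then have "dim_le K V' (Suc m) (f ` W)" using img linear_closed[OF f U(2)] by auto
    then show ?thesis using m(1) by blast
  next
    case False
    obtain u c where uc: "w = u \<oplus>\<^bsub>V\<^esub> c \<odot>\<^bsub>V\<^esub> b" "u \<in> U" "c \<in> carrier K"
      using Suc.prems(2) U(3) by (auto simp: adjoin_def)
    have "c \<noteq> \<zero>\<^bsub>K\<^esub>" using False uc UV U(2) by (auto simp: V.smult_zero_left)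
    then have c: "inv\<^bsub>K\<^esub> c \<in> carrier K" "inv\<^bsub>K\<^esub> c \<otimes>\<^bsub>K\<^esub> c = \<one>\<^bsub>K\<^esub>"
      using uc(3) by (simp_all add: K.field_Units)
    have fu: "f u \<in> carrier V'" "f b \<in> carrier V'" using linear_closed[OF f] uc UV U(2) by auto
    have "f u \<oplus>\<^bsub>V'\<^esub> c \<odot>\<^bsub>V'\<^esub> f b = \<zero>\<^bsub>V'\<^esub>" using eq[OF uc(2,3)] uc(1) Suc.prems(4) by simp
    then have "c \<odot>\<^bsub>V'\<^esub> f b = \<ominus>\<^bsub>V'\<^esub> f u"
      using fu uc(3) by (metis V'.M.a_comm V'.M.minus_equality V'.smult_closed)
    then have "c \<odot>\<^bsub>V'\<^esub> f b \<in> f ` U" using V'.submod_uminus[OF sfU] uc(2) by simp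
    then have "inv\<^bsub>K\<^esub> c \<odot>\<^bsub>V'\<^esub> (c \<odot>\<^bsub>V'\<^esub> f b) \<in> f ` U" by (rule submod_smult[OF sfU c(1)])
    then have "f b \<in> f ` U" using c uc(3) fu by (simp flip: V'.smult_assoc)
    then have "adjoin K V' (f ` U) (f b) = f ` U"
      using V'.adjoin_least[OF sfU order_refl] V'.adjoin_superset(1)[OF sfU fu(2)] by auto
    then show ?thesis using img dim_le_image[OF V f U(1)] by auto
  qed
qed simp

section \<open>Finite-dimensional algebras\<close>

definition restrict_scalars ::
    "('k, 'a, 'd) module_scheme \<Rightarrow> ('a, 'm, 'e) module_scheme \<Rightarrow> ('k, 'm) module"
  where "restrict_scalars A M =
    \<lparr>carrier = carrier M, mult = mult M, one = one M, zero = zero M, add = add M,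
     smult = (\<lambda>c x. (c \<odot>\<^bsub>A\<^esub> \<one>\<^bsub>A\<^esub>) \<odot>\<^bsub>M\<^esub> x)\<rparr>"

lemma restrict_scalars_simps [simp]:
  "carrier (restrict_scalars A M) = carrier M"
  "\<zero>\<^bsub>restrict_scalars A M\<^esub> = \<zero>\<^bsub>M\<^esub>"
  "x \<oplus>\<^bsub>restrict_scalars A M\<^esub> y = x \<oplus>\<^bsub>M\<^esub> y"
  "c \<odot>\<^bsub>restrict_scalars A M\<^esub> x = (c \<odot>\<^bsub>A\<^esub> \<one>\<^bsub>A\<^esub>) \<odot>\<^bsub>M\<^esub> x"
  "restrict_scalars A (subm M N) = subm (restrict_scalars A M) N"
  by (simp_all add: restrict_scalars_def)

text \<open>Collects what the arguments on torsion pairs and bricks require of the algebra: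
  submodules stay in the category, and a length drops on proper submodules and on proper quotients.
  For the algebra it is the dimension over the field.\<close>

locale length_ring = ring R for R :: "('a, 'c) ring_scheme" (structure) +
  fixes len :: "('a, 'a list) module \<Rightarrow> nat"
  assumes subm_mod_cat: "\<lbrakk>M \<in> mod_cat R; submod R M U\<rbrakk> \<Longrightarrow> subm M U \<in> mod_cat R"
    and len_subm: "\<lbrakk>M \<in> mod_cat R; submod R M U; U \<noteq> carrier M\<rbrakk> \<Longrightarrow> len (subm M U) < len M"
    and len_image: "\<lbrakk>M \<in> mod_cat R; N \<in> mod_cat R; linear R M N f; f ` carrier M = carrier N;
      \<not> inj_on f (carrier M)\<rbrakk> \<Longrightarrow> len N < len M"

context findim_algebra
begin

lemma scalar_closed: "c \<in> carrier K \<Longrightarrow> c \<odot>\<^bsub>A\<^esub> \<one>\<^bsub>A\<^esub> \<in> carrier A"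
  by simp

lemma restrict_scalars_left_module:
  assumes "left_module A M"
  shows "left_module K (restrict_scalars A M)"
proof -
  interpret M: left_module A M by fact
  show ?thesis
  proof (intro left_module.intro left_module_axioms.intro)
    show "ring K" by unfold_locales
    show "abelian_group (restrict_scalars A M)"
    proof (rule abelian_groupI)
      fix x assume "x \<in> carrier (restrict_scalars A M)"
      then show "\<exists>y\<in>carrier (restrict_scalars A M).
          y \<oplus>\<^bsub>restrict_scalars A M\<^esub> x = \<zero>\<^bsub>restrict_scalars A M\<^esub>"
        by (intro bexI[of _ "\<ominus>\<^bsub>M\<^esub> x"]) (auto simp: M.M.l_neg)
    qed (auto simp: M.M.a_ac)
  next
    fix a b x assume "a \<in> carrier K" "b \<in> carrier K" "x \<in> carrier (restrict_scalars A M)"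
    moreover have "(a \<otimes>\<^bsub>K\<^esub> b) \<odot>\<^bsub>A\<^esub> \<one>\<^bsub>A\<^esub> = (a \<odot>\<^bsub>A\<^esub> \<one>\<^bsub>A\<^esub>) \<otimes>\<^bsub>A\<^esub> (b \<odot>\<^bsub>A\<^esub> \<one>\<^bsub>A\<^esub>)"
      if "a \<in> carrier K" "b \<in> carrier K"
      using that by (simp add: smult_mult_left smult_assoc1)
    ultimately show "(a \<oplus>\<^bsub>K\<^esub> b) \<odot>\<^bsub>restrict_scalars A M\<^esub> x =
        a \<odot>\<^bsub>restrict_scalars A M\<^esub> x \<oplus>\<^bsub>restrict_scalars A M\<^esub> b \<odot>\<^bsub>restrict_scalars A M\<^esub> x"
      and "(a \<otimes>\<^bsub>K\<^esub> b) \<odot>\<^bsub>restrict_scalars A M\<^esub> x =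
        a \<odot>\<^bsub>restrict_scalars A M\<^esub> (b \<odot>\<^bsub>restrict_scalars A M\<^esub> x)"
      by (simp_all add: smult_l_distr M.smult_l_distr M.smult_assoc)
  qed (auto simp: M.smult_r_distr)
qed

lemma restrict_scalars_submod: "submod A M N \<Longrightarrow> submod K (restrict_scalars A M) N"
  using scalar_closed by (auto simp: submod_def)

lemma restrict_scalars_linear:
  "linear A M N f \<Longrightarrow> linear K (restrict_scalars A M) (restrict_scalars A N) f"
  using scalar_closed by (auto simp: linear_def)

lemma left_module_self: "left_module K A"
  by (intro left_module.intro left_module_axioms.intro)
     (unfold_locales, auto simp: smult_l_distr smult_r_distr smult_assoc1)

text \<open>Products of a spanning set \<open>B\<close> of the algebra with a generating set
  \<open>S\<close> of the module span it: for fixed \<open>s\<close>, the \<open>a\<close> with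
  \<open>a s\<close> in the span \<open>W\<close> form a subspace that contains
  \<open>B\<close>.\<close>

lemma finitely_generated_dim_le:
  assumes M: "left_module A M" and fg: "finitely_generated A M"
  shows "\<exists>n. dim_le K (restrict_scalars A M) n (carrier M)"
proof -
  interpret M: left_module A M by fact
  interpret V: left_module K "restrict_scalars A M" by (rule restrict_scalars_left_module[OF M])
  interpret S: left_module K A by (rule left_module_self)
  obtain S where S: "finite S" "S \<subseteq> carrier M"
    "\<And>x. x \<in> carrier M \<Longrightarrow> \<exists>c\<in>S \<rightarrow> carrier A. x = (\<Oplus>\<^bsub>M\<^esub>s\<in>S. c s \<odot>\<^bsub>M\<^esub> s)"
    using fg unfolding finitely_generated_def by blast
  obtain B where B: "finite B" "B \<subseteq> carrier A" "\<forall>W. submod K A W \<and> B \<subseteq> W \<longrightarrow> W = carrier A"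
    using finite_dimensional unfolding S.finitely_generated_iff by (elim exE conjE) (rule that)
  let ?G = "(\<lambda>(b, s). b \<odot>\<^bsub>M\<^esub> s) ` (B \<times> S)"
  have "finite ?G" "?G \<subseteq> carrier (restrict_scalars A M)" using S(1,2) B(1,2) by auto
  then obtain n W where W: "dim_le K (restrict_scalars A M) n W" "?G \<subseteq> W"
    using V.dim_le_cover[of ?G] by blast
  have sW: "submod K (restrict_scalars A M) W" by (rule V.dim_le_submod[OF W(1)])
  have aW: "a \<odot>\<^bsub>M\<^esub> s \<in> W" if a: "a \<in> carrier A" and s: "s \<in> S" for a s
  proof -
    have sM: "s \<in> carrier M" using s S(2) by auto
    let ?I = "{a \<in> carrier A. a \<odot>\<^bsub>M\<^esub> s \<in> W}"
    have "submod K A ?I"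
      unfolding submod_def
    proof (intro conjI ballI)
      show "\<zero>\<^bsub>A\<^esub> \<in> ?I" using sW sM by (simp add: submod_def M.smult_zero_left)
      fix x y assume "x \<in> ?I" "y \<in> ?I"
      then show "x \<oplus>\<^bsub>A\<^esub> y \<in> ?I" using submod_add[OF sW] sM by (simp add: M.smult_l_distr)
    next
      fix c x assume c: "c \<in> carrier K" and x: "x \<in> ?I"
      have "c \<odot>\<^bsub>A\<^esub> x = (c \<odot>\<^bsub>A\<^esub> \<one>\<^bsub>A\<^esub>) \<otimes>\<^bsub>A\<^esub> x" using c x by (simp add: smult_mult_left)
      then have "(c \<odot>\<^bsub>A\<^esub> x) \<odot>\<^bsub>M\<^esub> s = (c \<odot>\<^bsub>A\<^esub> \<one>\<^bsub>A\<^esub>) \<odot>\<^bsub>M\<^esub> (x \<odot>\<^bsub>M\<^esub> s)"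
        using c x sM by (simp add: M.smult_assoc)
      then show "c \<odot>\<^bsub>A\<^esub> x \<in> ?I" using submod_smult[OF sW c, of "x \<odot>\<^bsub>M\<^esub> s"] c x by simp
    qed auto
    moreover have "B \<subseteq> ?I" using B(2) W(2) s by auto
    ultimately have "?I = carrier A" using B(3) by blast
    then show ?thesis using a by blast
  qed
  have "x \<in> W" if x: "x \<in> carrier M" for x
  proof -
    obtain c where c: "c \<in> S \<rightarrow> carrier A" "x = (\<Oplus>\<^bsub>M\<^esub>s\<in>S. c s \<odot>\<^bsub>M\<^esub> s)" using S(3)[OF x] by blast
    have "(\<Oplus>\<^bsub>M\<^esub>s\<in>T. c s \<odot>\<^bsub>M\<^esub> s) \<in> W" if "finite T" "T \<subseteq> S" for T
      using that
    proof (induction T rule: finite_induct)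
      case empty
      then show ?case using sW by (simp add: submod_def)
    next
      case (insert s T)
      have "(\<lambda>s. c s \<odot>\<^bsub>M\<^esub> s) \<in> T \<rightarrow> carrier M" "c s \<odot>\<^bsub>M\<^esub> s \<in> carrier M"
        using insert c(1) S(2) by auto
      moreover have "c s \<odot>\<^bsub>M\<^esub> s \<in> W" using aW insert c(1) by auto
      ultimately show ?case using insert submod_add[OF sW] by simp
    qed
    then show ?thesis using c(2) S(1) by simp
  qed
  then have "W = carrier M" using sW by (auto simp: submod_def)
  then show ?thesis using W(1) by blast
qed

definition dim :: "('a, 'm) module \<Rightarrow> nat"
  where "dim M = (LEAST n. dim_le K (restrict_scalars A M) n (carrier M))"

lemma dim_le_dim:
  "left_module A M \<Longrightarrow> finitely_generated A M \<Longrightarrow> dim_le K (restrict_scalars A M) (dim M) (carrier M)"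
  unfolding dim_def using finitely_generated_dim_le by (rule LeastI_ex)

theorem length_ring_dim: "length_ring A dim"
proof (intro length_ring.intro length_ring_axioms.intro)
  show "ring A" by unfold_locales
next
  fix M :: "('a, 'a list) module" and N
  assume "M \<in> mod_cat A" and N: "submod A M N"
  then have M: "left_module A M" "finitely_generated A M" by (auto simp: mod_cat_def)
  interpret M: left_module A M by fact
  interpret V: left_module K "restrict_scalars A M" by (rule restrict_scalars_left_module[OF M(1)])
  interpret N: left_module A "subm M N" by (rule M.subm_left_module[OF N])
  have fld: "field K" by unfold_locales
  have sN: "submod K (restrict_scalars A M) N" by (rule restrict_scalars_submod[OF N])
  have proper: "\<exists>m<dim M. dim_le K (restrict_scalars A M) m N" if "N \<noteq> carrier M"
    using V.dim_le_proper_subspace[OF fld dim_le_dim[OF M] sN] that N by (auto simp: submod_def)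
  obtain k where k: "dim_le K (restrict_scalars A M) k N"
    using proper dim_le_dim[OF M] by (cases "N = carrier M") auto
  \<comment> \<open>Vectors spanning \<open>N\<close> over the field also generate it over the
    algebra, because every submodule over the algebra is a subspace.\<close>
  obtain S where S: "finite S" "S \<subseteq> N" "\<forall>U. submod K (restrict_scalars A M) U \<and> S \<subseteq> U \<longrightarrow> N \<subseteq> U"
    using V.dim_le_generators[OF k] by (elim exE conjE) (rule that)
  have "U = N" if "submod A (subm M N) U" "S \<subseteq> U" for U
    using that S(3) submod_of_subm[OF N] restrict_scalars_submod by (intro equalityI) blast+
  then have "finitely_generated A (subm M N)"
    unfolding N.finitely_generated_iff using S(1,2) by (intro exI[of _ S]) simp
  then show "subm M N \<in> mod_cat A" using N.left_module_axioms by (simp add: mod_cat_def)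
  assume "N \<noteq> carrier M"
  then obtain m where m: "m < dim M" "dim_le K (restrict_scalars A M) m N" using proper by blast
  have "dim_le K (restrict_scalars A (subm M N)) m (carrier (subm M N))"
    using V.dim_le_subm[OF m(2) sN] by simp
  then have "dim (subm M N) \<le> m" unfolding dim_def by (rule Least_le)
  then show "dim (subm M N) < dim M" using m(1) by simp
next
  fix M N :: "('a, 'a list) module" and f
  assume "M \<in> mod_cat A" "N \<in> mod_cat A" and f: "linear A M N f" "f ` carrier M = carrier N"
    and "\<not> inj_on f (carrier M)"
  then have M: "left_module A M" "finitely_generated A M" and N: "left_module A N"
    by (auto simp: mod_cat_def)
  obtain w where w: "w \<in> carrier M" "w \<noteq> \<zero>\<^bsub>M\<^esub>" "f w = \<zero>\<^bsub>N\<^esub>"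
    using \<open>\<not> inj_on f (carrier M)\<close> linear_inj_on_iff[OF M(1) N f(1)] by blast
  have fld: "field K" by unfold_locales
  obtain m where m: "m < dim M" "dim_le K (restrict_scalars A N) m (carrier N)"
    using dim_le_image_kernel[OF restrict_scalars_left_module[OF M(1)]
        restrict_scalars_left_module[OF N] restrict_scalars_linear[OF f(1)] fld dim_le_dim[OF M]] w f(2)
    by auto
  have "dim N \<le> m" unfolding dim_def using m(2) by (rule Least_le)
  then show "dim N < dim M" using m(1) by simp
qed

end

section \<open>Bricks and torsion pairs\<close>

lemma mod_hom_restrict: "linear R M N f \<Longrightarrow> restrict f (carrier M) \<in> mod_hom R M N"
  if "left_module R M"
proof -
  interpret M: left_module R M by fact
  show "linear R M N f \<Longrightarrow> restrict f (carrier M) \<in> mod_hom R M N"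
    by (auto simp: mod_hom_def linear_def)
qed

lemma mod_hom_linear: "f \<in> mod_hom R M N \<Longrightarrow> linear R M N f"
  by (auto simp: mod_hom_def linear_def)

definition nonzero :: "('r, 'm, 'd) module_scheme \<Rightarrow> bool"
  where "nonzero M \<longleftrightarrow> (\<exists>x\<in>carrier M. x \<noteq> \<zero>\<^bsub>M\<^esub>)"

definition hom_nonzero ::
    "('r, 'c) ring_scheme \<Rightarrow> ('r, 'm, 'd) module_scheme \<Rightarrow> ('r, 'n, 'e) module_scheme \<Rightarrow> bool"
  where "hom_nonzero R M N \<longleftrightarrow> (\<exists>f. linear R M N f \<and> (\<exists>x\<in>carrier M. f x \<noteq> \<zero>\<^bsub>N\<^esub>))"

lemma hom_nonzero_iff:
  assumes "left_module R M" "left_module R N"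
  shows "hom_nonzero R M N \<longleftrightarrow> mod_hom R M N \<noteq> {zero_hom M N}"
proof -
  interpret M: left_module R M by fact
  interpret N: left_module R N by fact
  have z: "zero_hom M N \<in> mod_hom R M N"
    by (auto simp: zero_hom_def mod_hom_def N.smult_zero_right)
  show ?thesis
  proof
    assume "hom_nonzero R M N"
    then obtain f x where f: "linear R M N f" "x \<in> carrier M" "f x \<noteq> \<zero>\<^bsub>N\<^esub>" by (auto simp: hom_nonzero_def)
    then have "restrict f (carrier M) \<noteq> zero_hom M N" by (auto simp: zero_hom_def fun_eq_iff)
    then show "mod_hom R M N \<noteq> {zero_hom M N}" using mod_hom_restrict[OF assms(1) f(1)] by auto
  next
    assume "mod_hom R M N \<noteq> {zero_hom M N}"
    then obtain f where f: "f \<in> mod_hom R M N" "f \<noteq> zero_hom M N" using z by blast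
    then have "\<exists>x\<in>carrier M. f x \<noteq> \<zero>\<^bsub>N\<^esub>"
      by (fastforce simp: mod_hom_def zero_hom_def PiE_def extensional_def)
    then show "hom_nonzero R M N" using mod_hom_linear[OF f(1)] by (auto simp: hom_nonzero_def)
  qed
qed

text \<open>\<open>division_ring\<close> includes the ring axioms, so showing that a given module is
  a brick requires this as well.\<close>

lemma End_ring_ring:
  assumes "left_module R M" shows "ring (End_ring R M)"
proof -
  interpret M: left_module R M by fact
  have ext: "f = g" if "f \<in> mod_hom R M M" "g \<in> mod_hom R M M" "\<And>x. x \<in> carrier M \<Longrightarrow> f x = g x" for f g
    using that by (auto simp: mod_hom_def intro: PiE_ext)
  have cl: "f x \<in> carrier M" if "f \<in> mod_hom R M M" "x \<in> carrier M" for f x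
    using that by (auto simp: mod_hom_def)
  have add: "(\<lambda>x\<in>carrier M. f x \<oplus>\<^bsub>M\<^esub> g x) \<in> mod_hom R M M"
    if f: "f \<in> mod_hom R M M" and g: "g \<in> mod_hom R M M" for f g
  proof (intro mod_hom_restrict[OF assms], unfold linear_def, intro conjI ballI)
    show "(\<lambda>x. f x \<oplus>\<^bsub>M\<^esub> g x) \<in> carrier M \<rightarrow> carrier M" using cl f g by simp
    fix x y assume xy: "x \<in> carrier M" "y \<in> carrier M"
    have "f (x \<oplus>\<^bsub>M\<^esub> y) = f x \<oplus>\<^bsub>M\<^esub> f y" "g (x \<oplus>\<^bsub>M\<^esub> y) = g x \<oplus>\<^bsub>M\<^esub> g y"
      using f g xy by (simp_all add: mod_hom_def)
    then show "f (x \<oplus>\<^bsub>M\<^esub> y) \<oplus>\<^bsub>M\<^esub> g (x \<oplus>\<^bsub>M\<^esub> y) = f x \<oplus>\<^bsub>M\<^esub> g x \<oplus>\<^bsub>M\<^esub> (f y \<oplus>\<^bsub>M\<^esub> g y)"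
      using cl f g xy by (simp add: M.M.a_ac)
  next
    fix a x assume ax: "a \<in> carrier R" "x \<in> carrier M"
    have "f (a \<odot>\<^bsub>M\<^esub> x) = a \<odot>\<^bsub>M\<^esub> f x" "g (a \<odot>\<^bsub>M\<^esub> x) = a \<odot>\<^bsub>M\<^esub> g x"
      using f g ax by (simp_all add: mod_hom_def)
    then show "f (a \<odot>\<^bsub>M\<^esub> x) \<oplus>\<^bsub>M\<^esub> g (a \<odot>\<^bsub>M\<^esub> x) = a \<odot>\<^bsub>M\<^esub> (f x \<oplus>\<^bsub>M\<^esub> g x)"
      using cl f g ax by (simp add: M.smult_r_distr)
  qed
  have neg: "(\<lambda>x\<in>carrier M. \<ominus>\<^bsub>M\<^esub> f x) \<in> mod_hom R M M" if f: "f \<in> mod_hom R M M" for f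
  proof (intro mod_hom_restrict[OF assms], unfold linear_def, intro conjI ballI)
    show "(\<lambda>x. \<ominus>\<^bsub>M\<^esub> f x) \<in> carrier M \<rightarrow> carrier M" using cl f by simp
    fix x y assume xy: "x \<in> carrier M" "y \<in> carrier M"
    have "f (x \<oplus>\<^bsub>M\<^esub> y) = f x \<oplus>\<^bsub>M\<^esub> f y" using f xy by (simp add: mod_hom_def)
    then show "\<ominus>\<^bsub>M\<^esub> f (x \<oplus>\<^bsub>M\<^esub> y) = \<ominus>\<^bsub>M\<^esub> f x \<oplus>\<^bsub>M\<^esub> \<ominus>\<^bsub>M\<^esub> f y"
      using cl f xy by (simp add: M.M.minus_add)
  next
    fix a x assume ax: "a \<in> carrier R" "x \<in> carrier M"
    have "f (a \<odot>\<^bsub>M\<^esub> x) = a \<odot>\<^bsub>M\<^esub> f x" using f ax by (simp add: mod_hom_def)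
    then show "\<ominus>\<^bsub>M\<^esub> f (a \<odot>\<^bsub>M\<^esub> x) = a \<odot>\<^bsub>M\<^esub> (\<ominus>\<^bsub>M\<^esub> f x)"
      using cl f ax by (simp add: M.smult_minus_right)
  qed
  have zero: "zero_hom M M \<in> mod_hom R M M"
    by (auto simp: zero_hom_def mod_hom_def M.smult_zero_right)
  have one: "(\<lambda>x\<in>carrier M. x) \<in> mod_hom R M M" by (auto simp: mod_hom_def)
  have comp: "compose (carrier M) f g \<in> mod_hom R M M" if "f \<in> mod_hom R M M" "g \<in> mod_hom R M M" for f g
    unfolding compose_def
    by (rule mod_hom_restrict[OF assms linear_compose[OF mod_hom_linear[OF that(2)] mod_hom_linear[OF that(1)]]])
  have ag: "abelian_group (End_ring R M)"
  proof (rule abelian_groupI)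
    fix f assume "f \<in> carrier (End_ring R M)"
    then have f: "f \<in> mod_hom R M M" by (simp add: End_ring_def)
    show "\<exists>g\<in>carrier (End_ring R M). g \<oplus>\<^bsub>End_ring R M\<^esub> f = \<zero>\<^bsub>End_ring R M\<^esub>"
      using neg[OF f] cl[OF f]
      by (intro bexI[of _ "\<lambda>x\<in>carrier M. \<ominus>\<^bsub>M\<^esub> f x"])
         (simp_all add: End_ring_def zero_hom_def M.M.l_neg cong: restrict_cong)
    show "\<zero>\<^bsub>End_ring R M\<^esub> \<oplus>\<^bsub>End_ring R M\<^esub> f = f"
    proof (rule ext[OF _ f])
      show "\<zero>\<^bsub>End_ring R M\<^esub> \<oplus>\<^bsub>End_ring R M\<^esub> f \<in> mod_hom R M M"
        using add[OF zero f] by (simp add: End_ring_def)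
    qed (simp add: End_ring_def zero_hom_def cl[OF f])
  next
    fix f g h assume "f \<in> carrier (End_ring R M)" "g \<in> carrier (End_ring R M)" "h \<in> carrier (End_ring R M)"
    then have fgh: "f \<in> mod_hom R M M" "g \<in> mod_hom R M M" "h \<in> mod_hom R M M" by (simp_all add: End_ring_def)
    show "f \<oplus>\<^bsub>End_ring R M\<^esub> g \<oplus>\<^bsub>End_ring R M\<^esub> h = f \<oplus>\<^bsub>End_ring R M\<^esub> (g \<oplus>\<^bsub>End_ring R M\<^esub> h)"
      using fgh cl by (simp add: End_ring_def M.M.a_assoc cong: restrict_cong)
  next
    fix f g assume "f \<in> carrier (End_ring R M)" "g \<in> carrier (End_ring R M)"
    then have fg: "f \<in> mod_hom R M M" "g \<in> mod_hom R M M" by (simp_all add: End_ring_def)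
    show "f \<oplus>\<^bsub>End_ring R M\<^esub> g \<in> carrier (End_ring R M)" using add fg by (simp add: End_ring_def)
    show "f \<oplus>\<^bsub>End_ring R M\<^esub> g = g \<oplus>\<^bsub>End_ring R M\<^esub> f"
      using fg cl by (simp add: End_ring_def M.M.a_comm cong: restrict_cong)
  qed (simp add: End_ring_def zero)
  show ?thesis
  proof (intro ringI ag monoidI)
    fix f g h assume "f \<in> carrier (End_ring R M)" "g \<in> carrier (End_ring R M)" "h \<in> carrier (End_ring R M)"
    then have fgh: "f \<in> mod_hom R M M" "g \<in> mod_hom R M M" "h \<in> mod_hom R M M" by (simp_all add: End_ring_def)
    show "f \<otimes>\<^bsub>End_ring R M\<^esub> g \<otimes>\<^bsub>End_ring R M\<^esub> h = f \<otimes>\<^bsub>End_ring R M\<^esub> (g \<otimes>\<^bsub>End_ring R M\<^esub> h)"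
      using fgh cl by (simp add: End_ring_def compose_def cong: restrict_cong)
    show "(f \<oplus>\<^bsub>End_ring R M\<^esub> g) \<otimes>\<^bsub>End_ring R M\<^esub> h =
        f \<otimes>\<^bsub>End_ring R M\<^esub> h \<oplus>\<^bsub>End_ring R M\<^esub> g \<otimes>\<^bsub>End_ring R M\<^esub> h"
      using fgh cl by (simp add: End_ring_def compose_def cong: restrict_cong)
    show "h \<otimes>\<^bsub>End_ring R M\<^esub> (f \<oplus>\<^bsub>End_ring R M\<^esub> g) =
        h \<otimes>\<^bsub>End_ring R M\<^esub> f \<oplus>\<^bsub>End_ring R M\<^esub> h \<otimes>\<^bsub>End_ring R M\<^esub> g"
      using fgh cl linear_add[OF mod_hom_linear[OF fgh(3)]]
      by (simp add: End_ring_def compose_def cong: restrict_cong)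
  next
    fix f g assume "f \<in> carrier (End_ring R M)" "g \<in> carrier (End_ring R M)"
    then show "f \<otimes>\<^bsub>End_ring R M\<^esub> g \<in> carrier (End_ring R M)" using comp by (simp add: End_ring_def)
  next
    fix f assume "f \<in> carrier (End_ring R M)"
    then have f: "f \<in> mod_hom R M M" by (simp add: End_ring_def)
    show "\<one>\<^bsub>End_ring R M\<^esub> \<otimes>\<^bsub>End_ring R M\<^esub> f = f"
    proof (rule ext[OF _ f])
      show "\<one>\<^bsub>End_ring R M\<^esub> \<otimes>\<^bsub>End_ring R M\<^esub> f \<in> mod_hom R M M"
        using comp[OF one f] by (simp add: End_ring_def)
    qed (simp add: End_ring_def compose_def cl[OF f])
    show "f \<otimes>\<^bsub>End_ring R M\<^esub> \<one>\<^bsub>End_ring R M\<^esub> = f"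
    proof (rule ext[OF _ f])
      show "f \<otimes>\<^bsub>End_ring R M\<^esub> \<one>\<^bsub>End_ring R M\<^esub> \<in> mod_hom R M M"
        using comp[OF f one] by (simp add: End_ring_def)
    qed (simp add: End_ring_def compose_def)
  qed (simp add: End_ring_def one)
qed

lemma linear_inverse:
  assumes "left_module R M" "linear R M N f" "bij_betw f (carrier M) (carrier N)"
  obtains g where "linear R N M g" "\<And>x. x \<in> carrier M \<Longrightarrow> g (f x) = x" "\<And>y. y \<in> carrier N \<Longrightarrow> f (g y) = y"
proof -
  interpret M: left_module R M by fact
  define g where "g = inv_into (carrier M) f"
  have gf: "g (f x) = x" if "x \<in> carrier M" for x
    using that assms(3) by (simp add: g_def bij_betw_def)
  have im: "f ` carrier M = carrier N" using assms(3) by (simp add: bij_betw_def)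
  have fg: "f (g y) = y" if "y \<in> carrier N" for y using that im by (simp add: g_def f_inv_into_f)
  have gM: "g y \<in> carrier M" if "y \<in> carrier N" for y using that im by (simp add: g_def inv_into_into)
  have "linear R N M g"
    unfolding linear_def
  proof (intro conjI ballI)
    show "g \<in> carrier N \<rightarrow> carrier M" using gM by auto
  next
    fix x y assume xy: "x \<in> carrier N" "y \<in> carrier N"
    have "f (g x \<oplus>\<^bsub>M\<^esub> g y) = x \<oplus>\<^bsub>N\<^esub> y" using linear_add[OF assms(2)] xy gM fg by simp
    then show "g (x \<oplus>\<^bsub>N\<^esub> y) = g x \<oplus>\<^bsub>M\<^esub> g y" using gf[of "g x \<oplus>\<^bsub>M\<^esub> g y"] xy gM by simp
  next
    fix a x assume ax: "a \<in> carrier R" "x \<in> carrier N"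
    have "f (a \<odot>\<^bsub>M\<^esub> g x) = a \<odot>\<^bsub>N\<^esub> x" using linear_smult[OF assms(2)] ax gM fg by simp
    then show "g (a \<odot>\<^bsub>N\<^esub> x) = a \<odot>\<^bsub>M\<^esub> g x" using gf[of "a \<odot>\<^bsub>M\<^esub> g x"] ax gM by simp
  qed
  then show ?thesis using that gf fg by blast
qed

text \<open>The inverse of a bijective linear map is linear, so the units are exactly the bijective
  endomorphisms; \<open>nonzero M\<close> is the condition that one differs from zero. Through
  \<open>brick_iff\<close>, bricks are afterwards handled without their endomorphism ring.\<close>

lemma division_ring_End_ring_iff:
  assumes M: "left_module R M"
  shows "division_ring (End_ring R M) \<longleftrightarrow> nonzero M \<and>
    (\<forall>f. linear R M M f \<and> (\<exists>x\<in>carrier M. f x \<noteq> \<zero>\<^bsub>M\<^esub>) \<longrightarrow> bij_betw f (carrier M) (carrier M))"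
proof -
  interpret M: left_module R M by fact
  interpret E: ring "End_ring R M" by (rule End_ring_ring[OF M])
  have sel: "carrier (End_ring R M) = mod_hom R M M" "\<one>\<^bsub>End_ring R M\<^esub> = (\<lambda>x\<in>carrier M. x)"
    "\<zero>\<^bsub>End_ring R M\<^esub> = zero_hom M M" "\<And>f g. f \<otimes>\<^bsub>End_ring R M\<^esub> g = compose (carrier M) f g"
    by (simp_all add: End_ring_def)
  have one: "\<one>\<^bsub>End_ring R M\<^esub> \<noteq> \<zero>\<^bsub>End_ring R M\<^esub> \<longleftrightarrow> nonzero M"
    by (auto simp: sel zero_hom_def nonzero_def fun_eq_iff)
  have unit: "f \<in> Units (End_ring R M) \<longleftrightarrow> bij_betw f (carrier M) (carrier M)"
    if f: "f \<in> mod_hom R M M" for f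
  proof
    assume "f \<in> Units (End_ring R M)"
    then obtain g where g: "g \<in> mod_hom R M M" "compose (carrier M) g f = (\<lambda>x\<in>carrier M. x)"
      "compose (carrier M) f g = (\<lambda>x\<in>carrier M. x)"
      by (auto simp: Units_def sel)
    have gf: "g (f x) = x" "f (g x) = x" if "x \<in> carrier M" for x
      using that fun_cong[OF g(2), of x] fun_cong[OF g(3), of x] by (auto simp: compose_def)
    show "bij_betw f (carrier M) (carrier M)"
      by (rule bij_betwI[where g = g]) (use f g(1) gf in \<open>auto simp: mod_hom_def\<close>)
  next
    assume "bij_betw f (carrier M) (carrier M)"
    then obtain g where g: "linear R M M g" "\<And>x. x \<in> carrier M \<Longrightarrow> g (f x) = x"
      "\<And>y. y \<in> carrier M \<Longrightarrow> f (g y) = y"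
      using linear_inverse[OF M mod_hom_linear[OF f]] by blast
    have "compose (carrier M) (restrict g (carrier M)) f = (\<lambda>x\<in>carrier M. x)"
      "compose (carrier M) f (restrict g (carrier M)) = (\<lambda>x\<in>carrier M. x)"
      using g linear_closed[OF mod_hom_linear[OF f]] linear_closed[OF g(1)]
      by (simp_all add: compose_def cong: restrict_cong)
    then show "f \<in> Units (End_ring R M)"
      using f mod_hom_restrict[OF M g(1)] unfolding Units_def sel by blast
  qed
  have zero: "f = zero_hom M M \<longleftrightarrow> (\<forall>x\<in>carrier M. f x = \<zero>\<^bsub>M\<^esub>)" if "f \<in> mod_hom R M M" for f
    using that by (auto simp: mod_hom_def zero_hom_def PiE_def extensional_def fun_eq_iff)
  show ?thesis
  proof
    assume "division_ring (End_ring R M)"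
    then interpret D: division_ring "End_ring R M" .
    show "nonzero M \<and>
        (\<forall>f. linear R M M f \<and> (\<exists>x\<in>carrier M. f x \<noteq> \<zero>\<^bsub>M\<^esub>) \<longrightarrow> bij_betw f (carrier M) (carrier M))"
    proof (intro conjI allI impI)
      show "nonzero M" using D.one_neq_zero one by simp
      fix f assume f: "linear R M M f \<and> (\<exists>x\<in>carrier M. f x \<noteq> \<zero>\<^bsub>M\<^esub>)"
      let ?f = "restrict f (carrier M)"
      have h: "?f \<in> mod_hom R M M" using f mod_hom_restrict[OF M] by blast
      then have "?f \<noteq> zero_hom M M" using zero f by auto
      then have "?f \<in> Units (End_ring R M)" using D.division_Units h by (simp add: sel)
      then have "bij_betw ?f (carrier M) (carrier M)" using unit[OF h] by simp
      then show "bij_betw f (carrier M) (carrier M)" using bij_betw_cong[of "carrier M" ?f f] by simp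
    qed
  next
    assume *: "nonzero M \<and>
        (\<forall>f. linear R M M f \<and> (\<exists>x\<in>carrier M. f x \<noteq> \<zero>\<^bsub>M\<^esub>) \<longrightarrow> bij_betw f (carrier M) (carrier M))"
    have "Units (End_ring R M) = carrier (End_ring R M) - {\<zero>\<^bsub>End_ring R M\<^esub>}"
    proof (intro equalityI subsetI)
      fix f assume u: "f \<in> Units (End_ring R M)"
      then have f: "f \<in> mod_hom R M M" using E.Units_closed sel(1) by blast
      have "bij_betw f (carrier M) (carrier M)" using u unit[OF f] by simp
      then have inj: "inj_on f (carrier M)" by (simp add: bij_betw_def)
      have "f \<noteq> zero_hom M M"
      proof
        assume "f = zero_hom M M"
        then have "\<forall>x\<in>carrier M. f x = f \<zero>\<^bsub>M\<^esub>" by (simp add: zero_hom_def)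
        then have "\<forall>x\<in>carrier M. x = \<zero>\<^bsub>M\<^esub>" using inj by (meson M.M.zero_closed inj_onD)
        then show False using * by (auto simp: nonzero_def)
      qed
      then show "f \<in> carrier (End_ring R M) - {\<zero>\<^bsub>End_ring R M\<^esub>}" using f by (simp add: sel)
    next
      fix f assume "f \<in> carrier (End_ring R M) - {\<zero>\<^bsub>End_ring R M\<^esub>}"
      then have f: "f \<in> mod_hom R M M" "f \<noteq> zero_hom M M" by (auto simp: sel)
      then have "bij_betw f (carrier M) (carrier M)" using * mod_hom_linear[OF f(1)] zero[OF f(1)] by blast
      then show "f \<in> Units (End_ring R M)" using unit[OF f(1)] by simp
    qed
    then show "division_ring (End_ring R M)"
      using * one by (intro division_ring.intro division_ring_axioms.intro E.ring_axioms) auto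
  qed
qed

lemma brick_iff:
  "brick R X \<longleftrightarrow> X \<in> mod_cat R \<and> nonzero X \<and>
    (\<forall>f. linear R X X f \<and> (\<exists>x\<in>carrier X. f x \<noteq> \<zero>\<^bsub>X\<^esub>) \<longrightarrow> bij_betw f (carrier X) (carrier X))"
  using division_ring_End_ring_iff[of R X] by (auto simp: brick_def mod_cat_def)

lemma mod_catD: "M \<in> mod_cat R \<Longrightarrow> left_module R M" "M \<in> mod_cat R \<Longrightarrow> finitely_generated R M"
  by (simp_all add: mod_cat_def)

lemma hom_nonzeroI: "linear R M N f \<Longrightarrow> x \<in> carrier M \<Longrightarrow> f x \<noteq> \<zero>\<^bsub>N\<^esub> \<Longrightarrow> hom_nonzero R M N"
  by (auto simp: hom_nonzero_def)

lemma hom_nonzeroE: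
  assumes "hom_nonzero R M N"
  obtains f x where "linear R M N f" "x \<in> carrier M" "f x \<noteq> \<zero>\<^bsub>N\<^esub>"
  using assms by (auto simp: hom_nonzero_def)

lemma hom_nonzero_refl: "nonzero M \<Longrightarrow> hom_nonzero R M M"
  unfolding nonzero_def hom_nonzero_def using linear_id by blast

lemma hom_nonzero_surj:
  assumes "linear R M N f" "f ` carrier M = carrier N" "hom_nonzero R N P"
  shows "hom_nonzero R M P"
proof -
  obtain g y where g: "linear R N P g" "y \<in> carrier N" "g y \<noteq> \<zero>\<^bsub>P\<^esub>" using assms(3) by (rule hom_nonzeroE)
  obtain x where "x \<in> carrier M" "f x = y" using assms(2) g(2) by (metis imageE)
  then show ?thesis using hom_nonzeroI[OF linear_compose[OF assms(1) g(1)], of x] g(3) by simp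
qed

lemma hom_nonzero_inj:
  assumes "left_module R N" "left_module R P"
    and "linear R N P f" "inj_on f (carrier N)" "hom_nonzero R M N"
  shows "hom_nonzero R M P"
proof -
  obtain g x where g: "linear R M N g" "x \<in> carrier M" "g x \<noteq> \<zero>\<^bsub>N\<^esub>" using assms(5) by (rule hom_nonzeroE)
  have "f (g x) \<noteq> \<zero>\<^bsub>P\<^esub>"
    using assms(4) linear_inj_on_iff[OF assms(1-3)] linear_closed[OF g(1,2)] g(3) by blast
  then show ?thesis using hom_nonzeroI[OF linear_compose[OF g(1) assms(3)] g(2)] by simp
qed

lemma torsion_class_surj:
  assumes T: "torsion_class R T" and "X \<in> T" "Y \<in> mod_cat R" "linear R X Y f" "f ` carrier X = carrier Y"
  shows "Y \<in> T"
proof (rule torsion_class_quotient[OF T assms(2,3)])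
  have "left_module R X" using T assms(2) torsion_class_subset mod_catD by blast
  then show "restrict f (carrier X) \<in> mod_hom R X Y" using assms(4) by (rule mod_hom_restrict)
  show "restrict f (carrier X) ` carrier X = carrier Y" using assms(5) by auto
qed

definition left_perp ::
    "('a, 'c) ring_scheme \<Rightarrow> ('a, 'a list) module set \<Rightarrow> ('a, 'a list) module set"
  where "left_perp R S = {X \<in> mod_cat R. \<forall>Y\<in>S. \<not> hom_nonzero R X Y}"

lemma right_perp_eq:
  assumes "T \<subseteq> mod_cat R"
  shows "right_perp R T = {Y \<in> mod_cat R. \<forall>X\<in>T. \<not> hom_nonzero R X Y}"
  using assms hom_nonzero_iff[of R] mod_catD(1)[of _ R] unfolding right_perp_def by blast

text \<open>Closure under extensions is left exactness of Hom into \<open>W\<close>: a map from the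
  middle term that vanishes on the image of \<open>X\<close> factors through
  \<open>Z\<close>.\<close>

lemma left_perp_torsion_class:
  assumes R: "ring R" and S: "S \<subseteq> mod_cat R"
  shows "torsion_class R (left_perp R S)"
proof (rule torsion_classI)
  show "left_perp R S \<subseteq> mod_cat R" by (auto simp: left_perp_def)
  have "\<not> hom_nonzero R zero_module Y" if Y: "Y \<in> S" for Y
  proof
    have m: "left_module R zero_module" "left_module R Y"
      using zero_module_mod_cat[OF R] Y S mod_catD by auto
    assume "hom_nonzero R zero_module Y"
    then obtain f x where f: "linear R zero_module Y f" "x \<in> carrier zero_module" "f x \<noteq> \<zero>\<^bsub>Y\<^esub>"
      by (rule hom_nonzeroE)
    have "x = \<zero>\<^bsub>zero_module\<^esub>" using f(2) by (simp add: zero_module_def)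
    then show False using linear_zero[OF m f(1)] f(3) by simp
  qed
  then show "left_perp R S \<noteq> {}" using zero_module_mod_cat[OF R] by (auto simp: left_perp_def)
next
  fix X Y f assume *: "X \<in> left_perp R S" "Y \<in> mod_cat R" "f \<in> mod_hom R X Y" "f ` carrier X = carrier Y"
  then show "Y \<in> left_perp R S"
    using hom_nonzero_surj[OF mod_hom_linear[OF *(3)] *(4)] by (auto simp: left_perp_def)
next
  fix X Y Z f g
  assume X: "X \<in> left_perp R S" and Y: "Y \<in> mod_cat R" and Z: "Z \<in> left_perp R S"
    and f: "f \<in> mod_hom R X Y" and g: "g \<in> mod_hom R Y Z" and "inj_on f (carrier X)"
    and ex: "f ` carrier X = {y \<in> carrier Y. g y = \<zero>\<^bsub>Z\<^esub>}" and surj: "g ` carrier Y = carrier Z"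
  have "\<not> hom_nonzero R Y W" if W: "W \<in> S" for W
  proof
    assume "hom_nonzero R Y W"
    then obtain h y where h: "linear R Y W h" "y \<in> carrier Y" "h y \<noteq> \<zero>\<^bsub>W\<^esub>" by (rule hom_nonzeroE)
    have m: "left_module R Y" "left_module R Z" "left_module R W"
      using Y Z W S mod_catD by (auto simp: left_perp_def)
    have "h x = \<zero>\<^bsub>W\<^esub>" if x: "x \<in> carrier Y" "g x = \<zero>\<^bsub>Z\<^esub>" for x
    proof (rule ccontr)
      assume "h x \<noteq> \<zero>\<^bsub>W\<^esub>"
      obtain u where "u \<in> carrier X" "x = f u" using x ex by blast
      then have "hom_nonzero R X W"
        using hom_nonzeroI[OF linear_compose[OF mod_hom_linear[OF f] h(1)]] \<open>h x \<noteq> \<zero>\<^bsub>W\<^esub>\<close> by simp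
      then show False using X W by (auto simp: left_perp_def)
    qed
    then obtain k where k: "linear R Z W k" "\<And>x. x \<in> carrier Y \<Longrightarrow> k (g x) = h x"
      using linear_factor[OF m mod_hom_linear[OF g] surj h(1)] by blast
    then have "hom_nonzero R Z W"
      using hom_nonzeroI[OF k(1) linear_closed[OF mod_hom_linear[OF g] h(2)]] h by simp
    then show False using Z W by (auto simp: left_perp_def)
  qed
  then show "Y \<in> left_perp R S" using Y by (auto simp: left_perp_def)
qed

section \<open>Torsion pairs and the existence of bricks\<close>

context length_ring
begin

lemma quotient_mod_cat:
  assumes M: "M \<in> mod_cat R" and N: "submod R M N"
  obtains Q p where "Q \<in> mod_cat R" "linear R M Q p" "p ` carrier M = carrier Q"
    "{x \<in> carrier M. p x = \<zero>\<^bsub>Q\<^esub>} = N"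
proof -
  obtain Q :: "('a, 'a list) module" and p where Q: "left_module R Q" "linear R M Q p"
    "p ` carrier M = carrier Q" "{x \<in> carrier M. p x = \<zero>\<^bsub>Q\<^esub>} = N"
    by (rule quotient_exists[OF mod_catD(1)[OF M] N])
  have "Q \<in> mod_cat R"
    using Q finitely_generated_image[OF mod_catD(1)[OF M] Q(1-3) mod_catD(2)[OF M]]
    by (simp add: mod_cat_def)
  then show ?thesis using that Q by blast
qed

lemma image_mod_cat:
  assumes "M \<in> mod_cat R" "N \<in> mod_cat R" "linear R M N f"
  shows "submod R N (f ` carrier M)" "subm N (f ` carrier M) \<in> mod_cat R"
    "linear R M (subm N (f ` carrier M)) f"
proof -
  interpret M: left_module R M by (rule mod_catD[OF assms(1)])
  show s: "submod R N (f ` carrier M)"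
    using submod_image[OF mod_catD(1)[OF assms(1)] mod_catD(1)[OF assms(2)] assms(3) M.submod_carrier] .
  show "subm N (f ` carrier M) \<in> mod_cat R" by (rule subm_mod_cat[OF assms(2) s])
  show "linear R M (subm N (f ` carrier M)) f" by (rule linear_restrict_codom[OF assms(3)]) simp
qed

lemma torsion_class_image:
  assumes T: "torsion_class R T" and X: "X \<in> T" and Y: "Y \<in> mod_cat R" and f: "linear R X Y f"
  shows "subm Y (f ` carrier X) \<in> T"
proof -
  have XM: "X \<in> mod_cat R" using T X torsion_class_subset by blast
  show ?thesis
    using torsion_class_surj[OF T X image_mod_cat(2,3)[OF XM Y f]] by simp
qed

lemma right_perp_inj:
  assumes T: "T \<subseteq> mod_cat R" and Y: "Y \<in> right_perp R T" and Z: "Z \<in> mod_cat R"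
    and f: "linear R Z Y f" "inj_on f (carrier Z)"
  shows "Z \<in> right_perp R T"
proof -
  have YM: "Y \<in> mod_cat R" using Y by (simp add: right_perp_def)
  show ?thesis
    using Y Z hom_nonzero_inj[OF mod_catD(1)[OF Z] mod_catD(1)[OF YM] f]
    by (auto simp: right_perp_eq[OF T])
qed

text \<open>A submodule in \<open>T\<close> of maximal length is the torsion submodule: a non-zero map from \<open>T\<close> to the
  quotient would lift its image to a larger submodule, which is in \<open>T\<close> as an extension.\<close>

lemma torsion_submodule:
  assumes T: "torsion_class R T" and M: "M \<in> mod_cat R"
  obtains N Q p where "submod R M N" "subm M N \<in> T" "Q \<in> right_perp R T" "linear R M Q p"
    "p ` carrier M = carrier Q" "{x \<in> carrier M. p x = \<zero>\<^bsub>Q\<^esub>} = N"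
proof -
  interpret M: left_module R M by (rule mod_catD[OF M])
  note TM = torsion_class_subset[OF T]
  have "submod R M {\<zero>\<^bsub>M\<^esub>} \<and> subm M {\<zero>\<^bsub>M\<^esub>} \<in> T"
  proof
    show s: "submod R M {\<zero>\<^bsub>M\<^esub>}" by (rule M.submod_zero)
    have "linear R zero_module (subm M {\<zero>\<^bsub>M\<^esub>}) (\<lambda>x. \<zero>\<^bsub>M\<^esub>)"
      by (auto simp: linear_def M.smult_zero_right)
    then show "subm M {\<zero>\<^bsub>M\<^esub>} \<in> T"
      using torsion_class_surj[OF T zero_module_torsion_class[OF ring_axioms T] subm_mod_cat[OF M s]]
      by (auto simp: zero_module_def)
  qed
  moreover have "\<forall>N. submod R M N \<and> subm M N \<in> T \<longrightarrow> len (subm M N) < Suc (len M)"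
  proof (intro allI impI)
    fix N assume N: "submod R M N \<and> subm M N \<in> T"
    then show "len (subm M N) < Suc (len M)"
      using len_subm[OF M, of N] by (cases "N = carrier M") auto
  qed
  ultimately obtain N where N: "submod R M N" "subm M N \<in> T"
    and max: "\<And>N'. \<lbrakk>submod R M N'; subm M N' \<in> T\<rbrakk> \<Longrightarrow> len (subm M N') \<le> len (subm M N)"
    using ex_has_greatest_nat[of "\<lambda>N. submod R M N \<and> subm M N \<in> T" "{\<zero>\<^bsub>M\<^esub>}" "\<lambda>N. len (subm M N)"]
    by blast
  obtain Q p where Q: "Q \<in> mod_cat R" "linear R M Q p" "p ` carrier M = carrier Q"
    "{x \<in> carrier M. p x = \<zero>\<^bsub>Q\<^esub>} = N" by (rule quotient_mod_cat[OF M N(1)])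
  interpret Q: left_module R Q by (rule mod_catD[OF Q(1)])
  have "\<not> hom_nonzero R Y Q" if Y: "Y \<in> T" for Y
  proof
    assume "hom_nonzero R Y Q"
    then obtain f y where f: "linear R Y Q f" "y \<in> carrier Y" "f y \<noteq> \<zero>\<^bsub>Q\<^esub>" by (rule hom_nonzeroE)
    have YM: "Y \<in> mod_cat R" using Y TM by blast
    note I = image_mod_cat[OF YM Q(1) f(1)]
    define P where "P = {x \<in> carrier M. p x \<in> f ` carrier Y}"
    have P: "submod R M P"
      unfolding P_def by (rule submod_vimage[OF mod_catD(1)[OF M] mod_catD(1)[OF Q(1)] Q(2) I(1)])
    have NP: "N \<subseteq> P"
      using Q(4) I(1) unfolding P_def by (auto simp: submod_def)
    have PM: "subm M P \<in> mod_cat R" by (rule subm_mod_cat[OF M P])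
    have lN: "left_module R (subm M N)" and lP: "left_module R (subm M P)"
      using M.subm_left_module N(1) P by blast+
    have "subm M P \<in> T"
    proof (rule torsion_class_extension[OF T N(2) PM torsion_class_image[OF T Y Q(1) f(1)]])
      show "restrict (\<lambda>x. x) N \<in> mod_hom R (subm M N) (subm M P)"
        using mod_hom_restrict[OF lN, of "subm M P" "\<lambda>x. x"] NP by (auto simp: linear_def)
      have "linear R (subm M P) Q p" using linear_restrict_dom[OF Q(2)] P by (simp add: submod_def)
      then have "linear R (subm M P) (subm Q (f ` carrier Y)) p"
        by (rule linear_restrict_codom) (auto simp: P_def)
      then show "restrict p P \<in> mod_hom R (subm M P) (subm Q (f ` carrier Y))"
        using mod_hom_restrict[OF lP] by force
      show "inj_on (restrict (\<lambda>x. x) N) (carrier (subm M N))" by (auto intro: inj_onI)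
      show "restrict (\<lambda>x. x) N ` carrier (subm M N) =
          {y \<in> carrier (subm M P). restrict p P y = \<zero>\<^bsub>subm Q (f ` carrier Y)\<^esub>}"
        using NP Q(4) unfolding P_def by auto
      have "f ` carrier Y \<subseteq> p ` carrier M" using I(1) Q(3) by (simp add: submod_def)
      have "p ` P = f ` carrier Y"
      proof (intro equalityI subsetI)
        fix z assume z: "z \<in> f ` carrier Y"
        then obtain x where "x \<in> carrier M" "z = p x" using \<open>f ` carrier Y \<subseteq> p ` carrier M\<close> by blast
        then show "z \<in> p ` P" using z by (auto simp: P_def)
      qed (auto simp: P_def)
      then show "restrict p P ` carrier (subm M P) = carrier (subm Q (f ` carrier Y))"
        by simp
    qed
    obtain x where x: "x \<in> carrier M" "p x = f y" using linear_closed[OF f(1,2)] Q(3) by (metis imageE)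
    then have "x \<in> P" "x \<notin> N" using f(2,3) Q(4) unfolding P_def by auto
    moreover have "submod R (subm M P) N" using N(1) NP submod_of_subm[OF P] by blast
    \<comment> \<open>Here \<open>subm (subm M P) N\<close> is the record \<open>subm M N\<close>,
      so this contradicts the maximality of \<open>N\<close>.\<close>
    ultimately have "len (subm (subm M P) N) < len (subm M P)" by (intro len_subm[OF PM]) auto
    then show False using max[OF P \<open>subm M P \<in> T\<close>] by simp
  qed
  then have "Q \<in> right_perp R T" using Q(1) by (simp add: right_perp_eq[OF TM])
  then show ?thesis using that N Q(2-4) by blast
qed

text \<open>Let \<open>Z\<close> be a shortest non-zero member. The image of a non-zero endomorphism
  is again a non-zero member, so it cannot be a proper submodule; and a surjection of
  \<open>Z\<close> onto itself with a kernel would lower the length of \<open>Z\<close>. The class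
  \<open>C\<close> is left open because it is chosen differently in each application.\<close>

lemma brick_exists:
  assumes C: "C \<subseteq> mod_cat R"
    and image: "\<And>Z f. \<lbrakk>Z \<in> C; linear R Z Z f\<rbrakk> \<Longrightarrow> subm Z (f ` carrier Z) \<in> C"
    and X: "X \<in> C" "nonzero X"
  obtains B where "B \<in> C" "brick R B"
proof -
  obtain Z where Z: "Z \<in> C" "nonzero Z" and min: "\<And>Y. \<lbrakk>Y \<in> C; nonzero Y\<rbrakk> \<Longrightarrow> len Z \<le> len Y"
    using X ex_has_least_nat[of "\<lambda>Z. Z \<in> C \<and> nonzero Z" X len] by blast
  have ZM: "Z \<in> mod_cat R" using Z(1) C by blast
  have "bij_betw f (carrier Z) (carrier Z)"
    if f: "linear R Z Z f" and x: "x \<in> carrier Z" "f x \<noteq> \<zero>\<^bsub>Z\<^esub>" for f x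
  proof -
    have "nonzero (subm Z (f ` carrier Z))" using x by (auto simp: nonzero_def)
    then have "len Z \<le> len (subm Z (f ` carrier Z))" by (rule min[OF image[OF Z(1) f]])
    then have surj: "f ` carrier Z = carrier Z"
      using len_subm[OF ZM image_mod_cat(1)[OF ZM ZM f]] by fastforce
    then have "inj_on f (carrier Z)" using len_image[OF ZM ZM f] by auto
    then show ?thesis using surj by (simp add: bij_betw_def)
  qed
  then have "brick R Z" using ZM Z(2) by (auto simp: brick_iff)
  then show ?thesis using that Z(1) by blast
qed

lemma brick_mod_cat: "brick R X \<Longrightarrow> X \<in> mod_cat R"
  by (simp add: brick_def)

lemma brick_nonzero: "brick R X \<Longrightarrow> nonzero X"
  by (simp add: brick_iff)

lemma brick_endo:
  "\<lbrakk>brick R X; linear R X X f; x \<in> carrier X; f x \<noteq> \<zero>\<^bsub>X\<^esub>\<rbrakk> \<Longrightarrow> bij_betw f (carrier X) (carrier X)"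
  by (auto simp: brick_iff)

text \<open>The torsion-free part of \<open>X\<close> is non-zero, and the torsion-free quotients of
  \<open>X\<close> are stable under images of endomorphisms: such an image is a submodule of a
  torsion-free module and still a quotient of \<open>X\<close>.\<close>

lemma brick_quotient:
  assumes T: "torsion_class R T" and X: "X \<in> mod_cat R" "X \<notin> T"
  obtains B f where "brick R B" "B \<in> right_perp R T" "linear R X B f" "f ` carrier X = carrier B"
proof -
  note TM = torsion_class_subset[OF T]
  let ?C = "{Z \<in> right_perp R T. \<exists>f. linear R X Z f \<and> f ` carrier X = carrier Z}"
  obtain N Q p where N: "submod R X N" "subm X N \<in> T" and Q: "Q \<in> right_perp R T" "linear R X Q p"
    "p ` carrier X = carrier Q" "{x \<in> carrier X. p x = \<zero>\<^bsub>Q\<^esub>} = N"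
    by (rule torsion_submodule[OF T X(1)])
  have "N \<noteq> carrier X" using N(2) X(2) by auto
  then obtain x where "x \<in> carrier X" "p x \<noteq> \<zero>\<^bsub>Q\<^esub>" using Q(4) by blast
  then have nz: "nonzero Q" using Q(3) by (auto simp: nonzero_def)
  have mem: "Q \<in> ?C" using Q by blast
  have sub: "?C \<subseteq> mod_cat R" by (auto simp: right_perp_def)
  have img: "subm Z (f ` carrier Z) \<in> ?C" if Z: "Z \<in> ?C" and f: "linear R Z Z f" for Z f
  proof -
    obtain g where g: "linear R X Z g" "g ` carrier X = carrier Z" using Z by blast
    have ZM: "Z \<in> mod_cat R" using Z by (simp add: right_perp_def)
    note I = image_mod_cat[OF ZM ZM f]
    have "subm Z (f ` carrier Z) \<in> right_perp R T"
      using right_perp_inj[OF TM _ I(2) linear_subm[OF I(1)]] Z by auto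
    moreover have "linear R X (subm Z (f ` carrier Z)) (\<lambda>x. f (g x))"
      by (rule linear_compose[OF g(1) I(3)])
    moreover have "(\<lambda>x. f (g x)) ` carrier X = f ` carrier Z" using g(2) by (simp flip: image_image)
    ultimately show ?thesis by auto
  qed
  obtain B where "B \<in> ?C" "brick R B" by (rule brick_exists[OF sub img mem nz])
  then show ?thesis using that by blast
qed

text \<open>The counterpart for modules in \<open>T\<close> that embed into \<open>X\<close>; a
  non-zero one is the image of a non-zero map from \<open>T\<close> to \<open>X\<close>.\<close>

lemma brick_submodule:
  assumes T: "torsion_class R T" and X: "X \<in> mod_cat R" "X \<notin> right_perp R T"
  obtains B f where "brick R B" "B \<in> T" "linear R B X f" "inj_on f (carrier B)"
proof -
  note TM = torsion_class_subset[OF T]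
  let ?C = "{Z \<in> T. \<exists>f. linear R Z X f \<and> inj_on f (carrier Z)}"
  obtain Y where Y: "Y \<in> T" "hom_nonzero R Y X" using X right_perp_eq[OF TM] by blast
  obtain h y where h: "linear R Y X h" "y \<in> carrier Y" "h y \<noteq> \<zero>\<^bsub>X\<^esub>" using Y(2) by (rule hom_nonzeroE)
  have YM: "Y \<in> mod_cat R" using Y(1) TM by blast
  note J = image_mod_cat[OF YM X(1) h(1)]
  have nz: "nonzero (subm X (h ` carrier Y))" using h by (auto simp: nonzero_def)
  have mem: "subm X (h ` carrier Y) \<in> ?C"
    using torsion_class_image[OF T Y(1) X(1) h(1)] linear_subm[OF J(1)] by (auto intro!: inj_onI)
  have sub: "?C \<subseteq> mod_cat R" using TM by blast
  have img: "subm Z (f ` carrier Z) \<in> ?C" if Z: "Z \<in> ?C" and f: "linear R Z Z f" for Z f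
  proof -
    obtain g where g: "linear R Z X g" "inj_on g (carrier Z)" using Z by blast
    have ZM: "Z \<in> mod_cat R" using Z TM by blast
    note I = image_mod_cat[OF ZM ZM f]
    have "f ` carrier Z \<subseteq> carrier Z" using I(1) by (simp add: submod_def)
    then have "linear R (subm Z (f ` carrier Z)) X g" "inj_on g (carrier (subm Z (f ` carrier Z)))"
      using linear_restrict_dom[OF g(1)] inj_on_subset[OF g(2)] by auto
    then show ?thesis using torsion_class_image[OF T _ ZM f] Z by blast
  qed
  obtain B where "B \<in> ?C" "brick R B" by (rule brick_exists[OF sub img mem nz])
  then show ?thesis using that by blast
qed

text \<open>The image of \<open>f\<close> is a non-zero module in T(X), so it receives a non-zero
  map from \<open>X\<close>. Followed by the inclusion into \<open>X\<close> this is a non-zero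
  endomorphism of a brick, hence onto, and so the image is everything.\<close>

lemma left_perp_brick:
  assumes X: "brick R X" and Y: "Y \<in> left_perp R (right_perp R {X})" and f: "linear R Y X f"
    and y: "y \<in> carrier Y" "f y \<noteq> \<zero>\<^bsub>X\<^esub>"
  shows "f ` carrier Y = carrier X"
proof -
  have XM: "X \<in> mod_cat R" by (rule brick_mod_cat[OF X])
  have YM: "Y \<in> mod_cat R" using Y by (simp add: left_perp_def)
  have T: "torsion_class R (left_perp R (right_perp R {X}))"
    by (rule left_perp_torsion_class[OF ring_axioms]) (auto simp: right_perp_def)
  let ?I = "subm X (f ` carrier Y)"
  note I = image_mod_cat[OF YM XM f]
  have "?I \<in> left_perp R (right_perp R {X})" by (rule torsion_class_image[OF T Y XM f])
  moreover have "nonzero ?I" using y by (auto simp: nonzero_def)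
  ultimately have "?I \<notin> right_perp R {X}" using hom_nonzero_refl[of ?I R] by (auto simp: left_perp_def)
  then have "hom_nonzero R X ?I" using I(2) XM by (simp add: right_perp_eq)
  then obtain g x where g: "linear R X ?I g" "x \<in> carrier X" "g x \<noteq> \<zero>\<^bsub>?I\<^esub>" by (rule hom_nonzeroE)
  have "linear R X X g" using linear_compose[OF g(1) linear_subm[OF I(1)]] .
  then have "bij_betw g (carrier X) (carrier X)" using brick_endo[OF X _ g(2)] g(3) by simp
  then have "carrier X = g ` carrier X" by (simp add: bij_betw_def)
  also have "\<dots> \<subseteq> f ` carrier Y" using linear_closed[OF g(1)] by auto
  finally show ?thesis using I(1) by (auto simp: submod_def)
qed

text \<open>Dually, the image of \<open>f\<close> is a non-zero module in F(X), so it has a non-zero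
  map to \<open>X\<close>; its composite with \<open>f\<close> is bijective, which forces
  \<open>f\<close> to be injective.\<close>

lemma right_perp_brick:
  assumes X: "brick R X" and Y: "Y \<in> right_perp R (left_perp R {X})" and f: "linear R X Y f"
    and x: "x \<in> carrier X" "f x \<noteq> \<zero>\<^bsub>Y\<^esub>"
  shows "inj_on f (carrier X)"
proof -
  have XM: "X \<in> mod_cat R" by (rule brick_mod_cat[OF X])
  have YM: "Y \<in> mod_cat R" using Y by (simp add: right_perp_def)
  have LM: "left_perp R {X} \<subseteq> mod_cat R" by (auto simp: left_perp_def)
  let ?I = "subm Y (f ` carrier X)"
  note I = image_mod_cat[OF XM YM f]
  have "?I \<in> right_perp R (left_perp R {X})"
    using right_perp_inj[OF LM Y I(2) linear_subm[OF I(1)]] by (auto intro: inj_onI)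
  moreover have "nonzero ?I" using x by (auto simp: nonzero_def)
  ultimately have "?I \<notin> left_perp R {X}" using hom_nonzero_refl[of ?I R] by (auto simp: right_perp_eq[OF LM])
  then have "hom_nonzero R ?I X" using I(2) by (simp add: left_perp_def)
  then obtain g y where g: "linear R ?I X g" "y \<in> carrier ?I" "g y \<noteq> \<zero>\<^bsub>X\<^esub>" by (rule hom_nonzeroE)
  obtain u where u: "u \<in> carrier X" "y = f u" using g(2) by auto
  have "bij_betw (\<lambda>x. g (f x)) (carrier X) (carrier X)"
    using brick_endo[OF X linear_compose[OF I(3) g(1)] u(1)] g(3) u(2) by simp
  then have "inj_on (g \<circ> f) (carrier X)" by (simp add: bij_betw_def comp_def)
  then show ?thesis by (rule inj_on_imageI2)
qed

end

section \<open>Representatives of bricks\<close>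

lemma mod_iso_iff:
  assumes "left_module R M"
  shows "mod_iso R M N \<noteq> {} \<longleftrightarrow> (\<exists>f. linear R M N f \<and> bij_betw f (carrier M) (carrier N))"
proof
  assume "mod_iso R M N \<noteq> {}"
  then obtain f where "f \<in> mod_hom R M N" "bij_betw f (carrier M) (carrier N)"
    by (auto simp: mod_iso_def)
  then show "\<exists>f. linear R M N f \<and> bij_betw f (carrier M) (carrier N)"
    using mod_hom_linear[of f R M N] by blast
next
  assume "\<exists>f. linear R M N f \<and> bij_betw f (carrier M) (carrier N)"
  then obtain f where f: "linear R M N f" "bij_betw f (carrier M) (carrier N)" by blast
  have "bij_betw (restrict f (carrier M)) (carrier M) (carrier N)"
    using f(2) bij_betw_cong[of "carrier M" "restrict f (carrier M)" f] by simp
  then have "restrict f (carrier M) \<in> mod_iso R M N"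
    using mod_hom_restrict[OF assms f(1)] by (simp add: mod_iso_def)
  then show "mod_iso R M N \<noteq> {}" by blast
qed

lemma mod_iso_refl:
  assumes "left_module R M" shows "mod_iso R M M \<noteq> {}"
  unfolding mod_iso_iff[OF assms] by (intro exI[of _ "\<lambda>x. x"]) (simp add: linear_id bij_betw_def)

lemma mod_iso_sym:
  assumes M: "left_module R M" and N: "left_module R N" and iso: "mod_iso R M N \<noteq> {}"
  shows "mod_iso R N M \<noteq> {}"
proof -
  obtain f where f: "linear R M N f" "bij_betw f (carrier M) (carrier N)"
    using iso mod_iso_iff[OF M] by blast
  obtain g where g: "linear R N M g" "\<And>x. x \<in> carrier M \<Longrightarrow> g (f x) = x"
    "\<And>y. y \<in> carrier N \<Longrightarrow> f (g y) = y"
    using linear_inverse[OF M f] by blast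
  have "bij_betw g (carrier N) (carrier M)"
    using f(1) g by (intro bij_betwI[where g = f]) (auto simp: linear_def)
  then show ?thesis using g(1) mod_iso_iff[OF N] by blast
qed

lemma mod_iso_trans:
  assumes M: "left_module R M" and N: "left_module R N"
    and "mod_iso R M N \<noteq> {}" "mod_iso R N P \<noteq> {}"
  shows "mod_iso R M P \<noteq> {}"
proof -
  obtain f where f: "linear R M N f" "bij_betw f (carrier M) (carrier N)"
    using assms(3) mod_iso_iff[OF M] by blast
  obtain g where g: "linear R N P g" "bij_betw g (carrier N) (carrier P)"
    using assms(4) mod_iso_iff[OF N] by blast
  have "bij_betw (\<lambda>x. g (f x)) (carrier M) (carrier P)"
    using bij_betw_trans[OF f(2) g(2)] by (simp add: comp_def)
  then show ?thesis using linear_compose[OF f(1) g(1)] mod_iso_iff[OF M] by blast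
qed

lemma brick_left_module: "brick R X \<Longrightarrow> left_module R X"
  by (simp add: brick_def mod_cat_def)

lemma equiv_brick_iso_rel: "equiv {X. brick R X} (brick_iso_rel R)"
proof (rule equivI)
  show "brick_iso_rel R \<subseteq> {X. brick R X} \<times> {X. brick R X}" by (auto simp: brick_iso_rel_def)
  show "refl_on {X. brick R X} (brick_iso_rel R)"
    using mod_iso_refl[OF brick_left_module] by (auto simp: refl_on_def brick_iso_rel_def)
  show "sym (brick_iso_rel R)"
    using mod_iso_sym[OF brick_left_module brick_left_module] by (auto simp: sym_def brick_iso_rel_def)
  show "trans (brick_iso_rel R)"
  proof (rule transI)
    fix X Y Z assume "(X, Y) \<in> brick_iso_rel R" "(Y, Z) \<in> brick_iso_rel R"
    then show "(X, Z) \<in> brick_iso_rel R"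
      using mod_iso_trans[OF brick_left_module brick_left_module, of R X Y Z]
      by (simp add: brick_iso_rel_def)
  qed
qed

text \<open>One brick per isomorphism class turns isomorphism into equality, as the antisymmetry
  axioms of \<open>two_acyclic\<close> demand, and makes the set finite, although
  \<open>mod_cat\<close> may contain many copies of each brick.\<close>

locale brick_representatives = length_ring R len
  for R :: "('a, 'c) ring_scheme" (structure) and len +
  fixes Q :: "('a, 'a list) module set"
  assumes finite_reps: "finite Q"
    and rep_brick: "X \<in> Q \<Longrightarrow> brick R X"
    and rep_exists: "brick R X \<Longrightarrow> \<exists>Y\<in>Q. mod_iso R X Y \<noteq> {}"
    and rep_unique: "\<lbrakk>X \<in> Q; Y \<in> Q; mod_iso R X Y \<noteq> {}\<rbrakk> \<Longrightarrow> X = Y"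

lemma (in length_ring) brick_representatives_exist:
  assumes "brick_finite R"
  obtains Q where "brick_representatives R len Q"
proof -
  let ?B = "{X. brick R X}" and ?r = "brick_iso_rel R"
  note E = equiv_brick_iso_rel[of R]
  let ?rep = "\<lambda>C. SOME X. X \<in> C"
  have rep: "?rep C \<in> C" if C: "C \<in> ?B // ?r" for C
    using in_quotient_imp_non_empty[OF E C] by (simp add: some_in_eq)
  have "brick_representatives R len (?rep ` (?B // ?r))"
  proof (intro brick_representatives.intro brick_representatives_axioms.intro length_ring_axioms)
    show "finite (?rep ` (?B // ?r))" using assms by (simp add: brick_finite_def)
    show "brick R X" if "X \<in> ?rep ` (?B // ?r)" for X
      using that rep in_quotient_imp_subset[OF E] by blast
    show "\<exists>Y\<in>?rep ` (?B // ?r). mod_iso R X Y \<noteq> {}" if X: "brick R X" for X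
    proof -
      have C: "?r `` {X} \<in> ?B // ?r" using X by (intro quotientI) simp
      have "(X, ?rep (?r `` {X})) \<in> ?r" using rep[OF C] by blast
      then have "mod_iso R X (?rep (?r `` {X})) \<noteq> {}" unfolding brick_iso_rel_def by blast
      then show ?thesis using C by blast
    qed
    show "X = Y"
      if X: "X \<in> ?rep ` (?B // ?r)" and Y: "Y \<in> ?rep ` (?B // ?r)" and iso: "mod_iso R X Y \<noteq> {}"
      for X Y
    proof -
      obtain C where C: "C \<in> ?B // ?r" "X = ?rep C" using X by blast
      obtain D where D: "D \<in> ?B // ?r" "Y = ?rep D" using Y by blast
      have XY: "X \<in> C" "Y \<in> D" using rep C D by auto
      then have "brick R X" "brick R Y" using C(1) D(1) in_quotient_imp_subset[OF E] by blast+
      then have "(X, Y) \<in> ?r" using iso by (simp add: brick_iso_rel_def)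
      then have "C = D" by (rule quotient_eqI[OF E C(1) D(1) XY])
      then show ?thesis using C(2) D(2) by simp
    qed
  qed
  then show ?thesis by (rule that)
qed

context brick_representatives
begin

lemma rep_mod_cat: "X \<in> Q \<Longrightarrow> X \<in> mod_cat R"
  using rep_brick brick_mod_cat by blast

lemma rep_left_module: "X \<in> Q \<Longrightarrow> left_module R X"
  using rep_mod_cat mod_catD by blast

lemma rep_iso:
  assumes X: "brick R X"
  obtains Y f g where "Y \<in> Q" "linear R X Y f" "f ` carrier X = carrier Y" "inj_on f (carrier X)"
    "linear R Y X g" "g ` carrier Y = carrier X" "inj_on g (carrier Y)"
proof -
  obtain Y where Y: "Y \<in> Q" "mod_iso R X Y \<noteq> {}" using rep_exists[OF X] by blast
  have X': "left_module R X" using X by (rule brick_left_module)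
  obtain f where f: "linear R X Y f" "bij_betw f (carrier X) (carrier Y)"
    using Y(2) mod_iso_iff[OF X'] by blast
  obtain g where g: "linear R Y X g" "bij_betw g (carrier Y) (carrier X)"
    using mod_iso_sym[OF X' rep_left_module[OF Y(1)] Y(2)] mod_iso_iff[OF rep_left_module[OF Y(1)]] by blast
  show ?thesis using that[OF Y(1) f(1) _ _ g(1)] f(2) g(2) by (simp add: bij_betw_def)
qed

lemma rep_unique_linear:
  assumes "X \<in> Q" "Y \<in> Q" "linear R X Y f" "bij_betw f (carrier X) (carrier Y)"
  shows "X = Y"
proof (rule rep_unique[OF assms(1,2)])
  show "mod_iso R X Y \<noteq> {}" using mod_iso_iff[OF rep_left_module[OF assms(1)]] assms(3,4) by blast
qed

lemma rep_quotient:
  assumes T: "torsion_class R T" and X: "X \<in> mod_cat R" "X \<notin> T"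
  obtains B f where "B \<in> Q" "B \<in> right_perp R T" "linear R X B f" "f ` carrier X = carrier B"
proof -
  obtain B f where B: "brick R B" "B \<in> right_perp R T" "linear R X B f" "f ` carrier X = carrier B"
    by (rule brick_quotient[OF T X])
  obtain B' g h where B': "B' \<in> Q" "linear R B B' g" "g ` carrier B = carrier B'"
    "linear R B' B h" "inj_on h (carrier B')" by (rule rep_iso[OF B(1)])
  have "B' \<in> right_perp R T"
    by (rule right_perp_inj[OF torsion_class_subset[OF T] B(2) rep_mod_cat[OF B'(1)] B'(4,5)])
  moreover have "(\<lambda>x. g (f x)) ` carrier X = carrier B'" using B(4) B'(3) by (simp flip: image_image)
  ultimately show ?thesis using that[OF B'(1) _ linear_compose[OF B(3) B'(2)]] by blast
qed

lemma rep_submodule: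
  assumes T: "torsion_class R T" and X: "X \<in> mod_cat R" "X \<notin> right_perp R T"
  obtains B where "B \<in> Q" "B \<in> T" "hom_nonzero R B X"
proof -
  obtain B f where B: "brick R B" "B \<in> T" "linear R B X f" "inj_on f (carrier B)"
    by (rule brick_submodule[OF T X])
  obtain B' g h where B': "B' \<in> Q" "linear R B B' g" "g ` carrier B = carrier B'"
    "linear R B' B h" "h ` carrier B' = carrier B" by (rule rep_iso[OF B(1)])
  have "B' \<in> T" by (rule torsion_class_surj[OF T B(2) rep_mod_cat[OF B'(1)] B'(2,3)])
  moreover have "hom_nonzero R B X"
    using hom_nonzero_inj[OF brick_left_module[OF B(1)] mod_catD(1)[OF X(1)] B(3,4)
        hom_nonzero_refl[OF brick_nonzero[OF B(1)]]] .
  then have "hom_nonzero R B' X" by (rule hom_nonzero_surj[OF B'(4,5)])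
  ultimately show ?thesis using that B'(1) by blast
qed

sublocale H: finite_reflexive_relation Q "hom_nonzero R"
  using finite_reps rep_brick brick_nonzero hom_nonzero_refl by unfold_locales blast+

text \<open>Bricks suffice to detect torsion-freeness: a module outside the right perpendicular
  receives a non-zero map from a representative inside \<open>T\<close>. Dually, in
  \<open>lperp_torsion_class\<close>, a module outside \<open>T\<close> maps onto a torsion-free
  representative.\<close>

lemma rperp_torsion_class:
  assumes T: "torsion_class R T"
  shows "H.rperp (T \<inter> Q) = right_perp R T \<inter> Q"
proof (intro equalityI subsetI)
  fix X assume X: "X \<in> H.rperp (T \<inter> Q)"
  then have XQ: "X \<in> Q" by (simp add: H.rperp_def)
  have "X \<in> right_perp R T"
  proof (rule ccontr)
    assume n: "X \<notin> right_perp R T"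
    obtain B where "B \<in> Q" "B \<in> T" "hom_nonzero R B X"
      by (rule rep_submodule[OF T rep_mod_cat[OF XQ] n])
    then show False using X by (auto simp: H.rperp_def)
  qed
  then show "X \<in> right_perp R T \<inter> Q" using XQ by simp
next
  fix X assume "X \<in> right_perp R T \<inter> Q"
  then show "X \<in> H.rperp (T \<inter> Q)"
    using right_perp_eq[OF torsion_class_subset[OF T]] by (auto simp: H.rperp_def)
qed

lemma lperp_torsion_class:
  assumes T: "torsion_class R T"
  shows "H.lperp (right_perp R T \<inter> Q) = T \<inter> Q"
proof (intro equalityI subsetI)
  fix X assume X: "X \<in> H.lperp (right_perp R T \<inter> Q)"
  then have XQ: "X \<in> Q" by (simp add: H.lperp_def)
  have "X \<in> T"
  proof (rule ccontr)
    assume n: "X \<notin> T"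
    obtain B f where B: "B \<in> Q" "B \<in> right_perp R T" "linear R X B f" "f ` carrier X = carrier B"
      by (rule rep_quotient[OF T rep_mod_cat[OF XQ] n])
    have "hom_nonzero R X B" using hom_nonzero_surj[OF B(3,4) H.rel_refl[OF B(1)]] .
    then show False using X B by (auto simp: H.lperp_def)
  qed
  then show "X \<in> T \<inter> Q" using XQ by simp
next
  fix X assume "X \<in> T \<inter> Q"
  then show "X \<in> H.lperp (right_perp R T \<inter> Q)"
    using right_perp_eq[OF torsion_class_subset[OF T]] by (auto simp: H.lperp_def)
qed

lemma torsion_class_closed: "torsion_class R T \<Longrightarrow> H.closed (T \<inter> Q)"
  by (simp add: H.closed_def rperp_torsion_class lperp_torsion_class)

text \<open>A module in \<open>T\<close> but not in \<open>U\<close> has a brick quotient that is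
  torsion-free for \<open>U\<close>. As a quotient it is in \<open>T\<close>, so by assumption in
  \<open>U\<close>, and its identity contradicts torsion-freeness.\<close>

lemma torsion_class_le_iff:
  assumes T: "torsion_class R T" and U: "torsion_class R U"
  shows "T \<subseteq> U \<longleftrightarrow> T \<inter> Q \<subseteq> U \<inter> Q"
proof
  assume sub: "T \<inter> Q \<subseteq> U \<inter> Q"
  show "T \<subseteq> U"
  proof
    fix X assume X: "X \<in> T"
    show "X \<in> U"
    proof (rule ccontr)
      assume n: "X \<notin> U"
      have XM: "X \<in> mod_cat R" using X torsion_class_subset[OF T] by blast
      obtain B f where B: "B \<in> Q" "B \<in> right_perp R U" "linear R X B f" "f ` carrier X = carrier B"
        by (rule rep_quotient[OF U XM n])
      have "B \<in> T" by (rule torsion_class_surj[OF T X rep_mod_cat[OF B(1)] B(3,4)])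
      then have "B \<in> U" using B(1) sub by blast
      then show False
        using B(1,2) H.rel_refl[OF B(1)] right_perp_eq[OF torsion_class_subset[OF U]] by blast
    qed
  qed
qed auto

lemma torsion_class_image_reps:
  "(\<lambda>T. T \<inter> Q) ` {T. torsion_class R T} = {S. H.closed S}"
proof (intro equalityI subsetI)
  fix S assume "S \<in> {S. H.closed S}"
  then have S: "H.closed S" by simp
  have M: "H.rperp S \<subseteq> mod_cat R" using H.rperp_subset rep_mod_cat by blast
  have "left_perp R (H.rperp S) \<inter> Q = H.lperp (H.rperp S)"
    using rep_mod_cat by (auto simp: left_perp_def H.lperp_def)
  then have "S = left_perp R (H.rperp S) \<inter> Q" using S by (simp add: H.closed_def)
  moreover have "torsion_class R (left_perp R (H.rperp S))"
    by (rule left_perp_torsion_class[OF ring_axioms M])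
  ultimately show "S \<in> (\<lambda>T. T \<inter> Q) ` {T. torsion_class R T}" by blast
qed (use torsion_class_closed in auto)

text \<open>This is T(X), the smallest torsion class containing \<open>X\<close>, and not just the
  quotients of powers of \<open>X\<close>; \<open>cogen\<close> is F(X). As double perpendiculars
  both are described by Hom alone.\<close>

abbreviation gen :: "('a, 'a list) module \<Rightarrow> ('a, 'a list) module set"
  where "gen X \<equiv> left_perp R (right_perp R {X})"

abbreviation cogen :: "('a, 'a list) module \<Rightarrow> ('a, 'a list) module set"
  where "cogen X \<equiv> right_perp R (left_perp R {X})"

lemma gen_torsion_class: "torsion_class R (gen X)"
  by (rule left_perp_torsion_class[OF ring_axioms]) (auto simp: right_perp_def)

lemma left_perp_single_torsion_class: "X \<in> Q \<Longrightarrow> torsion_class R (left_perp R {X})"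
  using rep_mod_cat by (intro left_perp_torsion_class[OF ring_axioms]) auto

text \<open>\<open>epi\<close> tests against bricks only, \<open>gen\<close> against all modules.
  The gap is closed by brick quotients: outside \<open>gen X\<close>, \<open>Y\<close> would map
  onto a representative to which \<open>X\<close> has no non-zero map. For \<open>mono_iff\<close>
  it is closed by bricks mapping to \<open>X\<close>.\<close>

lemma epi_iff:
  assumes X: "X \<in> Q" and Y: "Y \<in> Q"
  shows "H.epi X Y \<longleftrightarrow> Y \<in> gen X"
proof
  have XM: "{X} \<subseteq> mod_cat R" using rep_mod_cat X by auto
  assume epi: "H.epi X Y"
  show "Y \<in> gen X"
  proof (rule ccontr)
    assume n: "Y \<notin> gen X"
    obtain B f where B: "B \<in> Q" "B \<in> right_perp R (gen X)" "linear R Y B f" "f ` carrier Y = carrier B"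
      by (rule rep_quotient[OF gen_torsion_class rep_mod_cat[OF Y] n])
    have "hom_nonzero R Y B" using hom_nonzero_surj[OF B(3,4) H.rel_refl[OF B(1)]] .
    then have "hom_nonzero R X B" using epi B(1) by (simp add: H.epi_def)
    moreover have "X \<in> gen X" using XM by (auto simp: left_perp_def right_perp_eq[OF XM])
    ultimately show False
      using B(2) right_perp_eq[OF torsion_class_subset[OF gen_torsion_class]] by blast
  qed
next
  assume "Y \<in> gen X"
  moreover have "{X} \<subseteq> mod_cat R" using rep_mod_cat X by auto
  ultimately show "H.epi X Y"
    using rep_mod_cat by (auto simp: H.epi_def left_perp_def right_perp_eq)
qed

lemma mono_iff:
  assumes X: "X \<in> Q" and Y: "Y \<in> Q"
  shows "H.mono X Y \<longleftrightarrow> X \<in> cogen Y"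
proof
  assume mono: "H.mono X Y"
  show "X \<in> cogen Y"
  proof (rule ccontr)
    assume n: "X \<notin> cogen Y"
    obtain B where B: "B \<in> Q" "B \<in> left_perp R {Y}" "hom_nonzero R B X"
      by (rule rep_submodule[OF left_perp_single_torsion_class[OF Y] rep_mod_cat[OF X] n])
    have "hom_nonzero R B Y" using mono B(1,3) by (simp add: H.mono_def)
    then show False using B(2) by (simp add: left_perp_def)
  qed
next
  assume "X \<in> cogen Y"
  moreover have "left_perp R {Y} \<subseteq> mod_cat R" by (auto simp: left_perp_def)
  ultimately show "H.mono X Y"
    using rep_mod_cat by (auto simp: H.mono_def left_perp_def right_perp_eq)
qed

lemma hom_factorization:
  assumes X: "X \<in> Q" and Y: "Y \<in> Q" and XY: "hom_nonzero R X Y"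
  shows "\<exists>Z\<in>Q. H.epi X Z \<and> H.mono Z Y"
proof -
  note T = gen_torsion_class[of X] and U = left_perp_single_torsion_class[OF Y]
  note UM = torsion_class_subset[OF U]
  have XM: "{X} \<subseteq> mod_cat R" using rep_mod_cat X by auto
  have XT: "X \<in> gen X" using XM by (auto simp: left_perp_def right_perp_eq[OF XM])
  have YU: "Y \<in> cogen Y"
    unfolding right_perp_eq[OF UM] using rep_mod_cat[OF Y] by (simp add: left_perp_def)
  obtain f x where f: "linear R X Y f" "x \<in> carrier X" "f x \<noteq> \<zero>\<^bsub>Y\<^esub>" using XY by (rule hom_nonzeroE)
  \<comment> \<open>Serves twice: for the given map \<open>f\<close>, where it supplies a non-zero
    member, and for endomorphisms, where it supplies the stability required by
    \<open>brick_exists\<close>.\<close>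
  have img: "subm Z (h ` carrier V) \<in> gen X \<inter> cogen Y"
    if "V \<in> gen X" "Z \<in> cogen Y" "linear R V Z h" for V Z h
  proof -
    have M: "V \<in> mod_cat R" "Z \<in> mod_cat R" using that(1,2) by (simp_all add: left_perp_def right_perp_def)
    note J = image_mod_cat[OF M that(3)]
    show ?thesis
      using torsion_class_image[OF T that(1) M(2) that(3)]
        right_perp_inj[OF UM that(2) J(2) linear_subm[OF J(1)]] by (auto intro: inj_onI)
  qed
  have sub: "gen X \<inter> cogen Y \<subseteq> mod_cat R" by (auto simp: left_perp_def)
  have endo: "subm Z (h ` carrier Z) \<in> gen X \<inter> cogen Y" if "Z \<in> gen X \<inter> cogen Y" "linear R Z Z h" for Z h
    using img[of Z Z h] that by blast
  have nz: "nonzero (subm Y (f ` carrier X))" using f(2,3) by (auto simp: nonzero_def)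
  obtain B where B: "B \<in> gen X \<inter> cogen Y" "brick R B"
    by (rule brick_exists[OF sub endo img[OF XT YU f(1)] nz])
  obtain Z g h where Z: "Z \<in> Q" "linear R B Z g" "g ` carrier B = carrier Z"
    "linear R Z B h" "inj_on h (carrier Z)" by (rule rep_iso[OF B(2)])
  have "Z \<in> gen X" using torsion_class_surj[OF T _ rep_mod_cat[OF Z(1)] Z(2,3)] B(1) by blast
  moreover have "Z \<in> cogen Y" using right_perp_inj[OF UM _ rep_mod_cat[OF Z(1)] Z(4,5)] B(1) by blast
  ultimately show ?thesis using epi_iff[OF X Z(1)] mono_iff[OF Z(1) Y] Z(1) by blast
qed

text \<open>The surjection runs against \<open>epi\<close>: as \<open>Y\<close> lies in T(X), any
  non-zero map from \<open>Y\<close> to the brick \<open>X\<close> is onto. Likewise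
  \<open>mono_inj\<close> yields an injection opposite to \<open>mono\<close>.\<close>

lemma epi_surj:
  assumes X: "X \<in> Q" and Y: "Y \<in> Q" and epi: "H.epi X Y" and YX: "hom_nonzero R Y X"
  obtains f where "linear R Y X f" "f ` carrier Y = carrier X"
proof -
  obtain f y where f: "linear R Y X f" "y \<in> carrier Y" "f y \<noteq> \<zero>\<^bsub>X\<^esub>" using YX by (rule hom_nonzeroE)
  have "Y \<in> gen X" using epi epi_iff[OF X Y] by blast
  then have "f ` carrier Y = carrier X" using left_perp_brick[OF rep_brick[OF X] _ f] by blast
  then show ?thesis using that f(1) by blast
qed

lemma mono_inj:
  assumes X: "X \<in> Q" and Y: "Y \<in> Q" and mono: "H.mono Y X" and XY: "hom_nonzero R X Y"
  obtains f where "linear R X Y f" "inj_on f (carrier X)"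
proof -
  obtain f x where f: "linear R X Y f" "x \<in> carrier X" "f x \<noteq> \<zero>\<^bsub>Y\<^esub>" using XY by (rule hom_nonzeroE)
  have "Y \<in> cogen X" using mono mono_iff[OF Y X] by blast
  then have "inj_on f (carrier X)" using right_perp_brick[OF rep_brick[OF X] _ f] by blast
  then show ?thesis using that f(1) by blast
qed

lemma inj_nonzero:
  assumes X: "X \<in> Q" and Y: "left_module R Y" and f: "linear R X Y f" "inj_on f (carrier X)"
  obtains x where "x \<in> carrier X" "f x \<noteq> \<zero>\<^bsub>Y\<^esub>"
  using brick_nonzero[OF rep_brick[OF X]] f linear_inj_on_iff[OF rep_left_module[OF X] Y f(1)]
  unfolding nonzero_def by blast

lemma surj_nonzero:
  assumes Y: "Y \<in> Q" and f: "f ` carrier X = carrier Y"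
  obtains x where "x \<in> carrier X" "f x \<noteq> \<zero>\<^bsub>Y\<^esub>"
  using brick_nonzero[OF rep_brick[OF Y]] unfolding nonzero_def f[symmetric] by blast

text \<open>For each collapsing axiom the maps from \<open>epi_surj\<close> and
  \<open>mono_inj\<close> run in opposite directions and compose to a non-zero endomorphism of a
  brick. Its bijectivity turns one of the two factors into an isomorphism, and isomorphic
  representatives are equal.\<close>

sublocale H: two_acyclic Q "hom_nonzero R"
proof
  fix X Y assume X: "X \<in> Q" and Y: "Y \<in> Q"
  show "hom_nonzero R X Y \<Longrightarrow> \<exists>Z\<in>Q. H.epi X Z \<and> H.mono Z Y"
    by (rule hom_factorization[OF X Y])
  show "X = Y" if e: "H.epi X Y" "H.epi Y X"
  proof -
    have h: "hom_nonzero R Y X" "hom_nonzero R X Y"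
      using e H.rel_refl X Y by (auto simp: H.epi_def)
    obtain f where f: "linear R Y X f" "f ` carrier Y = carrier X" by (rule epi_surj[OF X Y e(1) h(1)])
    obtain g where g: "linear R X Y g" "g ` carrier X = carrier Y" by (rule epi_surj[OF Y X e(2) h(2)])
    have im: "(\<lambda>x. f (g x)) ` carrier X = carrier X" using f(2) g(2) by (simp flip: image_image)
    obtain x where "x \<in> carrier X" "f (g x) \<noteq> \<zero>\<^bsub>X\<^esub>" by (rule surj_nonzero[OF X im])
    then have "bij_betw (\<lambda>x. f (g x)) (carrier X) (carrier X)"
      by (rule brick_endo[OF rep_brick[OF X] linear_compose[OF g(1) f(1)]])
    then have "inj_on (f \<circ> g) (carrier X)" by (simp add: bij_betw_def comp_def)
    then have "inj_on g (carrier X)" by (rule inj_on_imageI2)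
    then show ?thesis using rep_unique_linear[OF X Y g(1)] g(2) by (simp add: bij_betw_def)
  qed
  show "X = Y" if m: "H.mono X Y" "H.mono Y X"
  proof -
    have h: "hom_nonzero R Y X" "hom_nonzero R X Y"
      using m H.rel_refl X Y by (auto simp: H.mono_def)
    obtain f where f: "linear R X Y f" "inj_on f (carrier X)" by (rule mono_inj[OF X Y m(2) h(2)])
    obtain g where g: "linear R Y X g" "inj_on g (carrier Y)" by (rule mono_inj[OF Y X m(1) h(1)])
    have fY: "f ` carrier X \<subseteq> carrier Y" using f(1) by (auto simp: linear_def)
    have "inj_on (g \<circ> f) (carrier X)" using f(2) inj_on_subset[OF g(2) fY] by (rule comp_inj_on)
    then have inj: "inj_on (\<lambda>x. g (f x)) (carrier X)" by (simp add: comp_def)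
    note lin = linear_compose[OF f(1) g(1)]
    obtain x where "x \<in> carrier X" "g (f x) \<noteq> \<zero>\<^bsub>X\<^esub>"
      by (rule inj_nonzero[OF X rep_left_module[OF X] lin inj])
    then have "bij_betw (\<lambda>x. g (f x)) (carrier X) (carrier X)" by (rule brick_endo[OF rep_brick[OF X] lin])
    then have im: "g ` f ` carrier X = carrier X" by (simp add: bij_betw_def image_image)
    have "g ` carrier Y \<subseteq> carrier X" using g(1) by (auto simp: linear_def)
    moreover have "g ` f ` carrier X \<subseteq> g ` carrier Y" using fY by (rule image_mono)
    ultimately have "g ` carrier Y = carrier X" using im by simp
    then show ?thesis using rep_unique_linear[OF Y X g(1)] g(2) by (simp add: bij_betw_def)
  qed
  show "X = Y" if em: "H.epi X Y" "H.mono Y X"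
  proof -
    have h: "hom_nonzero R Y X" "hom_nonzero R X Y"
      using em H.rel_refl X Y by (auto simp: H.mono_def H.epi_def)
    obtain f where f: "linear R Y X f" "f ` carrier Y = carrier X" by (rule epi_surj[OF X Y em(1) h(1)])
    obtain g where g: "linear R X Y g" "inj_on g (carrier X)" by (rule mono_inj[OF X Y em(2) h(2)])
    obtain x where x: "x \<in> carrier X" "g x \<noteq> \<zero>\<^bsub>Y\<^esub>" by (rule inj_nonzero[OF X rep_left_module[OF Y] g])
    obtain y where y: "y \<in> carrier Y" "f y = x" using x(1) unfolding f(2)[symmetric] by blast
    have "bij_betw (\<lambda>y. g (f y)) (carrier Y) (carrier Y)"
      using brick_endo[OF rep_brick[OF Y] linear_compose[OF f(1) g(1)] y(1)] x(2) y(2) by simp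
    then have "inj_on (g \<circ> f) (carrier Y)" by (simp add: bij_betw_def comp_def)
    then have "inj_on f (carrier Y)" by (rule inj_on_imageI2)
    then show ?thesis using rep_unique_linear[OF Y X f(1)] f(2) by (simp add: bij_betw_def)
  qed
qed

sublocale H: closed_set_lattice Q "hom_nonzero R" "tors R" "\<lambda>T. T \<inter> Q"
proof -
  interpret C: complete_lattice "tors R" by (rule tors_complete_lattice[OF ring_axioms])
  have top: "\<exists>x. greatest (tors R) x (carrier (tors R))"
    using torsion_class_mod_cat[OF ring_axioms] torsion_class_subset
    by (intro exI[of _ "mod_cat R"]) (auto simp: greatest_def tors_def)
  have bot: "\<exists>x. least (tors R) x (carrier (tors R))"
    using torsion_class_Inter[OF ring_axioms, of "{T. torsion_class R T}"]
      torsion_class_mod_cat[OF ring_axioms]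
    by (intro exI[of _ "\<Inter>{T. torsion_class R T}"]) (auto simp: least_def tors_def)
  show "closed_set_lattice Q (hom_nonzero R) (tors R) (\<lambda>T. T \<inter> Q)"
  proof (intro closed_set_lattice.intro closed_set_lattice_axioms.intro)
    show "two_acyclic Q (hom_nonzero R)" by unfold_locales
    show "bounded_lattice (tors R)" using top bot by unfold_locales
    show "T \<sqsubseteq>\<^bsub>tors R\<^esub> U \<longleftrightarrow> T \<inter> Q \<subseteq> U \<inter> Q" if "T \<in> carrier (tors R)" "U \<in> carrier (tors R)" for T U
      using that torsion_class_le_iff by (simp add: tors_def)
    show "(\<lambda>T. T \<inter> Q) ` carrier (tors R) = {S. finite_reflexive_relation.closed Q (hom_nonzero R) S}"
      using torsion_class_image_reps by (simp add: tors_def)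
  qed
qed

text \<open>A torsion class and its right perpendicular are stable under isomorphism, so the
  representatives decide.\<close>

lemma brick_splitting_iff:
  "brick_splitting R T \<longleftrightarrow> torsion_class R T \<and> H.upclosed (T \<inter> Q)"
proof (cases "torsion_class R T")
  case T: True
  have "(\<forall>X. brick R X \<longrightarrow> X \<in> T \<or> X \<in> right_perp R T) \<longleftrightarrow> (\<forall>X\<in>Q. X \<in> T \<or> X \<in> right_perp R T)"
  proof
    assume *: "\<forall>X\<in>Q. X \<in> T \<or> X \<in> right_perp R T"
    show "\<forall>X. brick R X \<longrightarrow> X \<in> T \<or> X \<in> right_perp R T"
    proof (intro allI impI)
      fix X assume X: "brick R X"
      obtain Y f g where Y: "Y \<in> Q" "linear R X Y f" "inj_on f (carrier X)"
        "linear R Y X g" "g ` carrier Y = carrier X" by (rule rep_iso[OF X])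
      show "X \<in> T \<or> X \<in> right_perp R T"
        using * Y(1) torsion_class_surj[OF T _ brick_mod_cat[OF X] Y(4,5)]
          right_perp_inj[OF torsion_class_subset[OF T] _ brick_mod_cat[OF X] Y(2,3)] by blast
    qed
  qed (use rep_brick in blast)
  also have "\<dots> \<longleftrightarrow> H.upclosed (T \<inter> Q)"
    unfolding H.upclosed_iff_split rperp_torsion_class[OF T] by blast
  finally show ?thesis using T by (simp add: brick_splitting_def)
qed (simp add: brick_splitting_def)

text \<open>Consecutive members of a cycle of the relation are distinct representatives, hence not
  isomorphic, so any non-zero map between them is a legal step of a brick-cycle.\<close>

lemma brick_directed_acyclic:
  assumes dir: "brick_directed R"
  shows H.acyclic_rel
  unfolding H.acyclic_rel_def
proof (rule acyclicI, intro allI notI)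
  let ?r = "{(X, Y). X \<in> Q \<and> Y \<in> Q \<and> hom_nonzero R X Y \<and> X \<noteq> Y}"
  fix X assume "(X, X) \<in> ?r\<^sup>+"
  then obtain m where m: "0 < m" "(X, X) \<in> ?r ^^ m" unfolding trancl_power by blast
  obtain F where F: "F 0 = X" "F m = X" and step: "\<And>i. i < m \<Longrightarrow> (F i, F (Suc i)) \<in> ?r"
    using m(2) unfolding relpow_fun_conv by blast
  have "X \<in> Q" using step[OF m(1)] F(1) by simp
  then have FQ: "F i \<in> Q" if "i \<le> m" for i
    using step[of i] F(2) that by (cases "i = m") auto
  let ?P = "\<lambda>j f. f \<in> mod_hom R (F (j - 1)) (F j) \<and> f \<noteq> zero_hom (F (j - 1)) (F j) \<and>
      f \<notin> mod_iso R (F (j - 1)) (F j)"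
  have ex: "\<exists>f. ?P j f" if j: "j \<in> {1..m}" for j
  proof -
    have s: "F (j - 1) \<in> Q" "F j \<in> Q" "hom_nonzero R (F (j - 1)) (F j)" "F (j - 1) \<noteq> F j"
    proof -
      have "j - 1 < m" "Suc (j - 1) = j" using j by auto
      then show "F (j - 1) \<in> Q" "F j \<in> Q" "hom_nonzero R (F (j - 1)) (F j)" "F (j - 1) \<noteq> F j"
        using step[of "j - 1"] by simp_all
    qed
    obtain f x where f: "linear R (F (j - 1)) (F j) f" "x \<in> carrier (F (j - 1))" "f x \<noteq> \<zero>\<^bsub>F j\<^esub>"
      using s(3) by (rule hom_nonzeroE)
    let ?f = "restrict f (carrier (F (j - 1)))"
    have "?f \<in> mod_hom R (F (j - 1)) (F j)" by (rule mod_hom_restrict[OF rep_left_module[OF s(1)] f(1)])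
    moreover have "?f \<noteq> zero_hom (F (j - 1)) (F j)"
      using f(2,3) by (auto simp: zero_hom_def fun_eq_iff)
    moreover have "?f \<notin> mod_iso R (F (j - 1)) (F j)" using rep_unique[OF s(1,2)] s(4) by blast
    ultimately show ?thesis by blast
  qed
  have "\<forall>j\<in>{1..m}. ?P j (SOME f. ?P j f)" using someI_ex[OF ex] by blast
  then have "brick_cycle R m F (\<lambda>j. SOME f. ?P j f)"
    unfolding brick_cycle_def
    using m(1) F rep_brick[OF FQ] mod_iso_refl[OF rep_left_module[OF \<open>X \<in> Q\<close>]] by simp
  then show False using dir by (auto simp: brick_directed_def)
qed

text \<open>Passing to representatives keeps the maps non-zero. Consecutive representatives stay
  distinct: otherwise the map followed by an isomorphism back would be a non-zero endomorphism of a
  brick, hence bijective, and the map would be invertible.\<close>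

lemma acyclic_brick_directed:
  assumes ac: H.acyclic_rel
  shows "brick_directed R"
  unfolding brick_directed_def
proof (intro notI, elim exE)
  let ?r = "{(X, Y). X \<in> Q \<and> Y \<in> Q \<and> hom_nonzero R X Y \<and> X \<noteq> Y}"
  fix m X f assume cyc: "brick_cycle R m X f"
  have m: "1 \<le> m" and br: "\<And>i. i \<le> m \<Longrightarrow> brick R (X i)" and iso: "mod_iso R (X 0) (X m) \<noteq> {}"
    and f: "\<And>j. j \<in> {1..m} \<Longrightarrow> f j \<in> mod_hom R (X (j - 1)) (X j) \<and>
        f j \<noteq> zero_hom (X (j - 1)) (X j) \<and> f j \<notin> mod_iso R (X (j - 1)) (X j)"
    using cyc unfolding brick_cycle_def by simp_all
  define \<rho> where "\<rho> Y = (SOME Z. Z \<in> Q \<and> mod_iso R Y Z \<noteq> {})" for Y :: "('a, 'a list) module"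
  have \<rho>: "\<rho> Y \<in> Q" "mod_iso R Y (\<rho> Y) \<noteq> {}" if "brick R Y" for Y
    using someI_ex[OF rep_exists[OF that, unfolded Bex_def]] by (simp_all add: \<rho>_def)
  have \<rho>': "mod_iso R (\<rho> Y) Y \<noteq> {}" if "brick R Y" for Y
    by (rule mod_iso_sym[OF brick_left_module[OF that] rep_left_module[OF \<rho>(1)[OF that]] \<rho>(2)[OF that]])
  have step: "(\<rho> (X i), \<rho> (X (Suc i))) \<in> ?r" if i: "i < m" for i
  proof -
    let ?X = "X i" and ?Y = "X (Suc i)" and ?f = "f (Suc i)"
    have b: "brick R ?X" "brick R ?Y" using br i by auto
    have h: "?f \<in> mod_hom R ?X ?Y" "?f \<noteq> zero_hom ?X ?Y" "?f \<notin> mod_iso R ?X ?Y"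
      using f[of "Suc i"] i by auto
    note lX = brick_left_module[OF b(1)] and lY = brick_left_module[OF b(2)]
    note l = mod_hom_linear[OF h(1)]
    have "mod_hom R ?X ?Y \<noteq> {zero_hom ?X ?Y}" using h(1,2) by blast
    then have nz: "hom_nonzero R ?X ?Y" using hom_nonzero_iff[OF lX lY] by simp
    obtain u where u: "linear R (\<rho> ?X) ?X u" "bij_betw u (carrier (\<rho> ?X)) (carrier ?X)"
      using \<rho>'[OF b(1)] mod_iso_iff[OF rep_left_module[OF \<rho>(1)[OF b(1)]]] by blast
    obtain v where v: "linear R ?Y (\<rho> ?Y) v" "bij_betw v (carrier ?Y) (carrier (\<rho> ?Y))"
      using \<rho>(2)[OF b(2)] mod_iso_iff[OF lY] by blast
    have "hom_nonzero R ?X (\<rho> ?Y)"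
      by (rule hom_nonzero_inj[OF lY rep_left_module[OF \<rho>(1)[OF b(2)]] v(1) bij_betw_imp_inj_on[OF v(2)] nz])
    then have "hom_nonzero R (\<rho> ?X) (\<rho> ?Y)"
      by (rule hom_nonzero_surj[OF u(1) bij_betw_imp_surj_on[OF u(2)]])
    moreover have "\<rho> ?X \<noteq> \<rho> ?Y"
    proof
      assume eq: "\<rho> ?X = \<rho> ?Y"
      have "mod_iso R ?Y (\<rho> ?X) \<noteq> {}" unfolding eq by (rule \<rho>(2)[OF b(2)])
      then have "mod_iso R ?Y ?X \<noteq> {}"
        using \<rho>'[OF b(1)] by (rule mod_iso_trans[OF lY rep_left_module[OF \<rho>(1)[OF b(1)]]])
      then obtain w where w: "linear R ?Y ?X w" "bij_betw w (carrier ?Y) (carrier ?X)"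
        using mod_iso_iff[OF lY] by blast
      have winj: "inj_on w (carrier ?Y)" by (rule bij_betw_imp_inj_on[OF w(2)])
      have "\<exists>x\<in>carrier ?X. ?f x \<noteq> \<zero>\<^bsub>?Y\<^esub>"
      proof (rule ccontr)
        assume "\<not> (\<exists>x\<in>carrier ?X. ?f x \<noteq> \<zero>\<^bsub>?Y\<^esub>)"
        then have "?f = zero_hom ?X ?Y"
          using h(1) by (auto simp: mod_hom_def zero_hom_def PiE_def extensional_def)
        then show False using h(2) by blast
      qed
      then obtain x where x: "x \<in> carrier ?X" "?f x \<noteq> \<zero>\<^bsub>?Y\<^esub>" by blast
      have "w (?f x) \<noteq> \<zero>\<^bsub>?X\<^esub>"
        using linear_closed[OF l x(1)] winj x(2) linear_inj_on_iff[OF lY lX w(1)] by blast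
      then have bij: "bij_betw (\<lambda>x. w (?f x)) (carrier ?X) (carrier ?X)"
        by (rule brick_endo[OF b(1) linear_compose[OF l w(1)] x(1)])
      then have "inj_on (w \<circ> ?f) (carrier ?X)" by (simp add: bij_betw_def comp_def)
      then have finj: "inj_on ?f (carrier ?X)" by (rule inj_on_imageI2)
      have "w ` ?f ` carrier ?X = w ` carrier ?Y"
        using bij w(2) by (simp add: bij_betw_def image_image)
      moreover have "?f ` carrier ?X \<subseteq> carrier ?Y" using linear_closed[OF l] by blast
      ultimately have "?f ` carrier ?X = carrier ?Y"
        using inj_on_image_eq_iff[OF winj _ order_refl] by blast
      then have "?f \<in> mod_iso R ?X ?Y" using h(1) finj by (simp add: mod_iso_def bij_betw_def)
      then show False using h(3) by blast
    qed
    ultimately show ?thesis using \<rho>(1)[OF b(1)] \<rho>(1)[OF b(2)] by simp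
  qed
  then have "(\<rho> (X 0), \<rho> (X m)) \<in> ?r ^^ m" unfolding relpow_fun_conv by (intro exI[of _ "\<lambda>i. \<rho> (X i)"]) simp
  moreover have "\<rho> (X 0) = \<rho> (X m)"
  proof -
    have b: "brick R (X 0)" "brick R (X m)" using br by auto
    have "mod_iso R (\<rho> (X 0)) (X m) \<noteq> {}"
      by (rule mod_iso_trans[OF rep_left_module[OF \<rho>(1)[OF b(1)]] brick_left_module[OF b(1)] \<rho>'[OF b(1)] iso])
    then have "mod_iso R (\<rho> (X 0)) (\<rho> (X m)) \<noteq> {}"
      using \<rho>(2)[OF b(2)] by (rule mod_iso_trans[OF rep_left_module[OF \<rho>(1)[OF b(1)]] brick_left_module[OF b(2)]])
    then show ?thesis by (rule rep_unique[OF \<rho>(1)[OF b(1)] \<rho>(1)[OF b(2)]])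
  qed
  ultimately have "(\<rho> (X 0), \<rho> (X 0)) \<in> ?r\<^sup>+"
    using m unfolding trancl_power by (intro exI[of _ m]) simp
  then show False using ac by (simp add: H.acyclic_rel_def acyclic_def)
qed

end

theorem theorem1p7:
  fixes K :: "('k, 'c) ring_scheme" and A :: "('k, 'a, 'd) module_scheme"
  assumes "findim_algebra K A"
    and "brick_finite A"
  shows "(brick_directed A \<longleftrightarrow> left_modular_lattice (tors A)) \<and>
    (brick_directed A \<longleftrightarrow> extremal_lattice (tors A)) \<and>
    (brick_directed A \<longleftrightarrow> trim_lattice (tors A)) \<and>
    (brick_directed A \<or> left_modular_lattice (tors A) \<or> extremal_lattice (tors A) \<or>
        trim_lattice (tors A) \<longrightarrow>
      spine (tors A) = {T. brick_splitting A T} \<and>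
      distributive_sublattice (tors A) (spine (tors A)))"
proof -
  interpret findim_algebra K A by fact
  interpret length_ring A dim by (rule length_ring_dim)
  obtain Q where "brick_representatives A dim Q"
    by (rule brick_representatives_exist[OF assms(2)])
  then interpret brick_representatives A dim Q .
  have dir: "brick_directed A \<longleftrightarrow> H.acyclic_rel"
    using brick_directed_acyclic acyclic_brick_directed by blast
  have "{T \<in> carrier (tors A). H.upclosed (T \<inter> Q)} = {T. brick_splitting A T}"
    by (auto simp: brick_splitting_iff tors_def)
  then have "spine (tors A) = {T. brick_splitting A T} \<and>
      distributive_sublattice (tors A) (spine (tors A))" if "brick_directed A"
    using H.spine_eq_upclosed H.distributive_sublattice_upclosed that dir by simp
  then show ?thesis
    using dir H.acyclic_iff_left_modular H.acyclic_iff_extremal H.acyclic_iff_trim by blast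
qed

end
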